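(* Let $\lambda>0$ and let $a=a(\lambda)$. The measure $\mu_\lambda$ has the form $$\mu_\lambda(dx)=\frac{\lambda(2-a^2)}{\lambda^2a+2\lambda+2a}\cdot\delta_{a+\lambda}(dx)-\frac{\Im G_\lambda(x)}{\pi}\,dx,$$ where $\delta_y$ is the Dirac measure at $y\in\mathbb{R}$. Moreover, the absolutely continuous part of $\mu_\lambda$ is supported on $[\lambda-\sqrt{2+\gamma_0},\ \lambda+\sqrt{2+\gamma_0}]$.
   Context: Notation: $\mathbb{N}=\{0,1,2,\dots\}$, $[n]=\{1,\dots,n\}$, $\mathbb{C}_+=\{z\in\mathbb{C}:\Im z>0\}$. The measure $\mu_\lambda$. A finite word $(i_1,\dots,i_n)$ over $\mathbb{N}$ is a V-word if $n=0$ or there is $m\in[n]$ with $i_1>\dots>i_m<\dots<i_n$; let $\mathcal{V}$ be the set of V-words. The discrete V-monotone Fock space $\mathcal{F}$ is the complex Hilbert space with orthonormal basis $(e_w)_{w\in\mathcal V}$; $\Omega=e_{()}$, and $e_w=0$ for words $w\notin\mathcal V$. For $i\in\mathbb{N}$ the bounded operators $A_i^+,A_i^-,A_i^\circ$ on $\mathcal F$ are determined by: $A_i^+e_w=e_{(i,w)}$ (concatenation) for $w\in\mathcal V$; $A_i^-\Omega=A_i^\circ\Omega=0$; and for $w=(j,w_0)\in\mathcal V$, $A_i^-e_w=\delta_{i,j}e_{w_0}$ and $A_i^\circ e_w=\delta_{i,j}e_w$. Put $\varphi(b)=\langle b\,\Omega,\Omega\rangle$ and $S_N(\lambda)=\sum_{i=1}^N\big(\frac{A_i^++A_i^-}{\sqrt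 N}+\lambda A_i^\circ\big)$ for $N\ge1$. Then $\mu_\lambda$ is the limit distribution of $S_N(\lambda)$ as $N\to\infty$: the unique (compactly supported) probability measure on $\mathbb{R}$ with $\int x^n\mu_\lambda(dx)=\lim_{N\to\infty}\varphi(S_N(\lambda)^n)$ for all $n\in\mathbb{N}$. The function $G$. Let $T_0:[0,\infty)\to\mathbb{R}$, $T_0(s)=\int_s^1\frac{t}{t^2-t+1}dt$; it is strictly decreasing with range $(-\infty,\sqrt3\pi/9]$ and inverse $T_0^{-1}$. $\mathrm{Log}$ and $\mathrm{Arg}$ are the principal logarithm and argument, $\mathrm{Arg}\in(-\pi,\pi]$. Let $\Theta=\{(\eta,\xi)\in\mathbb{R}^2:-\pi\le\eta\le0,\ \xi<-\eta\}$ and for $(\eta,\xi)\in\Theta$ $$g(\eta,\xi)=\frac{\sqrt3\,i\,(e^{-\sqrt3(\eta+\xi)+i\xi}-1)}{1-e^{-2\sqrt3(\eta+\xi)}}+\frac{1+\sqrt3 i}{2},$$ $$H(\eta,\xi)=-\frac{\sqrt3}{6}\Big(\mathrm{Arg}\big(e^{-\sqrt3(\eta+\xi)+i\xi}-1\big)-\mathrm{Arg}\big(g(\eta,\xi)-\tfrac{1-\sqrt3 i}{2}\big)+2\Big\lceil\frac{\xi-\pi}{2\pi}\Big\rceil\pi+\frac{\pi}{6}\Big)-\frac{\ln|g(\eta,\xi)^2-g(\eta,\xi)+1|}{2}+\frac{i\eta}{2}.$$ On $D=\{w\in\mathbb{C}:-\pi/2\le\Im w\le0\}$ define $T^{-1}:D\to\mathbb{C}$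 by $T^{-1}(w)=T_0^{-1}(w)$ if $w\in(-\infty,\sqrt3\pi/9]$, and $T^{-1}(w)=g(\eta,\xi)$ if $w=H(\eta,\xi)\in D\setminus(-\infty,\sqrt3\pi/9]$ with $(\eta,\xi)\in\Theta$ (this is well defined on $D$; known from earlier work). For $z\in(\mathbb{C}_+\cup\mathbb{R})\setminus\{-\sqrt2,0,\sqrt2\}$ let $$W(z)=\begin{cases}\frac12\mathrm{Log}\big(1+\frac{2}{z^2-2}\big)& z\notin(0,\sqrt2),\\ \frac12\ln\big(\frac{2}{2-z^2}-1\big)-\frac{i\pi}{2}& z\in(0,\sqrt2).\end{cases}$$ Let $\gamma_0=\frac{2}{e^{2\sqrt3\pi/9}-1}$. Then $G:\mathbb{C}_+\cup(\mathbb{R}\setminus\{\pm\sqrt{2+\gamma_0}\})\to\mathbb{C}$ is defined by $G(z)=\frac{1}{z\,T^{-1}(W(z))}$ if $\Re z\ge0$, $z\ne0,\sqrt2$; $G(0)=-\frac{\sqrt2 i}{2}e^{\sqrt3\pi/9}$; $G(\sqrt2)=\frac{\sqrt2-\sqrt6 i}{4}$; and $G(z)=-\overline{G(-\overline z)}$ if $\Re z<0$. The number $a(\lambda)$ and the function $G_\lambda$. For $\lambda>0$, $a(\lambda)$ is the unique solution $x$ of $1+\lambda G(x)=0$ in $\mathbb{R}\setminus\{\pm\sqrt{2+\gamma_0}\}$; it satisfies $a(\lambda)<-\sqrt{2+\gamma_0}$. The function $G_\lambda:\mathbb{C}_+\cup(\mathbb{R}\setminus\{a(\lambda)+\lambda\})\to\mathbb{C}$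 is defined by $G_\lambda(z)=\frac{G(z-\lambda)}{1+\lambda G(z-\lambda)}$ for $z\ne\lambda\pm\sqrt{2+\gamma_0}$ and $G_\lambda(\lambda\pm\sqrt{2+\gamma_0})=1/\lambda$. *)

theory Defs
  imports "HOL-Probability.Probability"
begin

text \<open>
  Conventions: the partial functions of the text are total here. Outside the stated
  domains (and where a denominator vanishes, e.g. at \<open>\<plusminus>sqrt (2 + gamma0)\<close> for \<open>Gfun\<close>) their
  values carry no meaning. Functions on \<open>\<complex>\<^sub>+ \<union> \<real>\<close> are functions on \<open>complex\<close>.
\<close>

section \<open>The discrete V-monotone Fock space\<close>

definition V_word :: "nat list \<Rightarrow> bool" where
  "V_word w \<longleftrightarrow> w = [] \<or>
     (\<exists>m\<in>{1..length w}. sorted_wrt (>) (take m w) \<and> sorted_wrt (<) (drop (m - 1) w))"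

text \<open>
  The Hilbert space is realised as the square-summable functions on V-words; functions
  are extended by 0 to all words, so a vector is its family of coordinates with respect
  to the basis \<open>e\<^sub>w\<close>. The operators are given by their coordinates; the lemmas below
  recover their values on the basis and show that they are contractions of the space.
\<close>

definition fock :: "(nat list \<Rightarrow> complex) set" where
  "fock = {f. (\<forall>w. \<not> V_word w \<longrightarrow> f w = 0) \<and> (\<lambda>w. (cmod (f w))\<^sup>2) summable_on UNIV}"

definition fock_inner :: "(nat list \<Rightarrow> complex) \<Rightarrow> (nat list \<Rightarrow> complex) \<Rightarrow> complex" where
  "fock_inner f h = (\<Sum>\<^sub>\<infinity>w. f w * cnj (h w))"

definition fock_basis :: "nat list \<Rightarrow> nat list \<Rightarrow> complex" where
  "fock_basis w = (\<lambda>v. if v = w \<and> V_word w then 1 else 0)"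

definition vacuum :: "nat list \<Rightarrow> complex" where
  "vacuum = fock_basis []"

definition creation :: "nat \<Rightarrow> (nat list \<Rightarrow> complex) \<Rightarrow> nat list \<Rightarrow> complex" where
  "creation i f = (\<lambda>v. if V_word v \<and> v \<noteq> [] \<and> hd v = i then f (tl v) else 0)"

definition annihilation :: "nat \<Rightarrow> (nat list \<Rightarrow> complex) \<Rightarrow> nat list \<Rightarrow> complex" where
  "annihilation i f = (\<lambda>v. if V_word (i # v) then f (i # v) else 0)"

definition conservation :: "nat \<Rightarrow> (nat list \<Rightarrow> complex) \<Rightarrow> nat list \<Rightarrow> complex" where
  "conservation i f = (\<lambda>v. if v \<noteq> [] \<and> hd v = i then f v else 0)"

lemma V_word_ConsD: "V_word (i # w) \<Longrightarrow> V_word w"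
proof -
  assume "V_word (i # w)"
  then obtain m where m: "m \<in> {1..Suc (length w)}" "sorted_wrt (>) (take m (i # w))"
    "sorted_wrt (<) (drop (m - 1) (i # w))"
    by (auto simp: V_word_def)
  show "V_word w"
  proof (cases "w = []")
    case True then show ?thesis by (simp add: V_word_def)
  next
    case ne: False
    show ?thesis
    proof (cases "m = 1")
      case True
      then have "sorted_wrt (<) w" using m(3) by simp
      then show ?thesis using ne
        by (auto simp: V_word_def Suc_le_eq take_Suc neq_Nil_conv intro!: bexI[of _ 1])
    next
      case False
      then obtain k where k: "m = Suc (Suc k)" using m(1)
        by (metis atLeastAtMost_iff not0_implies_Suc not_one_le_zero One_nat_def)
      then show ?thesis using m ne
        by (auto simp: V_word_def intro!: bexI[of _ "Suc k"])
    qed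
  qed
qed

lemma creation_basis:
  "V_word w \<Longrightarrow> creation i (fock_basis w) = fock_basis (i # w)"
  by (auto simp: creation_def fock_basis_def fun_eq_iff neq_Nil_conv)

lemma annihilation_basis:
  "annihilation i (fock_basis []) = (\<lambda>_. 0)"
  "V_word (j # w) \<Longrightarrow> annihilation i (fock_basis (j # w)) = (if i = j then fock_basis w else (\<lambda>_. 0))"
  using V_word_ConsD[of j w] by (auto simp: annihilation_def fock_basis_def fun_eq_iff)

lemma conservation_basis:
  "conservation i (fock_basis []) = (\<lambda>_. 0)"
  "V_word (j # w) \<Longrightarrow>
     conservation i (fock_basis (j # w)) = (if i = j then fock_basis (j # w) else (\<lambda>_. 0))"
  by (auto simp: conservation_def fock_basis_def fun_eq_iff)

lemma fock_basis_orthonormal: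
  "V_word v \<Longrightarrow> V_word w \<Longrightarrow> fock_inner (fock_basis v) (fock_basis w) = (if v = w then 1 else 0)"
proof -
  assume "V_word v" "V_word w"
  have "fock_inner (fock_basis v) (fock_basis w) =
    (\<Sum>\<^sub>\<infinity>u\<in>{v}. fock_basis v u * cnj (fock_basis w u))"
    unfolding fock_inner_def by (rule infsum_cong_neutral) (auto simp: fock_basis_def)
  then show ?thesis using \<open>V_word v\<close> \<open>V_word w\<close> by (auto simp: fock_basis_def)
qed

lemma fock_contraction_aux:
  assumes f: "f \<in> fock" and inj: "inj_on p S"
    and eq: "\<And>v. v \<in> S \<Longrightarrow> h v = f (p v)" "\<And>v. v \<notin> S \<Longrightarrow> h v = 0"
    and V: "\<And>v. \<not> V_word v \<Longrightarrow> h v = 0"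
  shows "h \<in> fock \<and> (\<Sum>\<^sub>\<infinity>w. (cmod (h w))\<^sup>2) \<le> (\<Sum>\<^sub>\<infinity>w. (cmod (f w))\<^sup>2)"
proof -
  let ?F = "\<lambda>w. (cmod (f w))\<^sup>2" and ?H = "\<lambda>w. (cmod (h w))\<^sup>2"
  have sf: "?F summable_on UNIV" using f by (simp add: fock_def)
  have sp: "?F summable_on (p ` S)" using sf by (rule summable_on_subset_banach) simp
  have "(?F \<circ> p) summable_on S" using sp summable_on_reindex[OF inj, of ?F] by simp
  moreover have "(?F \<circ> p) summable_on S \<longleftrightarrow> ?H summable_on UNIV"
    by (rule summable_on_cong_neutral) (auto simp: eq)
  ultimately have "?H summable_on UNIV" by simp
  moreover have "infsum ?H UNIV = infsum (?F \<circ> p) S"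
    by (rule infsum_cong_neutral) (auto simp: eq)
  moreover have "infsum (?F \<circ> p) S = infsum ?F (p ` S)"
    using infsum_reindex[OF inj, of ?F] by simp
  moreover have "infsum ?F (p ` S) \<le> infsum ?F UNIV"
    by (rule infsum_mono_neutral) (use sp sf in auto)
  ultimately show ?thesis using V by (auto simp: fock_def)
qed

lemma creation_contraction:
  "f \<in> fock \<Longrightarrow> creation i f \<in> fock \<and>
     (\<Sum>\<^sub>\<infinity>w. (cmod (creation i f w))\<^sup>2) \<le> (\<Sum>\<^sub>\<infinity>w. (cmod (f w))\<^sup>2)"
  by (rule fock_contraction_aux[where p = tl and S = "{v. V_word v \<and> v \<noteq> [] \<and> hd v = i}"])
     (auto simp: creation_def inj_on_def neq_Nil_conv)

lemma annihilation_contraction: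
  "f \<in> fock \<Longrightarrow> annihilation i f \<in> fock \<and>
     (\<Sum>\<^sub>\<infinity>w. (cmod (annihilation i f w))\<^sup>2) \<le> (\<Sum>\<^sub>\<infinity>w. (cmod (f w))\<^sup>2)"
  by (rule fock_contraction_aux[where p = "(#) i" and S = "{v. V_word (i # v)}"])
     (auto simp: annihilation_def dest: V_word_ConsD)

lemma conservation_contraction:
  "f \<in> fock \<Longrightarrow> conservation i f \<in> fock \<and>
     (\<Sum>\<^sub>\<infinity>w. (cmod (conservation i f w))\<^sup>2) \<le> (\<Sum>\<^sub>\<infinity>w. (cmod (f w))\<^sup>2)"
  by (rule fock_contraction_aux[where p = id and S = "{v. v \<noteq> [] \<and> hd v = i}"])
     (auto simp: conservation_def fock_def)

definition vacuum_state :: "((nat list \<Rightarrow> complex) \<Rightarrow> nat list \<Rightarrow> complex) \<Rightarrow> complex" where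
  "vacuum_state b = fock_inner (b vacuum) vacuum"

definition S_op :: "real \<Rightarrow> nat \<Rightarrow> (nat list \<Rightarrow> complex) \<Rightarrow> nat list \<Rightarrow> complex" where
  "S_op lam N f = (\<lambda>w. \<Sum>i=1..N.
     (creation i f w + annihilation i f w) / of_real (sqrt (real N))
       + of_real lam * conservation i f w)"

section \<open>The limit distribution\<close>

definition is_limit_distribution :: "real \<Rightarrow> real measure \<Rightarrow> bool" where
  "is_limit_distribution lam M \<longleftrightarrow>
     prob_space M \<and> sets M = sets borel \<and> (\<exists>R. AE x in M. \<bar>x\<bar> \<le> R) \<and>
     (\<forall>n. (\<lambda>N. vacuum_state (S_op lam N ^^ n)) \<longlonglongrightarrow> of_real (\<integral>x. x ^ n \<partial>M))"

definition mu :: "real \<Rightarrow> real measure" where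
  "mu lam = (THE M. is_limit_distribution lam M)"

text \<open>The absolutely continuous part in the Lebesgue decomposition with respect to \<open>lborel\<close>;
  the singular part is the restriction of \<open>M\<close> to a Lebesgue null set.\<close>

definition is_ac_part :: "real measure \<Rightarrow> real measure \<Rightarrow> bool" where
  "is_ac_part M A \<longleftrightarrow> sets A = sets borel \<and> absolutely_continuous lborel A \<and>
     (\<exists>N\<in>null_sets lborel. \<forall>B\<in>sets borel. emeasure M B = emeasure A B + emeasure M (B \<inter> N))"

definition ac_part :: "real measure \<Rightarrow> real measure" where
  "ac_part M = (THE A. is_ac_part M A)"

lemma is_ac_part_unique:
  assumes "is_ac_part M A" "is_ac_part M A'"
  shows "A = A'"
proof -
  have key: "emeasure A B = emeasure M (B - N)"
    if A: "is_ac_part M A" and NN: "N \<in> null_sets lborel" "N' \<in> null_sets lborel" "N' \<subseteq> N"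
      and eq: "\<forall>B\<in>sets borel. emeasure M B = emeasure A B + emeasure M (B \<inter> N')"
      and B: "B \<in> sets borel" for A N N' B
  proof -
    have sA: "sets A = sets borel" and "N \<in> null_sets A"
      using A NN by (auto simp: is_ac_part_def absolutely_continuous_def)
    then have "emeasure A B = emeasure A (B - N)"
      using B by (simp add: emeasure_Diff_null_set)
    moreover have "(B - N) \<inter> N' = {}" using NN by auto
    moreover have "B - N \<in> sets borel" using B NN by auto
    ultimately show ?thesis using eq by auto
  qed
  from assms obtain N N' where N: "N \<in> null_sets lborel" "N' \<in> null_sets lborel"
    and eq: "\<forall>B\<in>sets borel. emeasure M B = emeasure A B + emeasure M (B \<inter> N)"
      "\<forall>B\<in>sets borel. emeasure M B = emeasure A' B + emeasure M (B \<inter> N')"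
    unfolding is_ac_part_def by blast
  have U: "N \<union> N' \<in> null_sets lborel" using N by auto
  show ?thesis
  proof (rule measure_eqI)
    show "sets A = sets A'" using assms by (simp add: is_ac_part_def)
    fix B assume "B \<in> sets A"
    then have "B \<in> sets borel" using assms by (simp add: is_ac_part_def)
    then show "emeasure A B = emeasure A' B"
      using key[OF assms(1) U N(1) _ eq(1)] key[OF assms(2) U N(2) _ eq(2)] by simp
  qed
qed

lemma ac_part_eqI: "is_ac_part M A \<Longrightarrow> ac_part M = A"
  unfolding ac_part_def by (rule the_equality) (auto intro: is_ac_part_unique)

section \<open>The functions \<open>G\<close> and \<open>G\<^sub>\<lambda>\<close>\<close>

definition T0 :: "real \<Rightarrow> real" where
  "T0 s = (LBINT t=s..1. t / (t\<^sup>2 - t + 1))" \<comment> \<open>oriented integral, so negative for \<open>s > 1\<close>\<close>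

definition T0_inv :: "real \<Rightarrow> real" where
  "T0_inv = the_inv_into {0..} T0"

definition Theta :: "(real \<times> real) set" where
  "Theta = {(eta, xi). - pi \<le> eta \<and> eta \<le> 0 \<and> xi < - eta}"

definition Efun :: "real \<Rightarrow> real \<Rightarrow> complex" where
  "Efun eta xi = exp (of_real (- sqrt 3 * (eta + xi)) + \<i> * of_real xi)"

definition gfun :: "real \<Rightarrow> real \<Rightarrow> complex" where
  "gfun eta xi =
     of_real (sqrt 3) * \<i> * (Efun eta xi - 1) / of_real (1 - exp (- 2 * sqrt 3 * (eta + xi)))
       + (1 + of_real (sqrt 3) * \<i>) / 2"

definition Hfun :: "real \<Rightarrow> real \<Rightarrow> complex" where
  "Hfun eta xi =
     of_real (- (sqrt 3 / 6) *
        (Arg (Efun eta xi - 1) - Arg (gfun eta xi - (1 - of_real (sqrt 3) * \<i>) / 2)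
          + 2 * of_int \<lceil>(xi - pi) / (2 * pi)\<rceil> * pi + pi / 6)
       - ln (cmod ((gfun eta xi)\<^sup>2 - gfun eta xi + 1)) / 2)
     + \<i> * of_real eta / 2"

definition T_inv :: "complex \<Rightarrow> complex" where
  "T_inv w =
     (if w \<in> \<real> \<and> Re w \<le> sqrt 3 * pi / 9 then of_real (T0_inv (Re w))
      else (THE v. \<exists>(eta, xi)\<in>Theta. w = Hfun eta xi \<and> v = gfun eta xi))"

definition Wfun :: "complex \<Rightarrow> complex" where
  "Wfun z =
     (if z \<in> \<real> \<and> 0 < Re z \<and> Re z < sqrt 2
      then of_real (ln (2 / (2 - (Re z)\<^sup>2) - 1) / 2) - \<i> * of_real pi / 2
      else Ln (1 + 2 / (z\<^sup>2 - 2)) / 2)"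

definition gamma0 :: real where
  "gamma0 = 2 / (exp (2 * sqrt 3 * pi / 9) - 1)"

definition G_right :: "complex \<Rightarrow> complex" where
  "G_right z =
     (if z = 0 then - (of_real (sqrt 2) * \<i> / 2) * of_real (exp (sqrt 3 * pi / 9))
      else if z = of_real (sqrt 2) then (of_real (sqrt 2) - of_real (sqrt 6) * \<i>) / 4
      else 1 / (z * T_inv (Wfun z)))"

definition Gfun :: "complex \<Rightarrow> complex" where
  "Gfun z = (if 0 \<le> Re z then G_right z else - cnj (G_right (- cnj z)))"

definition a_lam :: "real \<Rightarrow> real" where
  "a_lam lam = (THE x. x \<notin> {- sqrt (2 + gamma0), sqrt (2 + gamma0)} \<and>
      1 + of_real lam * Gfun (of_real x) = 0)"

definition G_lam :: "real \<Rightarrow> complex \<Rightarrow> complex" where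
  "G_lam lam z =
     (if z = of_real (lam - sqrt (2 + gamma0)) \<or> z = of_real (lam + sqrt (2 + gamma0))
      then 1 / of_real lam
      else Gfun (z - of_real lam) / (1 + of_real lam * Gfun (z - of_real lam)))"

end

theory Submission
  imports Defs "HOL-Complex_Analysis.Complex_Analysis" "HOL-Real_Asymp.Real_Asymp"
begin

text \<open>
  On V-words over \<open>[N]\<close> the operator \<open>S\<^sub>N(\<lambda>)\<close> is the rescaled adjacency operator of a rooted
  tree plus \<open>\<lambda>\<close> times the projection off the root. Its vacuum resolvent is an explicit product
  along words, whose factors obey an Euler scheme for \<open>u' = 1/u\<close>, \<open>w' = 1/u - 1/w\<close>; solving
  the limit equation gives \<open>1/(\<lambda> + y T\<^sub>0\<inverse>(W(y)))\<close> at \<open>z = y + \<lambda>\<close> for large real \<open>y\<close>.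

  The function \<open>K = 1/G\<close> is extended to the closed upper half-plane through the coordinate
  \<open>l = log((r - \<omega>')/(r - \<omega>))\<close>, where \<open>\<omega>, \<omega>'\<close> are the roots of \<open>t\<^sup>2 - t + 1\<close>. In it the
  primitive of \<open>-t/(t\<^sup>2 - t + 1)\<close> has a derivative of positive real part on \<open>Re l > 0\<close>, hence is
  injective there, and \<open>(\<eta>, \<xi>) \<in> \<Theta>\<close> is merely a parametrisation of this half-plane. As
  \<open>Im K(z) \<ge> Im z\<close>, the function \<open>(z - a)/(K(z) + \<lambda>)\<close> is continuous on the closed half-plane, and
  Cauchy's theorem writes \<open>1/(K + \<lambda>)\<close> as the Stieltjes transform of the claimed measure. Moments
  follow by comparing power series in \<open>1/z\<close>.
\<close>

section \<open>The uniformising coordinate\<close>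

text \<open>Two boundary phenomena shape the argument. \<open>T_cov\<close> has a critical point on
  the imaginary axis, at \<open>4 * pi / 3\<close>, where r = 0; its value
  \<open>sqrt 3 * pi / 9\<close> is reached by W exactly at \<open>sqrt (2 + gamma0)\<close>, so
  that K vanishes there and G is infinite. At this fold no holomorphic inverse exists and continuity
  comes from a compactness argument, while at every other point of the closed strip the inverse
  extends holomorphically to a neighbourhood. Secondly, \<open>1 / (K + \<lambda>)\<close> has a
  pole on the boundary line, which the factor z - a removes; the quotient then tends to 1 at
  infinity, so letting the point of evaluation tend to a shows that atom and density together have
  mass 1. The resolvents are compared only at large real points, where the letters of a word
  contribute positive factors of size at most 1; the bound \<open>(2 + \<lambda>) ^ n\<close> on the
  moments, uniform in N, is what lets convergence at these points pass to every coefficient.\<close>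

text \<open>\<open>r_cov l\<close> solves \<open>exp l = (r - \<omega>')/(r - \<omega>)\<close> for \<open>\<omega>, \<omega>' = (1 \<plusminus> \<i>\<surd>3)/2\<close>, and
  \<open>T_cov\<close> is \<open>T\<^sub>0\<close> continued analytically in \<open>l\<close>; \<open>r = 1\<close>, \<open>T\<^sub>0 = 0\<close> sits at \<open>l = 2\<pi>\<i>/3\<close>.\<close>

definition r_cov :: "complex \<Rightarrow> complex" where
  "r_cov l = (1 + of_real (sqrt 3) * \<i>) / 2 + \<i> * of_real (sqrt 3) / (exp l - 1)"

definition T_cov :: "complex \<Rightarrow> complex" where
  "T_cov l = l / 2 + Ln (1 - exp (- l)) - \<i> * l / of_real (2 * sqrt 3)
     - (\<i> * of_real (pi / 2) + of_real (ln 3 / 2 + sqrt 3 * pi / 9))"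

text \<open>Here \<open>1 - exp (- l)\<close> lies in the open right half-plane, so the principal
  logarithm in \<open>T_cov\<close> meets no cut. Besides the half-plane \<open>Re l > 0\<close> the
  set contains the axis between 0 and \<open>2 * pi\<close>, and being open it leaves room for local
  inverses around points of that segment.\<close>

definition T_dom :: "complex set" where
  "T_dom = {l. Re (exp (- l)) < 1}"

lemma open_T_dom: "open T_dom"
  unfolding T_dom_def by (intro open_Collect_less continuous_intros)

lemma Re_pos_T_dom: "Re l > 0 \<Longrightarrow> l \<in> T_dom"
proof -
  assume "Re l > 0"
  have "Re (exp (- l)) \<le> cmod (exp (- l))" by (rule complex_Re_le_cmod)
  also have "\<dots> < 1" using \<open>Re l > 0\<close> by simp
  finally show ?thesis by (simp add: T_dom_def)
qed

lemma axis_T_dom: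
  assumes "0 < t" "t < 2 * pi" shows "\<i> * of_real t \<in> T_dom"
proof -
  have "cos t \<noteq> 1"
  proof
    assume "cos t = 1"
    then obtain n :: int where n: "t = of_int n * 2 * pi" using cos_one_2pi_int by blast
    from assms n have "0 < real_of_int n" "real_of_int n < 1" by (auto simp: zero_less_mult_iff)
    then have "0 < n" "n < 1" by (simp_all only: of_int_0_less_iff of_int_less_1_iff)
    then show False by simp
  qed
  then have "cos t < 1" using cos_le_one[of t] by linarith
  then show ?thesis by (simp add: T_dom_def exp_eq_polar Re_exp)
qed

lemma T_dom_exp_ne: "l \<in> T_dom \<Longrightarrow> exp l \<noteq> 1"
  by (auto simp: T_dom_def exp_minus)

lemma T_dom_Ln: "l \<in> T_dom \<Longrightarrow> 1 - exp (- l) \<notin> \<real>\<^sub>\<le>\<^sub>0"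
  by (auto simp: T_dom_def complex_nonpos_Reals_iff)

text \<open>The reason for this coordinate:
  \<open>dr/dl = \<i> * (r\<^sup>2 - r + 1) / sqrt 3\<close> cancels the denominator of the
  integrand \<open>- r / (r\<^sup>2 - r + 1)\<close>, and the derivative becomes a constant multiple
  of r. Its real part is thus governed by Im r alone.\<close>

lemma DERIV_T_cov:
  assumes "l \<in> T_dom"
  shows "(T_cov has_field_derivative - \<i> * r_cov l / of_real (sqrt 3)) (at l)"
proof -
  have ne: "exp l \<noteq> 1" using T_dom_exp_ne[OF assms] .
  have s: "complex_of_real (sqrt 3) \<noteq> 0" by simp
  have s2: "complex_of_real (sqrt 3) * complex_of_real (sqrt 3) = 3"
    by (simp flip: of_real_mult)
  have e: "exp (- l) / (1 - exp (- l)) = 1 / (exp l - 1)"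
    using ne by (simp add: exp_minus field_simps)
  have gen: "((\<lambda>l. l / 2 + Ln (1 - exp (- l)) - l * c - k) has_field_derivative
      1/2 + exp (- l) / (1 - exp (- l)) - c) (at l)" for c k
    using T_dom_Ln[OF assms] by (auto intro!: derivative_eq_intros) (metis divide_inverse mult.commute)
  have eq: "T_cov = (\<lambda>l. l / 2 + Ln (1 - exp (- l)) - l * (\<i> / of_real (2 * sqrt 3))
      - (\<i> * of_real (pi / 2) + of_real (ln 3 / 2 + sqrt 3 * pi / 9)))"
    by (simp add: T_cov_def fun_eq_iff mult.commute)
  have "(T_cov has_field_derivative
      1/2 + exp (- l) / (1 - exp (- l)) - \<i> / of_real (2 * sqrt 3)) (at l)"
    unfolding eq by (rule gen)
  also have "1/2 + exp (- l) / (1 - exp (- l)) - \<i> / of_real (2 * sqrt 3) =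
     - \<i> * r_cov l / of_real (sqrt 3)"
    unfolding e r_cov_def using ne s s2 by (simp add: field_simps)
  finally show ?thesis .
qed

lemma T_cov_holomorphic: "T_cov holomorphic_on T_dom"
  using DERIV_T_cov open_T_dom by (metis holomorphic_on_open)

lemma T_cov_continuous: "continuous_on T_dom T_cov"
  by (rule holomorphic_on_imp_continuous_on[OF T_cov_holomorphic])

lemma r_cov_holomorphic: "r_cov holomorphic_on T_dom"
  unfolding r_cov_def by (intro holomorphic_intros) (auto dest: T_dom_exp_ne)

lemma r_cov_continuous: "continuous_on T_dom r_cov"
  by (rule holomorphic_on_imp_continuous_on[OF r_cov_holomorphic])

text \<open>\<open>Re l > 0\<close> says \<open>cmod (exp l) > 1\<close>, that is, r is closer to
  \<omega> than to its conjugate \<omega>'; these points form the upper half-plane.\<close>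

lemma Im_r_cov_pos:
  assumes "Re l > 0" shows "Im (r_cov l) > 0"
proof -
  have ne: "exp l \<noteq> 1" using T_dom_exp_ne[OF Re_pos_T_dom[OF assms]] .
  define x y where "x = Re (exp l)" and "y = Im (exp l)"
  have m: "x\<^sup>2 + y\<^sup>2 = (exp (Re l))\<^sup>2" unfolding x_def y_def
    by (metis cmod_power2 norm_exp_eq_Re)
  have gt: "x\<^sup>2 + y\<^sup>2 > 1" unfolding m using assms by (simp add: one_less_power)
  have d: "(x - 1)\<^sup>2 + y\<^sup>2 > 0"
    using ne unfolding x_def y_def by (auto simp: complex_eq_iff sum_power2_gt_zero_iff)
  have "Im (r_cov l) = sqrt 3 / 2 + sqrt 3 * ((x - 1) / ((x - 1)\<^sup>2 + y\<^sup>2))"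
    unfolding r_cov_def x_def y_def by (simp add: Im_divide)
  also have "\<dots> = sqrt 3 / 2 * ((x\<^sup>2 + y\<^sup>2 - 1) / ((x - 1)\<^sup>2 + y\<^sup>2))"
    using d by (simp add: field_simps power2_eq_square)
  also have "\<dots> > 0" using gt d by simp
  finally show ?thesis .
qed

lemma Re_dTcov: "Re (- \<i> * r_cov l / of_real (sqrt 3)) = Im (r_cov l) / sqrt 3"
  by (simp add: Re_divide_of_real)

lemma Im_dTcov: "Im (- \<i> * r_cov l / of_real (sqrt 3)) = - Re (r_cov l) / sqrt 3"
  by (simp add: Im_divide_of_real)

text \<open>The Noshiro--Warschawski criterion: \<open>Re T_cov' > 0\<close> on the right half-plane.\<close>

lemma T_cov_neq:
  assumes l1: "Re l1 > 0" and l2: "Re l2 \<ge> 0" "l2 \<in> T_dom" and ne: "l1 \<noteq> l2"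
  shows "T_cov l1 \<noteq> T_cov l2"
proof
  assume eq: "T_cov l1 = T_cov l2"
  define d where "d = l1 - l2"
  define p where "p = (\<lambda>t::real. l2 + of_real t * d)"
  define f where "f = (\<lambda>t::real. Re (T_cov (p t) * cnj d))"
  have dom: "p t \<in> T_dom" if "0 \<le> t" "t \<le> 1" for t
  proof (cases "t = 0")
    case True then show ?thesis using l2 by (simp add: p_def)
  next
    case False
    have "Re (p t) = (1 - t) * Re l2 + t * Re l1" by (simp add: p_def d_def algebra_simps)
    also have "\<dots> > 0" using False that l1 l2 by (intro add_nonneg_pos) auto
    finally show ?thesis by (rule Re_pos_T_dom)
  qed
  have dp: "Re (p t) > 0" if "0 < t" "t < 1" for t
  proof -
    have "Re (p t) = (1 - t) * Re l2 + t * Re l1" by (simp add: p_def d_def algebra_simps)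
    also have "\<dots> > 0" using that l1 l2 by (intro add_nonneg_pos) auto
    finally show ?thesis .
  qed
  \<comment> \<open>The derivative of f along the segment is \<open>(cmod d)\<^sup>2\<close> times
    the real part of the derivative of \<open>T_cov\<close>. Since \<open>l2\<close> may lie on the
    axis, positivity is available only strictly inside the segment, which suffices together with
    continuity at the ends.\<close>
  have "f 0 < f 1"
  proof (rule DERIV_pos_imp_increasing_open[of 0 1])
    fix t :: real assume t: "0 < t" "t < 1"
    let ?D = "- \<i> * r_cov (p t) / of_real (sqrt 3)"
    have "(T_cov \<circ> p has_vector_derivative d * ?D) (at t)"
    proof (rule field_vector_diff_chain_at)
      show "(p has_vector_derivative d) (at t)" unfolding p_def
        by (auto intro!: derivative_eq_intros)
      show "(T_cov has_field_derivative ?D) (at (p t))"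
        by (rule DERIV_T_cov[OF dom]) (use t in auto)
    qed
    then have "((\<lambda>t. T_cov (p t) * cnj d) has_vector_derivative (d * ?D) * cnj d) (at t)"
      by (auto simp: o_def intro!: derivative_eq_intros)
    then have "(f has_real_derivative Re ((d * ?D) * cnj d)) (at t)"
      unfolding f_def has_real_derivative_iff_has_vector_derivative
      by (rule bounded_linear.has_vector_derivative[OF bounded_linear_Re])
    moreover have "Re ((d * ?D) * cnj d) = (cmod d)\<^sup>2 * (Im (r_cov (p t)) / sqrt 3)"
    proof -
      have "(d * ?D) * cnj d = of_real ((cmod d)\<^sup>2) * ?D"
        using complex_norm_square[of d] by (simp add: mult_ac)
      then show ?thesis
        by (simp only: times_complex.sel Re_complex_of_real Im_complex_of_real Re_dTcov)
    qed
    moreover have "\<dots> > 0" using Im_r_cov_pos[OF dp[OF t]] ne by (simp add: d_def)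
    ultimately show "\<exists>y. DERIV f t :> y \<and> 0 < y" by metis
  next
    show "continuous_on {0..1} f" unfolding f_def
      by (intro continuous_intros continuous_on_compose2[OF T_cov_continuous])
         (auto simp: p_def[abs_def] intro!: continuous_intros dom[unfolded p_def])
  qed simp
  then show False using eq by (simp add: f_def p_def d_def)
qed

text \<open>The coordinate of \<open>g(\<eta>, \<xi>)\<close>. The ceiling in \<open>H\<close> makes \<open>Arg(E - 1)\<close> continuous in \<open>\<xi>\<close>,
  and its continuous branch is \<open>\<xi> + Arg(1 - 1/E)\<close>.\<close>

definition l_coord :: "real \<Rightarrow> real \<Rightarrow> complex" where
  "l_coord eta xi = Complex (- sqrt 3 * (eta + xi)) (pi - xi - 2 * Arg (1 - 1 / Efun eta xi))"

lemma Efun_facts: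
  assumes "xi < - eta"
  defines "E \<equiv> Efun eta xi" and "s \<equiv> - sqrt 3 * (eta + xi)"
  shows "s > 0" "cmod E = exp s" "cmod E > 1" "E \<noteq> 0" "E \<noteq> 1"
    "Re (1 - 1 / E) > 0" "\<bar>Arg (1 - 1 / E)\<bar> < pi / 2" "1 - 1 / E \<noteq> 0"
    "E = of_real (exp s) * exp (\<i> * of_real xi)"
proof -
  show s: "s > 0" unfolding s_def using assms(1) by (simp add: mult_less_0_iff)
  show c: "cmod E = exp s" by (simp add: E_def s_def Efun_def)
  then show c1: "cmod E > 1" using s by simp
  then show "E \<noteq> 0" "E \<noteq> 1" by auto
  have "Re (1 / E) \<le> cmod (1 / E)" by (rule complex_Re_le_cmod)
  also have "\<dots> < 1" using c1 by (auto simp: norm_divide divide_less_eq_1)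
  finally show r: "Re (1 - 1 / E) > 0" by simp
  show n0: "1 - 1 / E \<noteq> 0" using r by auto
  show "\<bar>Arg (1 - 1 / E)\<bar> < pi / 2"
    using Re_Ln_pos_lt[OF n0] r by (simp only: Arg_eq_Im_Ln[OF n0])
  show "E = of_real (exp s) * exp (\<i> * of_real xi)"
    by (simp only: E_def s_def Efun_def exp_add exp_of_real)
qed

lemma polar_Arg: "z \<noteq> 0 \<Longrightarrow> z = of_real (cmod z) * exp (\<i> * of_real (Arg z))"
  using Arg_eq[of z] by (simp add: mult_ac)

text \<open>For w = 1 - 1/E the quotient of \<open>cnj w\<close> by w is
  \<open>exp (- 2 * \<i> * Arg w)\<close>; this is the phase supplied by the term - 2 Arg in
  \<open>l_coord\<close>, and the multivalued Arg disappears after exponentiation.\<close>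

lemma exp_l_coord:
  assumes "xi < - eta"
  defines "E \<equiv> Efun eta xi"
  shows "exp (l_coord eta xi) = - cnj E * cnj (1 - 1 / E) / (1 - 1 / E)"
proof -
  note F = Efun_facts[OF assms(1), folded E_def]
  define w where "w = 1 - 1 / E"
  define s where "s = - sqrt 3 * (eta + xi)"
  have w0: "w \<noteq> 0" using F by (simp add: w_def)
  define A where "A = exp (\<i> * of_real (Arg w))"
  have A: "w = of_real (cmod w) * A" "cnj A * A = 1" "A \<noteq> 0"
    using polar_Arg[OF w0] by (auto simp: A_def exp_cnj simp flip: exp_add)
  have cw: "cnj w = of_real (cmod w) * cnj A" using A(1) by (metis complex_cnj_complex_of_real complex_cnj_mult)
  have q: "cnj w / w = cnj A * cnj A"
  proof -
    have "cnj w = cnj A * cnj A * w"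
      unfolding cw by (subst (2) A(1)) (use A(2) in \<open>simp add: algebra_simps\<close>)
    then show ?thesis using w0 by simp
  qed
  have "exp (l_coord eta xi) = exp (of_real s + \<i> * of_real pi - \<i> * of_real xi - 2 * (\<i> * of_real (Arg w)))"
    by (rule arg_cong[of _ _ exp]) (simp add: l_coord_def complex_eq_iff s_def w_def E_def)
  also have "\<dots> = of_real (exp s) * (-1) * exp (- \<i> * of_real xi) * (cnj A * cnj A)"
    by (simp add: exp_add exp_diff exp_minus exp_double A_def exp_cnj exp_of_real[symmetric] power2_eq_square divide_inverse)
  also have "of_real (exp s) * (-1) * exp (- \<i> * of_real xi) = - cnj E"
    unfolding F(9) s_def by (simp add: exp_cnj)
  finally have "exp (l_coord eta xi) = - cnj E * (cnj w / w)" by (simp only: q)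
  then show ?thesis by (simp only: w_def times_divide_eq_right)
qed

lemma Efun_cnj: "xi < - eta \<Longrightarrow> Efun eta xi * cnj (Efun eta xi) = of_real (exp (- 2 * sqrt 3 * (eta + xi)))"
  using Efun_facts(2)[of xi eta]
  by (simp add: complex_norm_square[symmetric] exp_double[symmetric] del: of_real_power)

text \<open>By the closed form of \<open>exp l\<close>, the difference \<open>exp l - 1\<close>
  collapses to \<open>(1 - E * cnj E) / (E - 1)\<close>; its reciprocal is the fraction in
  \<open>gfun\<close>, whose denominator is 1 minus the squared modulus of E.\<close>

lemma r_cov_l_coord:
  assumes "xi < - eta" shows "r_cov (l_coord eta xi) = gfun eta xi"
proof -
  define E where "E = Efun eta xi"
  note F = Efun_facts[OF assms(1), folded E_def]
  have "exp (l_coord eta xi) - 1 = (1 - E * cnj E) / (E - 1)"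
    unfolding exp_l_coord[OF assms, folded E_def] using F(4,5,8) by (simp add: field_simps)
  then show ?thesis
    unfolding r_cov_def gfun_def Efun_cnj[OF assms, symmetric] E_def[symmetric] of_real_diff of_real_1
    by (simp add: E_def Efun_cnj[OF assms, symmetric])
qed

text \<open>\<open>1 - exp (- l)\<close> is a positive multiple of w, so its logarithm has imaginary
  part Arg w. This cancels the Arg in \<open>Im l / 2\<close>, and \<xi> cancels against
  \<open>Re l\<close>, leaving \<eta>/2: fixing \<eta> means following a level line of
  \<open>Im T_cov\<close>.\<close>

lemma T_cov_l_coord_eq:
  assumes "xi < - eta"
  defines "s \<equiv> - sqrt 3 * (eta + xi)" and "w \<equiv> 1 - 1 / Efun eta xi"
  shows "Re (T_cov (l_coord eta xi)) = s / 2 + ln (1 - exp (- 2 * s)) - ln (cmod w)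
            + (pi - xi - 2 * Arg w) / (2 * sqrt 3) - (ln 3 / 2 + sqrt 3 * pi / 9)"
    and "Im (T_cov (l_coord eta xi)) = eta / 2"
proof -
  define E where "E = Efun eta xi"
  note F = Efun_facts[OF assms(1), folded E_def s_def]
  have w: "w = 1 - 1 / E" by (simp add: w_def E_def)
  have w0: "w \<noteq> 0" using F by (simp add: w)
  have EE: "E * cnj E = of_real (exp (2 * s))" using Efun_cnj[OF assms(1)] by (simp add: E_def s_def mult_ac)
  have k: "(1 - exp (- 2 * s)) / (cmod w)\<^sup>2 > 0" using F w0 by simp
  have cw: "cnj E * cnj w = cnj E - 1" using F(4) by (simp add: w right_diff_distrib)
  have wE: "E * w = E - 1" using F(4) by (simp add: w right_diff_distrib)
  have "exp (- l_coord eta xi) = - w / (cnj E * cnj w)"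
    unfolding exp_minus exp_l_coord[OF assms(1), folded E_def] w[symmetric] by simp
  then have "1 - exp (- l_coord eta xi) = (cnj E * cnj w + w) / (cnj E * cnj w)"
    using w0 F(4) by (simp add: field_simps)
  also have "cnj E * cnj w + w = cnj E * (1 - exp (- 2 * of_real s))"
  proof -
    have "cnj E * cnj w + w = cnj E - 1 / E" unfolding cw by (simp add: w)
    also have "1 / E = cnj E / (E * cnj E)" using F(4) by simp
    finally show ?thesis unfolding EE by (simp add: exp_of_real[symmetric] exp_minus field_simps)
  qed
  also have "cnj E * (1 - exp (- 2 * of_real s)) / (cnj E * cnj w) =
      of_real ((1 - exp (- 2 * s)) / (cmod w)\<^sup>2) * w"
    using F(4) w0 by (simp add: complex_norm_square exp_of_real[symmetric] del: of_real_power)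
  finally have e: "1 - exp (- l_coord eta xi) = of_real ((1 - exp (- 2 * s)) / (cmod w)\<^sup>2) * w" .
  have "Ln (1 - exp (- l_coord eta xi)) = of_real (ln ((1 - exp (- 2 * s)) / (cmod w)\<^sup>2)) + Ln w"
    unfolding e Ln_times_of_real[OF k w0] Ln_of_real[OF k] ..
  also have "ln ((1 - exp (- 2 * s)) / (cmod w)\<^sup>2) = ln (1 - exp (- 2 * s)) - 2 * ln (cmod w)"
    using F(1) w0 by (simp add: ln_div ln_realpow)
  finally have L: "Re (Ln (1 - exp (- l_coord eta xi))) = ln (1 - exp (- 2 * s)) - ln (cmod w)"
     "Im (Ln (1 - exp (- l_coord eta xi))) = Arg w"
    using w0 by (auto simp: Arg_eq_Im_Ln)
  have l: "Re (l_coord eta xi) = s" "Im (l_coord eta xi) = pi - xi - 2 * Arg w"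
    by (auto simp: l_coord_def s_def w_def)
  show "Re (T_cov (l_coord eta xi)) = s / 2 + ln (1 - exp (- 2 * s)) - ln (cmod w)
            + (pi - xi - 2 * Arg w) / (2 * sqrt 3) - (ln 3 / 2 + sqrt 3 * pi / 9)"
    by (simp add: T_cov_def L l Re_divide_of_real diff_divide_distrib)
  have "Im (T_cov (l_coord eta xi)) = (pi - xi - 2 * Arg w) / 2 + Arg w - s / (2 * sqrt 3) - pi / 2"
    by (simp add: T_cov_def L l Im_divide_of_real)
  also have "\<dots> = eta / 2" by (simp add: s_def field_simps)
  finally show "Im (T_cov (l_coord eta xi)) = eta / 2" .
qed

text \<open>The factorisation E - 1 = E w with w = 1 - 1/E gives equality modulo
  \<open>2 * pi\<close>, and the ceiling reduces \<xi> to some x with -pi < x \<le> pi. The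
  remaining integer n is zero because Im w and Im (E - 1) both have the sign of sin x, which
  confines both arguments to the same half of the circle, and
  \<open>\<bar>Arg w\<bar> < pi / 2\<close>.\<close>

lemma Arg_Efun_minus_1:
  assumes "xi < - eta"
  shows "Arg (Efun eta xi - 1) + 2 * of_int \<lceil>(xi - pi) / (2 * pi)\<rceil> * pi = xi + Arg (1 - 1 / Efun eta xi)"
proof -
  define E where "E = Efun eta xi"
  define s where "s = - sqrt 3 * (eta + xi)"
  note F = Efun_facts[OF assms(1), folded E_def s_def]
  define w where "w = 1 - 1 / E"
  have w0: "w \<noteq> 0" and aw: "\<bar>Arg w\<bar> < pi / 2" using F by (auto simp: w_def)
  define k where "k = \<lceil>(xi - pi) / (2 * pi)\<rceil>"
  define x where "x = xi - 2 * of_int k * pi"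
  have "(xi - pi) / (2 * pi) \<le> of_int k" "of_int k < (xi - pi) / (2 * pi) + 1"
    unfolding k_def by linarith+
  then have x: "- pi < x" "x \<le> pi" by (auto simp: x_def field_simps)
  have ex: "exp (\<i> * of_real xi) = exp (\<i> * of_real x)"
    unfolding exp_eq x_def by (intro exI[of _ k]) (simp add: algebra_simps)
  have E: "E = of_real (exp s) * exp (\<i> * of_real x)" using F(9) ex by simp
  have ne: "E - 1 \<noteq> 0" using F(5) by simp
  have wE: "E * w = E - 1" using F(4) by (simp add: w_def right_diff_distrib)
  have ImE: "Im (E - 1) = exp s * sin x" unfolding E by (simp add: Im_exp)
  have "w = 1 - of_real (exp (- s)) * exp (- \<i> * of_real x)"
    unfolding w_def E by (simp add: exp_minus exp_of_real[symmetric] divide_inverse)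
  then have Imw: "Im w = exp (- s) * sin x" by (simp add: Im_exp)
  have "of_real (exp s * cmod w) * exp (\<i> * of_real (x + Arg w)) = E * w"
    by (subst (2) polar_Arg[OF w0]) (simp add: E exp_add algebra_simps)
  also have "\<dots> = of_real (cmod (E * w)) * exp (\<i> * of_real (Arg (E - 1)))"
    unfolding wE by (rule polar_Arg[OF ne])
  also have "cmod (E * w) = exp s * cmod w" by (simp add: norm_mult F(2))
  finally have "exp (\<i> * of_real (x + Arg w)) = exp (\<i> * of_real (Arg (E - 1)))"
    using w0 by simp
  then obtain n :: int where "\<i> * of_real (x + Arg w) = \<i> * of_real (Arg (E - 1)) + of_int (2 * n) * pi * \<i>"
    unfolding exp_eq by blast
  then have n: "x + Arg w = Arg (E - 1) + 2 * of_int n * pi"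
    by (simp add: complex_eq_iff)
  have B: "- pi < Arg (E - 1)" "Arg (E - 1) \<le> pi" using Arg_bounded by auto
  have "n = 0"
  proof (cases "x < 0")
    case True
    then have "sin x < 0" using x sin_gt_zero[of "- x"] by simp
    then have "Arg w < 0" "Arg (E - 1) < 0"
      using Arg_neg_iff[of w] Arg_neg_iff[of "E - 1"] Imw ImE by (auto simp: mult_pos_neg)
    with n x B aw pi_gt_zero True have "2 * of_int n * pi < 1 * pi" "(-2) * pi < 2 * of_int n * pi" by linarith+
    then have "2 * real_of_int n < 1" "-2 < 2 * real_of_int n"
      by (simp_all only: mult_less_cancel_right_pos[OF pi_gt_zero])
    then show ?thesis by linarith
  next
    case False
    then have "sin x \<ge> 0" using x sin_ge_zero[of x] by simp
    then have "Im w \<ge> 0" "Im (E - 1) \<ge> 0" using Imw ImE by auto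
    then have "Arg w \<ge> 0" "Arg (E - 1) \<ge> 0"
      using Arg_neg_iff[of w] Arg_neg_iff[of "E - 1"] by linarith+
    with n x B aw False pi_gt_zero have "2 * of_int n * pi < 2 * pi" "(-2) * pi < 2 * of_int n * pi" by linarith+
    then have "2 * real_of_int n < 2" "-2 < 2 * real_of_int n"
      by (simp_all only: mult_less_cancel_right_pos[OF pi_gt_zero])
    then show ?thesis by linarith
  qed
  with n show ?thesis by (simp add: x_def k_def E_def w_def)
qed

lemma sqrt3_sq: "complex_of_real (sqrt 3) * complex_of_real (sqrt 3) = 3"
  "complex_of_real (sqrt 3) * (complex_of_real (sqrt 3) * x) = 3 * x"
  by (simp_all flip: of_real_mult mult.assoc)

text \<open>With w = 1 - 1/E, the differences of g to the two roots of
  \<open>t\<^sup>2 - t + 1\<close> are real multiples of \<open>\<i> * E * w\<close> and of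
  \<open>\<i> * cnj w\<close>, the second multiple being positive. The latter gives the second Arg
  in \<open>Hfun\<close> as pi/2 - Arg w, and the product of both moduli gives the logarithmic
  term.\<close>

lemma T_cov_l_coord:
  assumes "xi < - eta" shows "T_cov (l_coord eta xi) = Hfun eta xi"
proof -
  define E where "E = Efun eta xi"
  define s where "s = - sqrt 3 * (eta + xi)"
  note F = Efun_facts[OF assms(1), folded E_def s_def]
  define w where "w = 1 - 1 / E"
  define g where "g = gfun eta xi"
  have w0: "w \<noteq> 0" and aw: "\<bar>Arg w\<bar> < pi / 2" using F by (auto simp: w_def)
  have EE: "E * cnj E = of_real (exp (2 * s))" using Efun_cnj[OF assms(1)] by (simp add: E_def s_def mult_ac)
  have cw: "cnj E * cnj w = cnj E - 1" using F(4) by (simp add: w_def right_diff_distrib)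
  have wE: "E * w = E - 1" using F(4) by (simp add: w_def right_diff_distrib)
  have m: "exp (2 * s) - 1 > 0" using F(1) by simp
  have mc: "(1::complex) - of_real (exp (2 * s)) \<noteq> 0" using m by (metis less_irrefl of_real_1 of_real_eq_iff right_minus_eq diff_self)
  have g1: "g - (1 + of_real (sqrt 3) * \<i>) / 2 = of_real (sqrt 3) * \<i> * (E * w) / (1 - of_real (exp (2 * s)))"
    unfolding g_def gfun_def E_def[symmetric] wE by (simp add: s_def mult_ac)
  have "g - (1 - of_real (sqrt 3) * \<i>) / 2 = g - (1 + of_real (sqrt 3) * \<i>) / 2 + of_real (sqrt 3) * \<i>"
    by (simp add: field_simps)
  also have "\<dots> = of_real (sqrt 3) * \<i> * ((E - 1) + (1 - E * cnj E)) / (1 - of_real (exp (2 * s)))"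
    unfolding g1 wE EE using mc by (simp add: field_simps)
  also have "(E - 1) + (1 - E * cnj E) = - (E * cnj E) * cnj w"
  proof -
    have "E * (cnj E * cnj w) = E * (cnj E - 1)" by (simp only: cw)
    then show ?thesis by (simp add: algebra_simps)
  qed
  also have "of_real (sqrt 3) * \<i> * (- (E * cnj E) * cnj w) / (1 - of_real (exp (2 * s))) =
     of_real (sqrt 3 * exp (2 * s) / (exp (2 * s) - 1)) * (\<i> * cnj w)"
    unfolding EE using mc m by (simp add: field_simps)
  finally have g2: "g - (1 - of_real (sqrt 3) * \<i>) / 2 =
     of_real (sqrt 3 * exp (2 * s) / (exp (2 * s) - 1)) * (\<i> * cnj w)" .
  have k: "sqrt 3 * exp (2 * s) / (exp (2 * s) - 1) > 0" using m by simp
  have "Arg (\<i> * cnj w) = pi / 2 - Arg w"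
  proof (rule Arg_unique)
    have "exp (\<i> * of_real (pi / 2 - Arg w)) = \<i> * exp (- \<i> * of_real (Arg w))"
    proof -
      have "exp (\<i> * of_real (pi / 2 - Arg w)) = cis (pi / 2 - Arg w)"
        by (simp only: cis_conv_exp)
      moreover have "exp (- \<i> * of_real (Arg w)) = cis (- Arg w)"
        by (simp add: cis_conv_exp)
      ultimately show ?thesis by (simp add: complex_eq_iff cos_diff sin_diff)
    qed
    moreover have "cnj w = of_real (cmod w) * exp (- \<i> * of_real (Arg w))"
      using arg_cong[OF polar_Arg[OF w0], of cnj] by (simp add: exp_cnj)
    ultimately show "of_real (cmod w) * exp (\<i> * of_real (pi / 2 - Arg w)) = \<i> * cnj w" by simp
  qed (use w0 aw in auto)
  then have A2: "Arg (g - (1 - of_real (sqrt 3) * \<i>) / 2) = pi / 2 - Arg w"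
    unfolding g2 by (subst Arg_times_of_real[OF k])
  have "g\<^sup>2 - g + 1 = (g - (1 + of_real (sqrt 3) * \<i>) / 2) * (g - (1 - of_real (sqrt 3) * \<i>) / 2)"
    using sqrt3_sq by (simp add: field_simps power2_eq_square)
  then have "cmod (g\<^sup>2 - g + 1) = cmod (of_real (sqrt 3) * \<i> * (E * w) / (1 - of_real (exp (2 * s)))) *
     cmod (of_real (sqrt 3 * exp (2 * s) / (exp (2 * s) - 1)) * (\<i> * cnj w))"
    unfolding g1 g2 by (simp only: norm_mult)
  also have "cmod (1 - of_real (exp (2 * s))) = exp (2 * s) - 1"
    using m by (metis abs_minus_commute abs_of_pos norm_of_real of_real_1 of_real_diff)
  then have "cmod (of_real (sqrt 3) * \<i> * (E * w) / (1 - of_real (exp (2 * s)))) *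
     cmod (of_real (sqrt 3 * exp (2 * s) / (exp (2 * s) - 1)) * (\<i> * cnj w)) =
     (sqrt 3 * exp s * cmod w / (exp (2 * s) - 1)) * (sqrt 3 * exp (2 * s) / (exp (2 * s) - 1) * cmod w)"
    using k norm_minus_commute[of 1 "complex_of_real (exp (2 * s))"] by (simp add: norm_mult norm_divide F(2))
  also have "\<dots> = 3 * exp s * exp (2 * s) * (cmod w * cmod w) / ((exp (2 * s) - 1) * (exp (2 * s) - 1))"
    by simp
  finally have "ln (cmod (g\<^sup>2 - g + 1)) = ln (3 * exp s * exp (2 * s) * (cmod w * cmod w) / ((exp (2 * s) - 1) * (exp (2 * s) - 1)))"
    by simp
  also have "\<dots> = ln 3 + 3 * s + 2 * ln (cmod w) - 2 * ln (exp (2 * s) - 1)"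
    using w0 m by (simp add: ln_div ln_mult)
  also have "ln (exp (2 * s) - 1) = 2 * s + ln (1 - exp (- 2 * s))"
  proof -
    have "exp (2 * s) - 1 = exp (2 * s) * (1 - exp (- 2 * s))" by (simp add: algebra_simps flip: exp_add)
    moreover have "1 - exp (- 2 * s) > 0" using F(1) by simp
    ultimately show ?thesis by (simp add: ln_mult)
  qed
  finally have lg: "ln (cmod (g\<^sup>2 - g + 1)) = ln 3 - s + 2 * ln (cmod w) - 2 * ln (1 - exp (- 2 * s))" by simp
  have s6: "1 / (2 * sqrt 3) = sqrt 3 / 6" by (simp add: field_simps)
  show ?thesis
  proof (rule complex_eqI)
    show "Im (T_cov (l_coord eta xi)) = Im (Hfun eta xi)"
      using T_cov_l_coord_eq(2)[OF assms] by (simp add: Hfun_def)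
    have "Re (Hfun eta xi) = - (sqrt 3 / 6) * (Arg (E - 1) + 2 * of_int \<lceil>(xi - pi) / (2 * pi)\<rceil> * pi
        - Arg (g - (1 - of_real (sqrt 3) * \<i>) / 2) + pi / 6) - ln (cmod (g\<^sup>2 - g + 1)) / 2"
      by (simp add: Hfun_def E_def g_def algebra_simps)
    also have "\<dots> = - (sqrt 3 / 6) * (xi + Arg w - (pi / 2 - Arg w) + pi / 6)
        - (ln 3 - s + 2 * ln (cmod w) - 2 * ln (1 - exp (- 2 * s))) / 2"
      unfolding A2 lg Arg_Efun_minus_1[OF assms, folded E_def, folded w_def] ..
    also have "\<dots> = s / 2 + ln (1 - exp (- 2 * s)) - ln (cmod w)
            + (pi - xi - 2 * Arg w) * (sqrt 3 / 6) - (ln 3 / 2 + sqrt 3 * pi / 9)"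
      by (simp add: field_simps)
    also have "\<dots> = Re (T_cov (l_coord eta xi))"
      unfolding T_cov_l_coord_eq(1)[OF assms, folded s_def E_def, folded w_def] s6[symmetric] by simp
    finally show "Re (T_cov (l_coord eta xi)) = Re (Hfun eta xi)" by simp
  qed
qed

section \<open>The imaginary axis and real values of \<open>T\<close>\<close>

text \<open>The restriction of \<open>T_cov\<close> to the points \<open>\<i> * t\<close> with 0 < t
  < 2 pi. There \<open>l / 2 + Ln (1 - exp (- l))\<close> is a logarithm of
  \<open>2 * sinh (l / 2) = 2 * \<i> * sin (t / 2)\<close>, and the constant
  \<open>\<i> * pi / 2\<close> in \<open>T_cov\<close> removes its imaginary part.\<close>

definition T_axis :: "real \<Rightarrow> real" where
  "T_axis t = ln (2 * sin (t / 2)) + t / (2 * sqrt 3) - (ln 3 / 2 + sqrt 3 * pi / 9)"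

definition r_axis :: "real \<Rightarrow> real" where
  "r_axis t = sin (t / 2 + pi / 3) / sin (t / 2)"

lemma sin_half_pos: "0 < t \<Longrightarrow> t < 2 * pi \<Longrightarrow> sin (t / 2) > 0"
  by (rule sin_gt_zero) auto

lemma sqrt3_mult [simp]: "sqrt 3 * (sqrt 3 * x) = 3 * x"
  by (simp flip: mult.assoc)

lemma T_cov_axis:
  assumes "0 < t" "t < 2 * pi" shows "T_cov (\<i> * of_real t) = of_real (T_axis t)"
proof -
  have s: "2 * sin (t / 2) > 0" using sin_half_pos[OF assms] by simp
  have "1 - cis (- t) = of_real (2 * sin (t / 2)) * cis (pi / 2 - t / 2)"
  proof -
    have "cos t = 1 - 2 * (sin (t / 2))\<^sup>2" "sin t = 2 * sin (t / 2) * cos (t / 2)"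
      using cos_double_sin[of "t / 2"] sin_double[of "t / 2"] by auto
    then show ?thesis
      by (simp add: complex_eq_iff cos_diff sin_diff power2_eq_square)
  qed
  then have e: "1 - exp (- (\<i> * of_real t)) = of_real (2 * sin (t / 2)) * exp (\<i> * of_real (pi / 2 - t / 2))"
    by (simp only: cis_conv_exp) simp
  have "Ln (1 - exp (- (\<i> * of_real t))) = of_real (ln (2 * sin (t / 2))) + \<i> * of_real (pi / 2 - t / 2)"
    unfolding e Ln_times_of_real[OF s exp_not_eq_zero] Ln_of_real[OF s]
    by (subst Ln_exp) (use assms in auto)
  then show ?thesis
    unfolding T_cov_def T_axis_def by (simp add: complex_eq_iff Re_divide_of_real Im_divide_of_real)
qed

lemma r_cov_axis:
  assumes "0 < t" "t < 2 * pi" shows "r_cov (\<i> * of_real t) = of_real (r_axis t)"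
proof -
  define c s where "c = cos (t / 2)" and "s = sin (t / 2)"
  have s0: "s > 0" using sin_half_pos[OF assms] by (simp add: s_def)
  have cs: "c * c + s * s = 1" by (simp add: c_def s_def)
  have ct: "cos t = c * c - s * s" "sin t = 2 * s * c"
    using cos_double[of "t / 2"] sin_double[of "t / 2"] by (auto simp: c_def s_def power2_eq_square)
  have "exp (\<i> * of_real t) - 1 = Complex (c * c - s * s - 1) (2 * s * c)"
    by (simp add: cis_conv_exp[symmetric] complex_eq_iff ct)
  also have "c * c - s * s - 1 = - 2 * s * s" using cs by linarith
  finally have e: "exp (\<i> * of_real t) - 1 = Complex (- 2 * s * s) (2 * s * c)" .
  have "(exp (\<i> * of_real t) - 1) * Complex (c / (2 * s)) (- 1 / 2) = \<i>"
    unfolding e using s0 cs by (simp add: complex_eq_iff field_simps)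
  then have "\<i> / (exp (\<i> * of_real t) - 1) = Complex (c / (2 * s)) (- 1 / 2)"
    using T_dom_exp_ne[OF axis_T_dom[OF assms]] by (simp add: field_simps)
  moreover have "r_cov (\<i> * of_real t) = (1 + of_real (sqrt 3) * \<i>) / 2 + of_real (sqrt 3) * (\<i> / (exp (\<i> * of_real t) - 1))"
    by (simp add: r_cov_def)
  ultimately have "r_cov (\<i> * of_real t) =
      (1 + of_real (sqrt 3) * \<i>) / 2 + of_real (sqrt 3) * Complex (c / (2 * s)) (- 1 / 2)"
    by (simp only:)
  then have "r_cov (\<i> * of_real t) = of_real (1 / 2 + sqrt 3 / 2 * (c / s))"
    by (simp add: complex_eq_iff)
  also have "1 / 2 + sqrt 3 / 2 * (c / s) = r_axis t"
    unfolding r_axis_def sin_add using s0 by (simp add: sin_60 cos_60 c_def[symmetric] s_def[symmetric] field_simps)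
  finally show ?thesis .
qed

lemma r_axis_pos: "0 < t \<Longrightarrow> t < 4 * pi / 3 \<Longrightarrow> r_axis t > 0"
  unfolding r_axis_def by (intro divide_pos_pos sin_gt_zero) auto

lemma r_axis_neg: "4 * pi / 3 < t \<Longrightarrow> t < 2 * pi \<Longrightarrow> r_axis t < 0"
proof -
  assume t: "4 * pi / 3 < t" "t < 2 * pi"
  have "sin (t / 2 + pi / 3) < 0" using t by (intro sin_lt_zero) auto
  moreover have "sin (t / 2) > 0" using t by (intro sin_half_pos) auto
  ultimately show ?thesis by (simp add: r_axis_def divide_neg_pos)
qed

lemma r_axis_zero: "r_axis (4 * pi / 3) = 0"
proof -
  have "4 * pi / 3 / 2 + pi / 3 = pi" by simp
  then show ?thesis unfolding r_axis_def by (simp only: sin_pi div_0)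
qed

lemma r_axis_nonneg: "0 < t \<Longrightarrow> t \<le> 4 * pi / 3 \<Longrightarrow> r_axis t \<ge> 0"
proof (cases "t < 4 * pi / 3")
  case False
  assume "t \<le> 4 * pi / 3"
  with False have "t = 4 * pi / 3" by simp
  then show ?thesis by (simp only: r_axis_zero order_refl)
qed (use r_axis_pos in \<open>auto intro: less_imp_le\<close>)

lemma sin_120': "sin (2 * pi / 3) = sqrt 3 / 2"
proof -
  have "sin (2 * pi / 3) = sin (pi - pi / 3)" by (rule arg_cong[of _ _ sin]) simp
  then show ?thesis by (simp only: sin_pi_minus sin_60)
qed

lemma pi_sqrt3: "pi / sqrt 3 = sqrt 3 * pi / 3"
  by (simp add: field_simps sqrt3_mult)

lemma T_axis_crit: "T_axis (4 * pi / 3) = sqrt 3 * pi / 9"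
proof -
  have "ln (sqrt 3) = ln 3 / 2" by (simp add: ln_sqrt)
  moreover have e: "4 * pi / 3 / 2 = 2 * pi / 3" "4 * pi / 3 / (2 * sqrt 3) = 2 / 3 * (pi / sqrt 3)"
    by simp_all
  ultimately show ?thesis unfolding T_axis_def e sin_120' pi_sqrt3 by simp
qed

lemma r_axis_one: "r_axis (2 * pi / 3) = 1"
proof -
  have e: "2 * pi / 3 / 2 + pi / 3 = 2 * pi / 3" "2 * pi / 3 / 2 = pi / 3" by simp_all
  show ?thesis unfolding r_axis_def e(1) by (simp only: e(2) sin_120' sin_60) simp
qed

lemma T_axis_zero: "T_axis (2 * pi / 3) = 0"
proof -
  have "ln (sqrt 3) = ln 3 / 2" by (simp add: ln_sqrt)
  moreover have e: "2 * pi / 3 / 2 = pi / 3" "2 * pi / 3 / (2 * sqrt 3) = 1 / 3 * (pi / sqrt 3)"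
    by simp_all
  ultimately show ?thesis unfolding T_axis_def e sin_60 pi_sqrt3 by simp
qed

lemma DERIV_T_axis:
  assumes "0 < t" "t < 2 * pi" shows "(T_axis has_real_derivative r_axis t / sqrt 3) (at t)"
proof -
  have s: "sin (t / 2) > 0" using sin_half_pos[OF assms] .
  have "(T_axis has_real_derivative cos (t / 2) / (2 * sin (t / 2)) + 1 / (2 * sqrt 3)) (at t)"
    unfolding T_axis_def[abs_def] using s by (auto intro!: derivative_eq_intros simp: divide_simps)
  also have "cos (t / 2) / (2 * sin (t / 2)) + 1 / (2 * sqrt 3) = r_axis t / sqrt 3"
  proof -
    have "r_axis t = 1 / 2 + sqrt 3 * (cos (t / 2) / (2 * sin (t / 2)))"
      unfolding r_axis_def sin_add using s by (simp add: sin_60 cos_60 field_simps)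
    then show ?thesis by (simp add: add_divide_distrib)
  qed
  finally show ?thesis .
qed

lemma T_axis_continuous: "continuous_on {0<..<2 * pi} T_axis"
  by (rule DERIV_continuous_on) (auto intro: DERIV_T_axis has_field_derivative_at_within)

text \<open>The derivative has the sign of \<open>r_axis\<close>, which changes from positive to
  negative at \<open>4 * pi / 3\<close>. So \<open>T_axis\<close> turns back there, and the branch
  up to this point is the one with r \<ge> 0, on which \<open>T0\<close> is inverted.\<close>

lemma T_axis_less: "0 < s \<Longrightarrow> s < t \<Longrightarrow> t \<le> 4 * pi / 3 \<Longrightarrow> T_axis s < T_axis t"
proof (rule DERIV_pos_imp_increasing_open[where f = T_axis])
  assume *: "0 < s" "s < t" "t \<le> 4 * pi / 3"
  then show "s < t" by simp
  show "\<exists>y. DERIV T_axis x :> y \<and> 0 < y" if "s < x" "x < t" for x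
    using that * DERIV_T_axis[of x] r_axis_pos[of x] by (intro exI[of _ "r_axis x / sqrt 3"]) auto
  show "continuous_on {s..t} T_axis"
    by (rule continuous_on_subset[OF T_axis_continuous]) (use * in auto)
qed

lemma T_axis_greater: "4 * pi / 3 \<le> s \<Longrightarrow> s < t \<Longrightarrow> t < 2 * pi \<Longrightarrow> T_axis t < T_axis s"
proof (rule DERIV_neg_imp_decreasing_open[where f = T_axis])
  assume *: "4 * pi / 3 \<le> s" "s < t" "t < 2 * pi"
  then show "s < t" by simp
  show "\<exists>y. DERIV T_axis x :> y \<and> y < 0" if "s < x" "x < t" for x
    using that * DERIV_T_axis[of x] r_axis_neg[of x] pi_gt_zero
    by (intro exI[of _ "r_axis x / sqrt 3"]) (auto simp: divide_neg_pos)
  show "continuous_on {s..t} T_axis"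
    using * pi_gt_zero by (intro continuous_on_subset[OF T_axis_continuous]) auto
qed

lemma T_axis_max: "0 < t \<Longrightarrow> t < 2 * pi \<Longrightarrow> T_axis t \<le> sqrt 3 * pi / 9"
  and T_axis_max_eq: "0 < t \<Longrightarrow> t < 2 * pi \<Longrightarrow> T_axis t = sqrt 3 * pi / 9 \<Longrightarrow> t = 4 * pi / 3"
  using T_axis_less[of t "4 * pi / 3"] T_axis_greater[of "4 * pi / 3" t] T_axis_crit
  by (cases t "4 * pi / 3" rule: linorder_cases; force)+

lemma T_axis_surj:
  assumes "w \<le> sqrt 3 * pi / 9" shows "\<exists>t. 0 < t \<and> t \<le> 4 * pi / 3 \<and> T_axis t = w"
proof -
  \<comment> \<open>Then \<open>2 * sin (t0 / 2) \<le> t0\<close> puts the logarithm at or below w -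
    2, and t0 \<le> 1 keeps the linear term at most 1.\<close>
  define t0 where "t0 = min 1 (exp (w - 2))"
  have t0: "0 < t0" "t0 \<le> 1" "ln t0 \<le> w - 2"
    by (auto simp: t0_def min_def)
  have pi3: "pi > 3" using pi_gt3 by simp
  have "ln (2 * sin (t0 / 2)) \<le> ln t0"
  proof (subst ln_le_cancel_iff)
    show "2 * sin (t0 / 2) > 0" using sin_half_pos[of t0] t0 pi3 by simp
    show "2 * sin (t0 / 2) \<le> t0" using sin_x_le_x[of "t0 / 2"] t0 by simp
  qed (use t0 in auto)
  moreover have "t0 / (2 * sqrt 3) \<le> 1"
  proof -
    have "(1::real) \<le> sqrt 3" by simp
    then have "t0 \<le> 2 * sqrt 3" using t0 by linarith
    then show ?thesis by (simp add: field_simps)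
  qed
  moreover have "ln 3 / 2 + sqrt 3 * pi / 9 \<ge> 0" by simp
  ultimately have "T_axis t0 \<le> w" unfolding T_axis_def using t0(3) by linarith
  moreover have "w \<le> T_axis (4 * pi / 3)" using assms by (simp add: T_axis_crit)
  moreover have "continuous_on {t0..4 * pi / 3} T_axis"
    using t0 pi3 by (intro continuous_on_subset[OF T_axis_continuous]) auto
  moreover have "t0 \<le> 4 * pi / 3" using t0 pi3 by linarith
  ultimately obtain t where "t0 \<le> t" "t \<le> 4 * pi / 3" "T_axis t = w"
    using IVT'[of T_axis t0 w "4 * pi / 3"] by auto
  then show ?thesis using t0 by (intro exI[of _ t]) auto
qed

section \<open>The real integral \<open>T0\<close> and its inverse\<close>

lemma quad_pos: "(s::real)\<^sup>2 - s + 1 > 0"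
proof -
  have "s\<^sup>2 - s + 1 = (s - 1 / 2)\<^sup>2 + 3 / 4" by (simp add: power2_eq_square algebra_simps)
  also have "\<dots> > 0" by (rule add_nonneg_pos) auto
  finally show ?thesis .
qed

definition T0_prim :: "real \<Rightarrow> real" where
  "T0_prim t = ln (t\<^sup>2 - t + 1) / 2 + arctan ((2 * t - 1) / sqrt 3) / sqrt 3"

lemma DERIV_T0_prim: "(T0_prim has_real_derivative s / (s\<^sup>2 - s + 1)) (at s)"
proof -
  have "(T0_prim has_real_derivative (2 * s - 1) / (s\<^sup>2 - s + 1) / 2
      + inverse (1 + ((2 * s - 1) / sqrt 3)\<^sup>2) * (2 / sqrt 3) / sqrt 3) (at s)"
  proof -
    have "((\<lambda>t. t\<^sup>2 - t + 1) has_real_derivative 2 * s - 1) (at s)"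
      by (auto intro!: derivative_eq_intros)
    from DERIV_cdivide[OF DERIV_chain2[OF DERIV_ln_divide[OF quad_pos] this], of 2]
    have 1: "((\<lambda>t. ln (t\<^sup>2 - t + 1) / 2) has_real_derivative (2 * s - 1) / (s\<^sup>2 - s + 1) / 2) (at s)"
      by simp
    have "((\<lambda>t. (2 * t - 1) / sqrt 3) has_real_derivative 2 / sqrt 3) (at s)"
      by (intro DERIV_cdivide) (auto intro!: derivative_eq_intros)
    from DERIV_add[OF 1 DERIV_cdivide[OF DERIV_chain2[OF DERIV_arctan this], of "sqrt 3"]]
    show ?thesis by (simp only: T0_prim_def[abs_def])
  qed
  also have "inverse (1 + ((2 * s - 1) / sqrt 3)\<^sup>2) * (2 / sqrt 3) / sqrt 3 = 1 / (2 * (s\<^sup>2 - s + 1))"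
  proof -
    have e: "1 + ((2 * s - 1) / sqrt 3)\<^sup>2 = 4 * (s\<^sup>2 - s + 1) / 3"
      by (simp add: power_divide) (simp add: power2_eq_square field_simps)
    show ?thesis unfolding e using quad_pos[of s] by (simp add: field_simps)
  qed
  also have "(2 * s - 1) / (s\<^sup>2 - s + 1) / 2 + 1 / (2 * (s\<^sup>2 - s + 1)) = s / (s\<^sup>2 - s + 1)"
    using quad_pos[of s] by (simp add: field_simps)
  finally show ?thesis .
qed

lemma T0_eq: "T0 s = T0_prim 1 - T0_prim s"
  unfolding T0_def one_ereal_def
proof (rule interval_integral_FTC_finite)
  show "continuous_on {min s 1..max s 1} (\<lambda>t. t / (t\<^sup>2 - t + 1))"
    by (intro continuous_intros) (metis less_irrefl quad_pos)
  show "(T0_prim has_vector_derivative x / (x\<^sup>2 - x + 1)) (at x within {min s 1..max s 1})" for x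
    using DERIV_T0_prim[of x]
    by (simp add: has_real_derivative_iff_has_vector_derivative has_vector_derivative_at_within)
qed

lemma DERIV_T0: "(T0 has_real_derivative - (s / (s\<^sup>2 - s + 1))) (at s)"
  unfolding T0_eq[abs_def] by (auto intro!: derivative_eq_intros DERIV_T0_prim)

lemma T0_strict_antimono: "0 \<le> s \<Longrightarrow> s < t \<Longrightarrow> T0 t < T0 s"
proof (rule DERIV_neg_imp_decreasing_open[where f = T0])
  assume *: "0 \<le> s" "s < t"
  then show "s < t" by simp
  show "\<exists>y. DERIV T0 x :> y \<and> y < 0" if "s < x" "x < t" for x
    using that * DERIV_T0[of x] quad_pos[of x] by (intro exI[of _ "- (x / (x\<^sup>2 - x + 1))"]) auto
  show "continuous_on {s..t} T0"
    by (rule DERIV_continuous_on) (auto intro: DERIV_T0 has_field_derivative_at_within)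
qed

lemma T0_inv_T0: "0 \<le> s \<Longrightarrow> T0_inv (T0 s) = s"
  unfolding T0_inv_def
proof (rule the_inv_into_f_f)
  show "inj_on T0 {0..}"
  proof (rule linorder_inj_onI)
    fix x y :: real assume "x < y" "x \<in> {0..}"
    then show "T0 x \<noteq> T0 y" using T0_strict_antimono[of x y] by simp
  qed auto
qed auto

text \<open>Both sides have derivative \<open>r_axis t / sqrt 3\<close> and vanish at
  \<open>2 * pi / 3\<close>, where \<open>r_axis\<close> is 1. This identifies \<open>T_cov\<close>
  on the axis with the real integral.\<close>

lemma T0_r_axis:
  assumes "0 < t" "t < 2 * pi" shows "T0 (r_axis t) = T_axis t"
proof -
  define d where "d = (\<lambda>t. T0 (r_axis t) - T_axis t)"
  have "(d has_real_derivative 0) (at x)" if x: "0 < x" "x < 2 * pi" for x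
  proof -
    define c s where "c = cos (x / 2)" and "s = sin (x / 2)"
    have s: "s > 0" using sin_half_pos[OF x] by (simp add: s_def)
    have cs: "c * c = 1 - s * s" unfolding c_def s_def by (simp add: sin_squared_eq flip: power2_eq_square)
    have r: "r_axis x = (s + sqrt 3 * c) / (2 * s)"
      unfolding r_axis_def sin_add by (simp add: sin_60 cos_60 c_def s_def field_simps)
    have q: "(r_axis x)\<^sup>2 - r_axis x + 1 = 3 / (4 * s * s)"
    proof -
      have "(r_axis x)\<^sup>2 - r_axis x + 1 = (3 * (c * c) + 3 * s * s) / (4 * s * s)"
        unfolding r using s by (simp add: power2_eq_square field_simps)
      then show ?thesis unfolding cs by simp
    qed
    have "(r_axis has_real_derivative - sqrt 3 / (4 * s * s)) (at x)"
    proof -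
      have "(r_axis has_real_derivative (cos (x / 2 + pi / 3) / 2 * sin (x / 2)
          - sin (x / 2 + pi / 3) * (cos (x / 2) / 2)) / (sin (x / 2) * sin (x / 2))) (at x)"
        unfolding r_axis_def[abs_def] using s by (auto intro!: derivative_eq_intros simp: s_def)
      also have "cos (x / 2 + pi / 3) / 2 * sin (x / 2) - sin (x / 2 + pi / 3) * (cos (x / 2) / 2) = 
          sin (x / 2 - (x / 2 + pi / 3)) / 2"
        using sin_diff[of "x / 2" "x / 2 + pi / 3"] by (simp add: mult.commute)
      finally show ?thesis using s by (simp add: s_def sin_60 field_simps)
    qed
    then have "((\<lambda>x. T0 (r_axis x)) has_real_derivative
        - (r_axis x / ((r_axis x)\<^sup>2 - r_axis x + 1)) * (- sqrt 3 / (4 * s * s))) (at x)"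
      by (rule DERIV_chain2[OF DERIV_T0])
    also have "- (r_axis x / ((r_axis x)\<^sup>2 - r_axis x + 1)) * (- sqrt 3 / (4 * s * s)) = r_axis x / sqrt 3"
      unfolding q using s by (simp add: field_simps)
    finally show ?thesis
      unfolding d_def using DERIV_diff[OF _ DERIV_T_axis[OF x]] by fastforce
  qed
  then have "\<exists>c. \<forall>x\<in>{0<..<2 * pi}. d x = c"
    by (intro has_field_derivative_zero_constant) (auto intro: has_field_derivative_at_within)
  then have "d t = d (2 * pi / 3)" using assms pi_gt_zero by auto
  also have "\<dots> = 0" by (simp add: d_def r_axis_one T_axis_zero T0_eq)
  finally show ?thesis by (simp add: d_def)
qed

text \<open>Intermediate value theorem along the level line \<open>Im T_cov = \<eta> / 2\<close>,
  parametrised by s = Re l > 0. For large s the term s/2 wins. For s tending to 0 the term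
  \<open>ln (1 - exp (- 2 * s))\<close> goes to minus infinity if \<eta> < 0; if \<eta> = 0 then
  \<open>cmod (w s)\<close> vanishes as well and the finite limit \<open>sqrt 3 * pi / 9\<close>
  remains, whence the lower bound on v.\<close>

lemma T_cov_l_coord_surj:
  assumes eta: "- pi \<le> eta" "eta \<le> 0" and v: "eta < 0 \<or> v > sqrt 3 * pi / 9"
  shows "\<exists>xi < - eta. Re (T_cov (l_coord eta xi)) = v"
proof -
  \<comment> \<open>\<open>X s\<close> is the \<xi> for which Re l = s, and
    \<open>s * c + \<i> * \<eta>\<close> is the exponent of 1/E at this point.\<close>
  define c :: complex where "c = Complex (-1) (1 / sqrt 3)"
  define w where "w = (\<lambda>s::real. 1 - exp (of_real s * c + \<i> * of_real eta))"
  define X where "X = (\<lambda>s::real. - s / sqrt 3 - eta)"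
  define f where "f = (\<lambda>s::real. s / 2 + ln (1 - exp (- 2 * s)) - ln (cmod (w s))
      + (pi + s / sqrt 3 + eta - 2 * Im (Ln (w s))) / (2 * sqrt 3) - (ln 3 / 2 + sqrt 3 * pi / 9))"
  have X: "X s < - eta" "- sqrt 3 * (eta + X s) = s" "w s = 1 - 1 / Efun eta (X s)" if "s > 0" for s
  proof -
    show "X s < - eta" using that by (simp add: X_def)
    show 2: "- sqrt 3 * (eta + X s) = s" by (simp add: X_def)
    have "of_real s * c + \<i> * of_real eta = - (of_real s + \<i> * of_real (X s))"
      by (simp add: complex_eq_iff c_def X_def)
    then show "w s = 1 - 1 / Efun eta (X s)"
      unfolding w_def Efun_def 2 by (simp only: exp_minus inverse_eq_divide)
  qed
  have w: "Re (w s) > 0" "w s \<noteq> 0" "\<bar>Im (Ln (w s))\<bar> < pi / 2" if "s > 0" for s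
    using Efun_facts(6-8)[OF X(1)[OF that]] X(3)[OF that] by (auto simp: Arg_eq_Im_Ln)
  have f: "Re (T_cov (l_coord eta (X s))) = f s" if "s > 0" for s
    using T_cov_l_coord_eq(1)[OF X(1)[OF that]] w(2)[OF that]
    unfolding X(2)[OF that] X(3)[OF that, symmetric] f_def by (simp add: Arg_eq_Im_Ln X_def)
  have wc: "continuous_on A w" for A unfolding w_def by (intro continuous_intros)
  have wn: "w s \<notin> \<real>\<^sub>\<le>\<^sub>0" if "s > 0" for s using w(1)[OF that] by (auto simp: complex_nonpos_Reals_iff)
  have cont: "continuous_on {0<..} f"
    unfolding f_def using w wn
    by (intro continuous_intros wc) (auto simp: complex_nonpos_Reals_iff)
  define M where "M = ln 2 - ln (1 - exp (- 2 :: real)) + pi / (2 * sqrt 3) + (ln 3 / 2 + sqrt 3 * pi / 9)"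
  have up: "f s \<ge> s / 2 - M" if s: "s \<ge> 1" for s
  proof -
    have "cmod (w s) \<le> 1 + cmod (exp (of_real s * c + \<i> * of_real eta))"
      unfolding w_def by (metis norm_one norm_triangle_ineq4)
    also have "\<dots> \<le> 2" using s by (simp add: c_def)
    finally have 1: "ln (cmod (w s)) \<le> ln 2" using w(2)[of s] s by simp
    have 2: "ln (1 - exp (- 2 * s)) \<ge> ln (1 - exp (- 2))" using s by simp
    have "- pi \<le> pi + s / sqrt 3 + eta - 2 * Im (Ln (w s))"
    proof -
      have "s / sqrt 3 \<ge> 0" using s by simp
      then show ?thesis using w(3)[of s] s eta by linarith
    qed
    then have "- pi / (2 * sqrt 3) \<le> (pi + s / sqrt 3 + eta - 2 * Im (Ln (w s))) / (2 * sqrt 3)"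
      by (intro divide_right_mono) auto
    then show ?thesis using 1 2 unfolding f_def M_def by simp
  qed
  have low: "eventually (\<lambda>s. f s < v) (at_right 0)"
  proof (cases "eta < 0")
    case True
    \<comment> \<open>An \<eta> in [-pi, 0) is no multiple of 2 pi, so w has a nonzero limit at 0
      and the logarithm of its modulus stays bounded.\<close>
    have "exp (\<i> * of_real eta) \<noteq> 1"
    proof
      assume "exp (\<i> * of_real eta) = 1"
      then have "cis eta = 1" by (simp add: cis_conv_exp)
      then have "cos eta = 1" by (simp add: complex_eq_iff)
      then obtain n :: int where n: "eta = of_int n * 2 * pi" using cos_one_2pi_int by blast
      from n True have "of_int n < (0::real)" by (simp add: mult_less_0_iff)
      then have "n \<le> -1" by simp
      then have "of_int n \<le> (-1::real)" by (metis of_int_le_iff of_int_minus of_int_1)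
      then have "of_int n * (2 * pi) \<le> -1 * (2 * pi)" by (intro mult_right_mono) auto
      moreover have "eta = of_int n * (2 * pi)" using n by (simp only: mult.assoc)
      ultimately show False using eta pi_gt_zero by linarith
    qed
    then have w0: "w 0 \<noteq> 0" by (simp add: w_def)
    have "(w \<longlongrightarrow> w 0) (at_right 0)"
      unfolding w_def by (auto intro!: tendsto_eq_intros)
    then have "((\<lambda>s. v - s / 2 + ln (cmod (w s)) - (2 * pi + s / sqrt 3) / (2 * sqrt 3)) \<longlongrightarrow>
       v - 0 / 2 + ln (cmod (w 0)) - (2 * pi + 0 / sqrt 3) / (2 * sqrt 3)) (at_right 0)"
      using w0 by (intro tendsto_intros) auto
    moreover have "filterlim (\<lambda>s::real. ln (1 - exp (- 2 * s))) at_bot (at_right 0)"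
      by real_asymp
    ultimately have "filterlim (\<lambda>s. (v - s / 2 + ln (cmod (w s)) - (2 * pi + s / sqrt 3) / (2 * sqrt 3))
        + - ln (1 - exp (- 2 * s))) at_top (at_right 0)"
      by (intro filterlim_tendsto_add_at_top) (auto simp: filterlim_uminus_at_top)
    then have "eventually (\<lambda>s. 0 < (v - s / 2 + ln (cmod (w s)) - (2 * pi + s / sqrt 3) / (2 * sqrt 3))
        + - ln (1 - exp (- 2 * s))) (at_right 0)"
      by (simp only: filterlim_at_top_dense)
    moreover have "eventually (\<lambda>s::real. s > 0) (at_right 0)" by (simp add: eventually_at_right_less)
    ultimately show ?thesis
    proof eventually_elim
      case (elim s)
      have "(pi + s / sqrt 3 + eta - 2 * Im (Ln (w s))) / (2 * sqrt 3) \<le> (2 * pi + s / sqrt 3) / (2 * sqrt 3)"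
        using w(3)[OF elim(2)] True by (intro divide_right_mono) auto
      moreover have "ln 3 / 2 + sqrt 3 * pi / 9 \<ge> 0" by simp
      ultimately show ?case using elim(1) unfolding f_def by linarith
    qed
  next
    case False
    then have e0: "eta = 0" using eta by simp
    \<comment> \<open>Both \<open>1 - exp (- 2 * s)\<close> and \<open>w s\<close> vanish to first
      order; dividing each by s leaves the difference of the logarithms unchanged and gives the
      limits 2 and - c.\<close>
    have l1: "((\<lambda>s::real. (1 - exp (- 2 * s)) / s) \<longlongrightarrow> 2) (at_right 0)" by real_asymp
    have "((\<lambda>z. exp (z * c)) has_field_derivative c) (at 0)"
      by (auto intro!: derivative_eq_intros)
    then have "((\<lambda>h. (exp (h * c) - 1) / h) \<longlongrightarrow> c) (at 0)"
      by (simp add: DERIV_def)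
    moreover have "filterlim complex_of_real (at 0) (at_right 0)"
      unfolding filterlim_at
      by (auto intro!: tendsto_eq_intros simp: eventually_neq_at_within)
    ultimately have "((\<lambda>s. (exp (of_real s * c) - 1) / of_real s) \<longlongrightarrow> c) (at_right 0)"
      by (rule filterlim_compose)
    from tendsto_minus[OF this] have l2: "((\<lambda>s. w s / of_real s) \<longlongrightarrow> - c) (at_right 0)"
      by (simp add: w_def e0 minus_divide_left)
    have mc: "of_real (2 / sqrt 3) * exp (\<i> * of_real (- (pi / 6))) = - c"
    proof -
      have "of_real (2 / sqrt 3) * cis (- (pi / 6)) = - c"
        by (simp add: complex_eq_iff c_def cos_30 sin_30)
      then show ?thesis by (simp only: cis_conv_exp)
    qed
    have "Arg (- c) = - (pi / 6)"
    proof (rule Arg_unique[OF mc])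
      show "- pi < - (pi / 6)" "- (pi / 6) \<le> pi" using pi_gt_zero by linarith+
    qed simp
    moreover have c0: "- c \<noteq> 0" by (simp add: c_def complex_eq_iff)
    ultimately have ac: "Im (Ln (- c)) = - (pi / 6)" by (simp only: Arg_eq_Im_Ln[OF c0])
    have nc: "cmod (- c) = 2 / sqrt 3" unfolding mc[symmetric] by (simp only: norm_mult norm_exp_i_times norm_of_real) simp
    have cn: "- c \<notin> \<real>\<^sub>\<le>\<^sub>0" by (simp add: c_def complex_nonpos_Reals_iff)
    have "((\<lambda>s. s / 2 + ln ((1 - exp (- 2 * s)) / s) - ln (cmod (w s / of_real s))
      + (pi + s / sqrt 3 - 2 * Im (Ln (w s / of_real s))) / (2 * sqrt 3) - (ln 3 / 2 + sqrt 3 * pi / 9)) \<longlongrightarrow>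
      0 / 2 + ln 2 - ln (cmod (- c)) + (pi + 0 / sqrt 3 - 2 * Im (Ln (- c))) / (2 * sqrt 3)
        - (ln 3 / 2 + sqrt 3 * pi / 9)) (at_right 0)"
      using c0 cn by (intro tendsto_intros l1 l2 tendsto_Ln) auto
    also have "0 / 2 + ln 2 - ln (cmod (- c)) + (pi + 0 / sqrt 3 - 2 * Im (Ln (- c))) / (2 * sqrt 3)
        - (ln 3 / 2 + sqrt 3 * pi / 9) = sqrt 3 * pi / 9"
    proof -
      have "(pi + 0 / sqrt 3 - 2 * Im (Ln (- c))) / (2 * sqrt 3) = 2 / 3 * (pi / sqrt 3)"
        unfolding ac by simp
      then show ?thesis unfolding nc pi_sqrt3 by (simp add: ln_div ln_sqrt)
    qed
    finally have "eventually (\<lambda>s. s / 2 + ln ((1 - exp (- 2 * s)) / s) - ln (cmod (w s / of_real s))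
      + (pi + s / sqrt 3 - 2 * Im (Ln (w s / of_real s))) / (2 * sqrt 3) - (ln 3 / 2 + sqrt 3 * pi / 9) < v) (at_right 0)"
      by (rule order_tendstoD) (use v e0 in auto)
    moreover have "eventually (\<lambda>s::real. s > 0) (at_right 0)" by (simp add: eventually_at_right_less)
    ultimately show ?thesis
    proof eventually_elim
      case (elim s)
      have s': "1 / s > 0" using elim(2) by simp
      have "w s / of_real s = of_real (1 / s) * w s" by simp
      then have 1: "Ln (w s / of_real s) = of_real (ln (1 / s)) + Ln (w s)"
        by (simp only: Ln_times_of_real[OF s' w(2)[OF elim(2)]] Ln_of_real[OF s'])
      have 2: "ln ((1 - exp (- 2 * s)) / s) - ln (cmod (w s / of_real s)) = ln (1 - exp (- 2 * s)) - ln (cmod (w s))"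
        using elim(2) w(2)[of s] by (simp add: norm_divide ln_div)
      show ?case using elim(1) 2 unfolding 1 f_def e0 by simp
    qed
  qed
  have "eventually (\<lambda>s::real. s > 0 \<and> s < 1) (at_right 0)"
    by (auto simp: eventually_at_right_field intro!: exI[of _ 1])
  from eventually_happens'[OF _ eventually_conj[OF low this]]
  obtain s0 where s0: "0 < s0" "s0 < 1" "f s0 < v" by auto
  define s1 where "s1 = max 1 (2 * (v + M))"
  have "s1 \<ge> 1" "s1 \<ge> 2 * (v + M)" by (auto simp: s1_def)
  with up[of s1] have s1: "s1 \<ge> 1" "f s1 \<ge> v" by auto
  have "continuous_on {s0..s1} f" using s0 by (intro continuous_on_subset[OF cont]) auto
  then obtain s where "s0 \<le> s" "f s = v" using IVT'[of f s0 v s1] s0 s1 by auto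
  then show ?thesis using f[of s] X(1)[of s] s0 by (intro exI[of _ "X s"]) auto
qed

section \<open>The inverse function on the closed strip\<close>

definition W_strip :: "complex set" where
  "W_strip = {w. - (pi / 2) \<le> Im w \<and> Im w \<le> 0}"

text \<open>The half-plane with the part of its boundary on which r \<ge> 0. The end
  \<open>4 * pi / 3\<close> is included since r = 0 is a value of the inverse; past it
  \<open>T_axis\<close> decreases and repeats values, so injectivity would fail.\<close>

definition sheet :: "complex set" where
  "sheet = {l. Re l > 0 \<or> Re l = 0 \<and> 0 < Im l \<and> Im l \<le> 4 * pi / 3}"

lemma Re_zero_imp_imaginary: "Re l = 0 \<Longrightarrow> l = \<i> * of_real (Im l)"
  by (simp add: complex_eq_iff)

lemma sheet_T_dom: "l \<in> sheet \<Longrightarrow> l \<in> T_dom"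
proof (cases "Re l > 0")
  case False
  assume "l \<in> sheet"
  with False have l: "Re l = 0" "0 < Im l" "Im l \<le> 4 * pi / 3" by (auto simp: sheet_def)
  then have "Im l < 2 * pi" using pi_gt_zero by linarith
  then show ?thesis using axis_T_dom[of "Im l"] l Re_zero_imp_imaginary[of l] by simp
qed (rule Re_pos_T_dom)

lemma T_cov_inj_sheet:
  assumes "l1 \<in> sheet" "l2 \<in> sheet" "T_cov l1 = T_cov l2" shows "l1 = l2"
proof (rule ccontr)
  assume ne: "l1 \<noteq> l2"
  have R: "Re l1 \<ge> 0" "Re l2 \<ge> 0" using assms by (auto simp: sheet_def)
  have "Re l1 = 0" "Re l2 = 0"
    using T_cov_neq[OF _ R(2) sheet_T_dom[OF assms(2)] ne] T_cov_neq[OF _ R(1) sheet_T_dom[OF assms(1)] ne[symmetric]]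
      R assms(3) by force+
  then have l: "0 < Im l1" "Im l1 \<le> 4 * pi / 3" "0 < Im l2" "Im l2 \<le> 4 * pi / 3"
    "l1 = \<i> * of_real (Im l1)" "l2 = \<i> * of_real (Im l2)"
    using assms by (auto simp: sheet_def complex_eq_iff)
  have "Im l1 < 2 * pi" "Im l2 < 2 * pi" using l pi_gt_zero by linarith+
  then have "T_axis (Im l1) = T_axis (Im l2)"
    using assms(3) T_cov_axis[of "Im l1"] T_cov_axis[of "Im l2"] l by (metis of_real_eq_iff)
  then have "Im l1 = Im l2" using T_axis_less[of "Im l1" "Im l2"] T_axis_less[of "Im l2" "Im l1"] l
    by (metis less_irrefl linorder_cases)
  then show False using ne l(5,6) by simp
qed

lemma T_cov_surj:
  assumes "w \<in> W_strip" shows "\<exists>l\<in>sheet. T_cov l = w"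
proof (cases "Im w = 0 \<and> Re w \<le> sqrt 3 * pi / 9")
  case True
  then obtain t where t: "0 < t" "t \<le> 4 * pi / 3" "T_axis t = Re w" using T_axis_surj by blast
  then have "t < 2 * pi" using pi_gt_zero by linarith
  then have "T_cov (\<i> * of_real t) = w" using T_cov_axis[of t] t True by (simp add: complex_eq_iff)
  then show ?thesis using t by (intro bexI[of _ "\<i> * of_real t"]) (auto simp: sheet_def)
next
  case False
  have "\<exists>xi < - (2 * Im w). Re (T_cov (l_coord (2 * Im w) xi)) = Re w"
    using assms False by (intro T_cov_l_coord_surj) (auto simp: W_strip_def)
  then obtain xi where xi: "xi < - (2 * Im w)" "Re (T_cov (l_coord (2 * Im w) xi)) = Re w" by blast
  have "T_cov (l_coord (2 * Im w) xi) = w"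
    using T_cov_l_coord_eq(2)[OF xi(1)] xi(2) by (simp add: complex_eq_iff)
  moreover have "Re (l_coord (2 * Im w) xi) > 0" using Efun_facts(1)[OF xi(1)] by (simp add: l_coord_def)
  ultimately show ?thesis by (intro bexI[of _ "l_coord (2 * Im w) xi"]) (auto simp: sheet_def)
qed

definition sheet_inv :: "complex \<Rightarrow> complex" where
  "sheet_inv w = (THE l. l \<in> sheet \<and> T_cov l = w)"

lemma sheet_inv_T_cov: "l \<in> sheet \<Longrightarrow> sheet_inv (T_cov l) = l"
  unfolding sheet_inv_def by (rule the_equality) (auto intro: T_cov_inj_sheet)

lemma sheet_inv:
  assumes "w \<in> W_strip" shows "sheet_inv w \<in> sheet" "T_cov (sheet_inv w) = w"
  using T_cov_surj[OF assms] sheet_inv_T_cov by auto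

lemma sheet_inv_axis:
  assumes "w \<in> \<real>" "Re w \<le> sqrt 3 * pi / 9"
  shows "\<exists>t. 0 < t \<and> t \<le> 4 * pi / 3 \<and> sheet_inv w = \<i> * of_real t \<and> T_axis t = Re w"
proof -
  obtain t where t: "0 < t" "t \<le> 4 * pi / 3" "T_axis t = Re w" using T_axis_surj[OF assms(2)] by blast
  then have "t < 2 * pi" using pi_gt_zero by linarith
  then have "T_cov (\<i> * of_real t) = w" using T_cov_axis[of t] t assms by (simp add: complex_eq_iff complex_is_Real_iff)
  then show ?thesis using t sheet_inv_T_cov[of "\<i> * of_real t"] by (intro exI[of _ t]) (auto simp: sheet_def)
qed

lemma sheet_inv_not_axis:
  assumes "w \<in> W_strip" "\<not> (w \<in> \<real> \<and> Re w \<le> sqrt 3 * pi / 9)"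
  shows "Re (sheet_inv w) > 0"
proof (rule ccontr)
  assume "\<not> Re (sheet_inv w) > 0"
  then have l: "Re (sheet_inv w) = 0" "0 < Im (sheet_inv w)" "Im (sheet_inv w) \<le> 4 * pi / 3"
    using sheet_inv(1)[OF assms(1)] by (auto simp: sheet_def)
  then have 2: "Im (sheet_inv w) < 2 * pi" using pi_gt_zero by linarith
  have "w = of_real (T_axis (Im (sheet_inv w)))"
    using sheet_inv(2)[OF assms(1)] T_cov_axis[OF l(2) 2] Re_zero_imp_imaginary[OF l(1)] by simp
  then show False using assms(2) T_axis_max[OF l(2) 2] by (metis Re_complex_of_real Reals_of_real)
qed

text \<open>The two branches of \<open>T_inv\<close> are the two parts of the sheet, axis and open
  half-plane. On the second branch the described value is unique because every admissible (\<eta>,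
  \<xi>) has its \<open>l_coord\<close> in the half-plane, where \<open>T_cov\<close> is
  injective.\<close>

lemma T_inv_eq:
  assumes "w \<in> W_strip" shows "T_inv w = r_cov (sheet_inv w)"
proof (cases "w \<in> \<real> \<and> Re w \<le> sqrt 3 * pi / 9")
  case True
  then obtain t where t: "0 < t" "t \<le> 4 * pi / 3" "sheet_inv w = \<i> * of_real t" "T_axis t = Re w"
    using sheet_inv_axis by blast
  then have 2: "t < 2 * pi" using pi_gt_zero by linarith
  have "r_axis t \<ge> 0" by (rule r_axis_nonneg[OF t(1,2)])
  then have "T0_inv (Re w) = r_axis t" using T0_inv_T0 T0_r_axis[OF t(1) 2] t by metis
  then show ?thesis using True r_cov_axis[OF t(1) 2] t by (simp add: T_inv_def)
next
  case False
  have "(THE v. \<exists>(eta, xi)\<in>Theta. w = Hfun eta xi \<and> v = gfun eta xi) = r_cov (sheet_inv w)"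
  proof (rule the_equality)
    have "\<exists>xi < - (2 * Im w). Re (T_cov (l_coord (2 * Im w) xi)) = Re w"
      using assms False by (intro T_cov_l_coord_surj) (auto simp: W_strip_def complex_is_Real_iff)
    then obtain xi where xi: "xi < - (2 * Im w)" "Re (T_cov (l_coord (2 * Im w) xi)) = Re w" by blast
    have T: "T_cov (l_coord (2 * Im w) xi) = w"
      using T_cov_l_coord_eq(2)[OF xi(1)] xi(2) by (simp add: complex_eq_iff)
    have "Re (l_coord (2 * Im w) xi) > 0" using Efun_facts(1)[OF xi(1)] by (simp add: l_coord_def)
    then have "sheet_inv w = l_coord (2 * Im w) xi" using sheet_inv_T_cov[of "l_coord (2 * Im w) xi"] T by (simp add: sheet_def)
    then show "\<exists>(eta, xi)\<in>Theta. w = Hfun eta xi \<and> r_cov (sheet_inv w) = gfun eta xi"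
      using xi(1) T assms
      by (intro bexI[of _ "(2 * Im w, xi)"]) (auto simp: Theta_def W_strip_def r_cov_l_coord T_cov_l_coord[symmetric])
  next
    fix v assume "\<exists>(eta, xi)\<in>Theta. w = Hfun eta xi \<and> v = gfun eta xi"
    then obtain eta xi where *: "xi < - eta" "w = Hfun eta xi" "v = gfun eta xi" by (auto simp: Theta_def)
    have "Re (l_coord eta xi) > 0" using Efun_facts(1)[OF *(1)] by (simp add: l_coord_def)
    then have "sheet_inv w = l_coord eta xi" using sheet_inv_T_cov[of "l_coord eta xi"] T_cov_l_coord[OF *(1)] * by (simp add: sheet_def)
    then show "v = r_cov (sheet_inv w)" using * by (simp add: r_cov_l_coord)
  qed
  then show ?thesis using False by (auto simp: T_inv_def)
qed

text \<open>The derivative of \<open>Im T_cov\<close> with respect to Re l is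
  \<open>- Re (r_cov l) / sqrt 3 < 0\<close>, and \<open>Im T_cov\<close> is 0 on the axis, so
  preimages to the left of the axis fall outside the strip. This tells which values of a local
  inverse are on the sheet.\<close>

lemma Im_T_cov_neg_side:
  assumes "ball p e \<subseteq> T_dom \<inter> {l. Re (r_cov l) > 0 \<and> 0 < Im l \<and> Im l < 2 * pi}" "Re p = 0" "l \<in> ball p e" "Re l < 0"
  shows "Im (T_cov l) > 0"
proof -
  define c where "c = (\<lambda>s::real. Complex (s * Re l) (Im l))"
  have c: "c s \<in> ball p e" if "0 \<le> s" "s \<le> 1" for s
  proof -
    have "(s * Re l)\<^sup>2 \<le> (Re l)\<^sup>2"
      using that assms(4) by (auto simp: power_mult_distrib mult_left_le_one_le power_le_one)
    then have "cmod (p - c s) \<le> cmod (p - l)"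
      unfolding cmod_def using assms(2) by (simp add: c_def)
    then show ?thesis using assms(3) by (simp add: dist_norm)
  qed
  have "Im (T_cov (c 0)) < Im (T_cov (c 1))"
  proof (rule DERIV_pos_imp_increasing[of 0 1 "\<lambda>s. Im (T_cov (c s))"])
    fix s :: real assume s: "0 \<le> s" "s \<le> 1"
    have R: "c s \<in> T_dom" "Re (r_cov (c s)) > 0" using c[OF s] assms(1) by auto
    have "c = (\<lambda>s. of_real s * of_real (Re l) + \<i> * of_real (Im l))"
      by (auto simp: c_def complex_eq_iff)
    then have cd: "(c has_vector_derivative of_real (Re l)) (at s)"
      by (auto intro!: derivative_eq_intros)
    have "(T_cov \<circ> c has_vector_derivative of_real (Re l) * (- \<i> * r_cov (c s) / of_real (sqrt 3))) (at s)"
      by (rule field_vector_diff_chain_at[OF cd DERIV_T_cov[OF R(1)]])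
    from bounded_linear.has_vector_derivative[OF bounded_linear_Im this]
    have "((\<lambda>s. Im (T_cov (c s))) has_real_derivative Im (of_real (Re l) * (- \<i> * r_cov (c s) / of_real (sqrt 3)))) (at s)"
      by (simp add: has_real_derivative_iff_has_vector_derivative o_def)
    moreover have "Im (of_real (Re l) * (- \<i> * r_cov (c s) / of_real (sqrt 3))) = Re l * (- Re (r_cov (c s)) / sqrt 3)"
      by (simp only: times_complex.sel Re_complex_of_real Im_complex_of_real Im_dTcov) 
    moreover have "Re l * (- Re (r_cov (c s)) / sqrt 3) > 0" 
      using mult_neg_pos[OF assms(4) R(2)] by (simp add: divide_less_0_iff)
    ultimately show "\<exists>y. ((\<lambda>s. Im (T_cov (c s))) has_real_derivative y) (at s) \<and> 0 < y" by metis
  qed simp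
  moreover have "c 1 = l" by (simp add: c_def complex_eq_iff)
  moreover have "c 0 = \<i> * of_real (Im l)" by (simp add: c_def complex_eq_iff)
  moreover have "0 < Im l" "Im l < 2 * pi" using assms(1,3) by auto
  ultimately show ?thesis by (simp add: T_cov_axis)
qed

text \<open>In the half-plane \<open>T_cov\<close> is injective and open. At a boundary point below
  the fold its derivative is a nonzero multiple of r, so a local inverse exists on a full ball; over
  the strip it cannot take values with Re l < 0, where \<open>Im T_cov > 0\<close>, and hence agrees
  with \<open>sheet_inv\<close>.\<close>

lemma sheet_inv_local:
  assumes w0: "w0 \<in> W_strip" and ne: "w0 \<noteq> of_real (sqrt 3 * pi / 9)"
  shows "\<exists>e>0. \<exists>f. f holomorphic_on ball w0 e \<and> f ` ball w0 e \<subseteq> T_dom \<and> (\<forall>w\<in>ball w0 e. T_cov (f w) = w) \<and>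
           (\<forall>w\<in>ball w0 e \<inter> W_strip. sheet_inv w = f w)"
proof (cases "Re (sheet_inv w0) > 0")
  case True
  define H where "H = {l. Re l > 0}"
  have H: "open H" "H \<subseteq> T_dom" by (auto simp: H_def open_halfspace_Re_gt Re_pos_T_dom)
  have inj: "inj_on T_cov H"
  proof (rule inj_onI)
    fix x y assume "x \<in> H" "y \<in> H" "T_cov x = T_cov y"
    then show "x = y" using T_cov_inj_sheet[of x y] by (auto simp: H_def sheet_def)
  qed
  have hol: "T_cov holomorphic_on H" by (rule holomorphic_on_subset[OF T_cov_holomorphic H(2)])
  obtain g where g: "g holomorphic_on T_cov ` H" "\<And>z. z \<in> H \<Longrightarrow> g (T_cov z) = z"
    using holomorphic_has_inverse[OF hol H(1) inj] by metis
  have "open (T_cov ` H)" by (rule open_mapping_thm3[OF hol H(1) inj])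
  moreover have "w0 \<in> T_cov ` H" using True sheet_inv(2)[OF w0] by (force simp: H_def)
  ultimately obtain e where e: "e > 0" "ball w0 e \<subseteq> T_cov ` H" using open_contains_ball by blast
  have "\<forall>w\<in>ball w0 e \<inter> W_strip. sheet_inv w = g w"
  proof
    fix w assume "w \<in> ball w0 e \<inter> W_strip"
    then obtain l where l: "l \<in> H" "w = T_cov l" using e by auto
    then show "sheet_inv w = g w" using g(2) sheet_inv_T_cov[of l] by (simp add: H_def sheet_def)
  qed
  moreover have "g ` ball w0 e \<subseteq> T_dom"
  proof
    fix x assume "x \<in> g ` ball w0 e"
    then obtain l where "l \<in> H" "x = g (T_cov l)" using e(2) by auto
    then show "x \<in> T_dom" using g(2) H(2) by auto
  qed
  moreover have "\<forall>w\<in>ball w0 e. T_cov (g w) = w"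
  proof
    fix w assume "w \<in> ball w0 e"
    then obtain l where "l \<in> H" "w = T_cov l" using e(2) by auto
    then show "T_cov (g w) = w" using g(2) by auto
  qed
  ultimately show ?thesis using e(1) holomorphic_on_subset[OF g(1) e(2)] by blast
next
  case False
  define p where "p = sheet_inv w0"
  have p: "Re p = 0" "0 < Im p" "Im p \<le> 4 * pi / 3" "T_cov p = w0"
    using sheet_inv[OF w0] False by (auto simp: sheet_def p_def)
  have pp: "p = \<i> * of_real (Im p)" using Re_zero_imp_imaginary[OF p(1)] .
  have "Im p < 2 * pi" using p pi_gt_zero by linarith
  then have w0t: "w0 = of_real (T_axis (Im p))" "r_cov p = of_real (r_axis (Im p))"
    using T_cov_axis[of "Im p"] r_cov_axis[of "Im p"] p pp by metis+
  then have "Im p \<noteq> 4 * pi / 3" using ne w0t(1) T_axis_crit by metis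
  then have p43: "Im p < 4 * pi / 3" using p by simp
  have pT: "p \<in> T_dom" using sheet_inv(1)[OF w0] sheet_T_dom by (simp add: p_def)
  define S where "S = T_dom \<inter> {l. Re (r_cov l) > 0} \<inter> {l. 0 < Im l \<and> Im l < 4 * pi / 3}"
  have "open (T_dom \<inter> (\<lambda>l. Re (r_cov l)) -` {0<..})"
    by (intro continuous_open_preimage open_T_dom continuous_intros r_cov_continuous)
  moreover have "open {l. 0 < Im l \<and> Im l < 4 * pi / 3}"
    by (intro open_Collect_conj open_Collect_less continuous_intros)
  ultimately have "open ((T_dom \<inter> (\<lambda>l. Re (r_cov l)) -` {0<..}) \<inter> {l. 0 < Im l \<and> Im l < 4 * pi / 3})"
    by (rule open_Int)
  moreover have "(T_dom \<inter> (\<lambda>l. Re (r_cov l)) -` {0<..}) \<inter> {l. 0 < Im l \<and> Im l < 4 * pi / 3} = S"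
    by (auto simp: S_def)
  ultimately have oS: "open S" by simp
  have pS: "p \<in> S" using pT w0t(2) r_axis_pos[OF p(2) p43] p p43 by (simp add: S_def)
  have hol: "T_cov holomorphic_on S" by (rule holomorphic_on_subset[OF T_cov_holomorphic]) (auto simp: S_def)
  have "deriv T_cov p \<noteq> 0"
    using DERIV_imp_deriv[OF DERIV_T_cov[OF pT]] w0t(2) r_axis_pos[OF p(2) p43] by simp
  then obtain r where r: "r > 0" "ball p r \<subseteq> S" "inj_on T_cov (ball p r)"
    using has_complex_derivative_locally_injective[OF hol pS oS] by metis
  have hol': "T_cov holomorphic_on ball p r" by (rule holomorphic_on_subset[OF hol r(2)])
  obtain g where g: "g holomorphic_on T_cov ` ball p r" "\<And>z. z \<in> ball p r \<Longrightarrow> g (T_cov z) = z"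
    using holomorphic_has_inverse[OF hol' open_ball r(3)] by metis
  have "open (T_cov ` ball p r)" by (rule open_mapping_thm3[OF hol' open_ball r(3)])
  moreover have "w0 \<in> T_cov ` ball p r" using p(4) r(1) by force
  ultimately obtain e where e: "e > 0" "ball w0 e \<subseteq> T_cov ` ball p r" using open_contains_ball by blast
  have B: "ball p r \<subseteq> T_dom \<inter> {l. Re (r_cov l) > 0 \<and> 0 < Im l \<and> Im l < 2 * pi}"
    using r(2) pi_gt_zero by (auto simp: S_def)
  have "\<forall>w\<in>ball w0 e \<inter> W_strip. sheet_inv w = g w"
  proof
    fix w assume w: "w \<in> ball w0 e \<inter> W_strip"
    then obtain l where l: "l \<in> ball p r" "w = T_cov l" using e by auto
    have "\<not> Re l < 0" using Im_T_cov_neg_side[OF B p(1) l(1)] w l(2) by (auto simp: W_strip_def)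
    then have "l \<in> sheet" using l(1) r(2) by (auto simp: S_def sheet_def)
    then show "sheet_inv w = g w" using l g(2) sheet_inv_T_cov[of l] by simp
  qed
  moreover have "g ` ball w0 e \<subseteq> T_dom"
  proof
    fix x assume "x \<in> g ` ball w0 e"
    then obtain l where "l \<in> ball p r" "x = g (T_cov l)" using e(2) by auto
    then show "x \<in> T_dom" using g(2) B by auto
  qed
  moreover have "\<forall>w\<in>ball w0 e. T_cov (g w) = w"
  proof
    fix w assume "w \<in> ball w0 e"
    then obtain l where "l \<in> ball p r" "w = T_cov l" using e(2) by auto
    then show "T_cov (g w) = w" using g(2) by auto
  qed
  ultimately show ?thesis using e(1) holomorphic_on_subset[OF g(1) e(2)] by blast
qed

section \<open>Growth of the inverse and continuity at the fold\<close>

definition T_const :: real where "T_const = ln 3 / 2 + sqrt 3 * pi / 9"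

lemma Re_T_cov:
  "l \<in> T_dom \<Longrightarrow> Re (T_cov l) = Re l / 2 + ln (cmod (1 - exp (- l))) + Im l / (2 * sqrt 3) - T_const"
  using T_dom_exp_ne[of l] by (auto simp: T_cov_def T_const_def Re_divide_of_real exp_minus)

lemma T_dom_Re_pos: "l \<in> T_dom \<Longrightarrow> Re (1 - exp (- l)) > 0"
  by (simp add: T_dom_def)

text \<open>The logarithm in \<open>T_cov\<close> contributes an angle of modulus less than pi/2, so
  Im l is determined by \<open>Im T_cov\<close> and Re l within a window of length 2 pi.\<close>

lemma Im_bounds:
  assumes "l \<in> T_dom"
  shows "2 * Im (T_cov l) + Re l / sqrt 3 < Im l" "Im l < 2 * Im (T_cov l) + Re l / sqrt 3 + 2 * pi"
proof -
  have ne: "1 - exp (- l) \<noteq> 0" using T_dom_Re_pos[OF assms] by auto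
  have "\<bar>Im (Ln (1 - exp (- l)))\<bar> < pi / 2" using Re_Ln_pos_lt[OF ne] T_dom_Re_pos[OF assms] by simp
  moreover have "Im (T_cov l) = Im l / 2 + Im (Ln (1 - exp (- l))) - Re l / (2 * sqrt 3) - pi / 2"
    by (simp add: T_cov_def Im_divide_of_real)
  moreover have "Re l / (2 * sqrt 3) = (Re l / sqrt 3) / 2" by simp
  ultimately show "2 * Im (T_cov l) + Re l / sqrt 3 < Im l" "Im l < 2 * Im (T_cov l) + Re l / sqrt 3 + 2 * pi"
    by linarith+
qed

lemma norm_1_minus_exp:
  assumes "Re l \<ge> 0" shows "1 - exp (- Re l) \<le> cmod (1 - exp (- l))" "cmod (1 - exp (- l)) \<le> 2"
proof -
  show "1 - exp (- Re l) \<le> cmod (1 - exp (- l))"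
    using norm_triangle_ineq2[of 1 "exp (- l)"] by simp
  have "cmod (1 - exp (- l)) \<le> 1 + cmod (exp (- l))" by (metis norm_one norm_triangle_ineq4)
  also have "\<dots> \<le> 2" using assms by simp
  finally show "cmod (1 - exp (- l)) \<le> 2" .
qed

text \<open>Bounded Re w forces bounded Re l, which is the compactness needed at the fold. Once Re l
  \<ge> 1 the logarithm is bounded below, and so is Im l, hence \<open>Re l / 2\<close>
  dominates.\<close>

lemma Re_sheet_inv_upper: "\<exists>C. \<forall>w\<in>W_strip. Re (sheet_inv w) \<le> max 1 (2 * Re w + C)"
proof (intro exI ballI)
  fix w assume w: "w \<in> W_strip"
  define l where "l = sheet_inv w"
  have l: "l \<in> T_dom" "Re l \<ge> 0" "T_cov l = w" using sheet_inv[OF w] sheet_T_dom by (auto simp: l_def sheet_def)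
  show "Re (sheet_inv w) \<le> max 1 (2 * Re w + (2 * T_const - 2 * ln (1 - exp (- 1)) + pi / sqrt 3))"
  proof (cases "Re l \<ge> 1")
    case True
    have "1 - exp (- 1 :: real) \<le> 1 - exp (- Re l)" using True by simp
    also have "\<dots> \<le> cmod (1 - exp (- l))" by (rule norm_1_minus_exp[OF l(2)])
    finally have 1: "ln (1 - exp (- 1)) \<le> ln (cmod (1 - exp (- l)))"
      by (subst ln_le_cancel_iff) (auto intro: less_le_trans)
    have "- pi \<le> Im l"
    proof -
      have "Re l / sqrt 3 \<ge> 0" using l by simp
      then show ?thesis using Im_bounds(1)[OF l(1)] w unfolding l(3) W_strip_def by auto
    qed
    then have "- pi / (2 * sqrt 3) \<le> Im l / (2 * sqrt 3)" by (intro divide_right_mono) auto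
    moreover have "- pi / (2 * sqrt 3) = - (pi / sqrt 3) / 2" by simp
    ultimately show ?thesis using Re_T_cov[OF l(1)] 1 unfolding l(3) l_def[symmetric] by simp
  qed (simp add: l_def)
qed

text \<open>Growth in the other direction, for the limit at z = sqrt 2: there Re W tends to
  infinity, and this bound sends Re l to infinity.\<close>

lemma Re_sheet_inv_lower: "\<exists>C. \<forall>w\<in>W_strip. Re w \<le> Re (sheet_inv w) + C"
proof (intro exI ballI)
  fix w assume w: "w \<in> W_strip"
  define l where "l = sheet_inv w"
  have l: "l \<in> T_dom" "Re l \<ge> 0" "T_cov l = w" using sheet_inv[OF w] sheet_T_dom by (auto simp: l_def sheet_def)
  have "cmod (1 - exp (- l)) > 0" using T_dom_Re_pos[OF l(1)] by auto
  then have 1: "ln (cmod (1 - exp (- l))) \<le> ln 2" using norm_1_minus_exp(2)[OF l(2)] by simp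
  have "Im l \<le> Re l / sqrt 3 + 2 * pi" using Im_bounds(2)[OF l(1)] w unfolding l(3) W_strip_def by auto
  then have "Im l / (2 * sqrt 3) \<le> (Re l / sqrt 3 + 2 * pi) / (2 * sqrt 3)" by (intro divide_right_mono) auto
  also have "\<dots> = Re l / 6 + pi / sqrt 3" by (simp add: field_simps)
  finally show "Re w \<le> Re (sheet_inv w) + (ln 2 + pi / sqrt 3 - T_const)"
    using Re_T_cov[OF l(1)] 1 l(2) unfolding l(3) l_def[symmetric] by simp
qed

text \<open>Free of logarithms, so the right-hand side still has a limit when l tends to a zero of
  \<open>1 - exp (- l)\<close>, where \<open>T_cov\<close> itself blows up.\<close>

lemma exp_T_cov:
  assumes "l \<in> T_dom"
  shows "exp (T_cov l) = exp (l / 2) * (1 - exp (- l)) * exp (- (\<i> * l / of_real (2 * sqrt 3)))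
     * exp (- (\<i> * of_real (pi / 2) + of_real T_const))"
proof -
  have ne: "1 - exp (- l) \<noteq> 0" using T_dom_Re_pos[OF assms] by auto
  have "T_cov l = l / 2 + Ln (1 - exp (- l)) + - (\<i> * l / of_real (2 * sqrt 3))
     + - (\<i> * of_real (pi / 2) + of_real T_const)"
    by (simp add: T_cov_def T_const_def)
  then show ?thesis by (simp only: exp_add exp_Ln[OF ne])
qed

text \<open>The derivative of \<open>T_cov\<close> vanishes at the limit point, so no local inverse
  is at hand. If convergence failed, preimages of a sequence tending to the fold value would stay
  bounded and accumulate at some L in the closed half-plane other than the fold. Such an L would be
  another preimage: impossible in the interior by \<open>T_cov_neq\<close>, and on the axis because
  \<open>T_axis\<close> attains its maximum only once.\<close>

lemma sheet_inv_tendsto_crit: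
  "(sheet_inv \<longlongrightarrow> \<i> * of_real (4 * pi / 3)) (at (of_real (sqrt 3 * pi / 9)) within W_strip)"
proof -
  define w0 where "w0 = complex_of_real (sqrt 3 * pi / 9)"
  define l0 where "l0 = \<i> * complex_of_real (4 * pi / 3)"
  have pp: "0 < 4 * pi / 3" "4 * pi / 3 < 2 * pi" using pi_gt_zero by linarith+
  have l0: "l0 \<in> T_dom" "T_cov l0 = w0" "Re l0 = 0"
    using axis_T_dom[OF pp] T_cov_axis[OF pp] T_axis_crit by (auto simp: l0_def w0_def)
  have "\<exists>d>0. \<forall>w\<in>W_strip. dist w w0 < d \<longrightarrow> dist (sheet_inv w) l0 < e" if e: "e > 0" for e
  proof (rule ccontr)
    assume n: "\<not> (\<exists>d>0. \<forall>w\<in>W_strip. dist w w0 < d \<longrightarrow> dist (sheet_inv w) l0 < e)"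
    have "\<forall>d>0. \<exists>w\<in>W_strip. dist w w0 < d \<and> dist (sheet_inv w) l0 \<ge> e"
      using n by (meson not_less)
    then have "\<exists>w. w \<in> W_strip \<and> dist w w0 < inverse (real (Suc n)) \<and> dist (sheet_inv w) l0 \<ge> e" for n
      by (metis inverse_positive_iff_positive of_nat_0_less_iff zero_less_Suc)
    then obtain x where x: "\<And>n. x n \<in> W_strip" "\<And>n. dist (x n) w0 < inverse (real (Suc n))"
      "\<And>n. dist (sheet_inv (x n)) l0 \<ge> e" by metis
    have xl: "x \<longlonglongrightarrow> w0"
    proof (rule metric_tendsto_imp_tendsto[OF LIMSEQ_inverse_real_of_nat])
      show "eventually (\<lambda>n. dist (x n) w0 \<le> dist (inverse (real (Suc n))) 0) sequentially"
        using x(2) by (intro always_eventually allI) (simp add: less_imp_le)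
    qed
    define l where "l = (\<lambda>n. sheet_inv (x n))"
    have l: "l n \<in> T_dom" "Re (l n) \<ge> 0" "T_cov (l n) = x n" for n
      using sheet_inv[OF x(1)[of n]] sheet_T_dom by (auto simp: l_def sheet_def)
    have x1: "dist (x n) w0 < 1" for n
    proof -
      have "inverse (real (Suc n)) \<le> 1" by (simp add: field_simps)
      then show ?thesis using x(2)[of n] by linarith
    qed
    have rx: "Re (x n) \<le> Re w0 + 1" for n
      using x1[of n] abs_Re_le_cmod[of "x n - w0"] by (simp add: dist_norm)
    obtain C where C: "\<forall>w\<in>W_strip. Re (sheet_inv w) \<le> max 1 (2 * Re w + C)" using Re_sheet_inv_upper by blast
    define B where "B = max 1 (2 * (Re w0 + 1) + C)"
    have lB: "Re (l n) \<le> B" for n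
    proof -
      have "Re (l n) \<le> max 1 (2 * Re (x n) + C)" using C x(1) by (simp add: l_def)
      also have "\<dots> \<le> B" unfolding B_def using rx[of n] by (intro max.mono) auto
      finally show ?thesis .
    qed
    have "\<bar>Im (l n)\<bar> \<le> B / sqrt 3 + 2 * pi" for n
    proof -
      have "0 \<le> Re (l n) / sqrt 3" "Re (l n) / sqrt 3 \<le> B / sqrt 3"
        using l(2)[of n] lB[of n] by (auto intro: divide_right_mono)
      moreover have "- (pi / 2) \<le> Im (x n)" "Im (x n) \<le> 0" using x(1)[of n] by (auto simp: W_strip_def)
      ultimately show ?thesis using Im_bounds[OF l(1)[of n]] pi_gt_zero unfolding l(3) by linarith
    qed
    moreover have "\<bar>Re (l n)\<bar> \<le> B" for n using l(2)[of n] lB[of n] by simp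
    ultimately have "cmod (l n) \<le> B + (B / sqrt 3 + 2 * pi)" for n
      using cmod_le[of "l n"] by (smt (verit))
    then have "bounded (range l)" unfolding bounded_iff by blast
    then obtain L r where r: "strict_mono r" "(l \<circ> r) \<longlonglongrightarrow> L"
      using bounded_imp_convergent_subsequence by blast
    have xr: "(\<lambda>n. x (r n)) \<longlonglongrightarrow> w0" using LIMSEQ_subseq_LIMSEQ[OF xl r(1)] by (simp add: o_def)
    have lr: "(\<lambda>n. l (r n)) \<longlonglongrightarrow> L" using r(2) by (simp add: o_def)
    have L0: "Re L \<ge> 0"
      by (rule LIMSEQ_le_const[OF tendsto_Re[OF lr]]) (use l in auto)
    have "e \<le> dist L l0"
      by (rule LIMSEQ_le_const[OF tendsto_dist[OF lr tendsto_const]]) (use x(3) in \<open>auto simp: l_def\<close>)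
    then have Lne: "L \<noteq> l0" using e by auto
    have "Re L / sqrt 3 \<le> Im L"
    proof (rule LIMSEQ_le)
      show "(\<lambda>n. 2 * Im (x (r n)) + Re (l (r n)) / sqrt 3) \<longlonglongrightarrow> Re L / sqrt 3"
        by (auto intro!: tendsto_eq_intros xr lr simp: w0_def)
      show "(\<lambda>n. Im (l (r n))) \<longlonglongrightarrow> Im L" by (intro tendsto_Im lr)
    qed (use Im_bounds(1)[OF l(1)] in \<open>auto simp: l(3) intro!: less_imp_le\<close>)
    moreover have "Im L \<le> Re L / sqrt 3 + 2 * pi"
    proof (rule LIMSEQ_le)
      show "(\<lambda>n. 2 * Im (x (r n)) + Re (l (r n)) / sqrt 3 + 2 * pi) \<longlonglongrightarrow> Re L / sqrt 3 + 2 * pi"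
        by (auto intro!: tendsto_eq_intros xr lr simp: w0_def)
      show "(\<lambda>n. Im (l (r n))) \<longlonglongrightarrow> Im L" by (intro tendsto_Im lr)
    qed (use Im_bounds(2)[OF l(1)] in \<open>auto simp: l(3) intro!: less_imp_le\<close>)
    \<comment> \<open>Excludes that L is one of the ends 0 and \<open>2 * pi * \<i>\<close> of the
      axis segment: there the exponential of \<open>T_cov\<close> would tend to 0, while it tends to
      \<open>exp w0\<close>.\<close>
    moreover have "1 - exp (- L) \<noteq> 0"
    proof
      assume z: "1 - exp (- L) = 0"
      have "(\<lambda>n. exp (T_cov (l (r n)))) \<longlonglongrightarrow> exp w0"
        unfolding l(3) by (intro tendsto_exp xr)
      moreover have "(\<lambda>n. exp (l (r n) / 2) * (1 - exp (- l (r n))) * exp (- (\<i> * l (r n) / of_real (2 * sqrt 3)))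
           * exp (- (\<i> * of_real (pi / 2) + of_real T_const))) \<longlonglongrightarrow>
          exp (L / 2) * (1 - exp (- L)) * exp (- (\<i> * L / of_real (2 * sqrt 3)))
           * exp (- (\<i> * of_real (pi / 2) + of_real T_const))"
        by (intro tendsto_intros lr) auto
      ultimately show False unfolding exp_T_cov[OF l(1)] z using LIMSEQ_unique by fastforce
    qed
    ultimately have "L \<in> T_dom"
    proof (cases "Re L > 0")
      case False
      then have R: "Re L = 0" using L0 by simp
      assume *: "Re L / sqrt 3 \<le> Im L" "Im L \<le> Re L / sqrt 3 + 2 * pi" "1 - exp (- L) \<noteq> 0"
      have LL: "L = \<i> * of_real (Im L)" by (rule Re_zero_imp_imaginary[OF R])
      have "Im L \<noteq> 0" using *(3) LL by auto
      moreover have "Im L \<noteq> 2 * pi"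
      proof
        assume "Im L = 2 * pi"
        then have "- L = - (of_real (2 * pi) * \<i>)" using LL by (simp add: mult.commute)
        then have "exp (- L) = 1" by (simp add: exp_minus exp_two_pi_i' mult.commute)
        then show False using *(3) by simp
      qed
      ultimately have "0 < Im L" "Im L < 2 * pi" using * R by auto
      then show ?thesis using axis_T_dom[of "Im L"] LL by simp
    qed (rule Re_pos_T_dom)
    then have "isCont T_cov L" using T_cov_continuous open_T_dom continuous_on_eq_continuous_at by blast
    then have "(\<lambda>n. T_cov (l (r n))) \<longlonglongrightarrow> T_cov L" using lr by (rule isCont_tendsto_compose)
    then have TL: "T_cov L = w0" unfolding l(3) using LIMSEQ_unique xr by blast
    show False
    proof (cases "Re L > 0")
      case True
      then show False using T_cov_neq[OF True _ l0(1) Lne] l0 TL by simp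
    next
      case False
      then have R: "Re L = 0" using L0 by simp
      have LL: "L = \<i> * of_real (Im L)" by (rule Re_zero_imp_imaginary[OF R])
      have I: "0 < Im L" "Im L < 2 * pi" using Im_bounds[OF \<open>L \<in> T_dom\<close>] R TL by (auto simp: w0_def)
      have "T_axis (Im L) = sqrt 3 * pi / 9"
        using T_cov_axis[OF I] TL LL by (metis of_real_eq_iff w0_def)
      then show False using T_axis_max_eq[OF I] LL Lne unfolding l0_def by metis
    qed
  qed
  then show ?thesis unfolding Lim_within w0_def[symmetric] l0_def[symmetric] by blast
qed

lemma sheet_inv_continuous: "continuous_on W_strip sheet_inv"
  unfolding continuous_on_def
proof
  fix w0 assume w0: "w0 \<in> W_strip"
  show "(sheet_inv \<longlongrightarrow> sheet_inv w0) (at w0 within W_strip)"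
  proof (cases "w0 = of_real (sqrt 3 * pi / 9)")
    case True
    obtain t where t: "0 < t" "t \<le> 4 * pi / 3" "sheet_inv w0 = \<i> * of_real t" "T_axis t = Re w0"
      using sheet_inv_axis[of w0] True by auto
    have "t = 4 * pi / 3" using T_axis_max_eq[of t] t True pi_gt_zero by auto
    then have "sheet_inv w0 = \<i> * of_real (4 * pi / 3)" by (simp only: t(3))
    then show ?thesis using sheet_inv_tendsto_crit by (simp only: True)
  next
    case False
    then obtain e f where e: "e > 0" "f holomorphic_on ball w0 e" "\<forall>w\<in>ball w0 e \<inter> W_strip. sheet_inv w = f w"
      using sheet_inv_local[OF w0 False] by blast
    have "isCont f w0" using e(1) holomorphic_on_imp_continuous_on[OF e(2)]
      by (simp add: continuous_on_eq_continuous_at)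
    then have "(f \<longlongrightarrow> sheet_inv w0) (at w0 within W_strip)"
      using e(1,3) w0 by (metis IntI centre_in_ball continuous_at tendsto_within_subset top_greatest)
    moreover have "eventually (\<lambda>w. f w = sheet_inv w) (at w0 within W_strip)"
      unfolding eventually_at using e by (intro exI[of _ e]) (auto simp: dist_commute)
    ultimately show ?thesis by (rule Lim_transform_eventually)
  qed
qed

text \<open>Keeps preimages of the strip away from \<open>2 * pi * \<i>\<close>, a zero of
  \<open>1 - exp (- l)\<close> that must be told apart from 0. The height \<open>3 * pi / 2\<close>
  lies between the fold and \<open>2 * pi\<close>: on the axis r < 0 there, so
  \<open>Im T_cov\<close> turns positive as soon as Re l does, and it increases with Im l since Im r
  > 0.\<close>

lemma Im_lt_small:
  "\<exists>d>0. \<forall>l\<in>sheet. Re l < d \<and> Im (T_cov l) \<le> 0 \<longrightarrow> Im l < 3 * pi / 2"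
proof -
  have pp: "0 < 3 * pi / 2" "3 * pi / 2 < 2 * pi" "4 * pi / 3 < 3 * pi / 2" using pi_gt_zero by linarith+
  define p where "p = (\<lambda>s::real. of_real s + \<i> * complex_of_real (3 * pi / 2))"
  have p0: "p 0 \<in> T_dom" using axis_T_dom[OF pp(1,2)] by (simp add: p_def)
  have der: "((\<lambda>s. Im (T_cov (q s))) has_real_derivative Im (c * (- \<i> * r_cov (q s) / of_real (sqrt 3)))) (at s)"
    if "q s \<in> T_dom" "(q has_vector_derivative c) (at s)" for q s c
  proof -
    have "(T_cov \<circ> q has_vector_derivative c * (- \<i> * r_cov (q s) / of_real (sqrt 3))) (at s)"
      by (rule field_vector_diff_chain_at[OF that(2) DERIV_T_cov[OF that(1)]])
    from bounded_linear.has_vector_derivative[OF bounded_linear_Im this]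
    show ?thesis by (simp add: has_real_derivative_iff_has_vector_derivative o_def)
  qed
  have "(p has_vector_derivative 1) (at 0)" unfolding p_def by (auto intro!: derivative_eq_intros)
  from der[OF p0 this]
  have "((\<lambda>s. Im (T_cov (p s))) has_real_derivative - r_axis (3 * pi / 2) / sqrt 3) (at 0)"
    using r_cov_axis[OF pp(1,2)] by (simp only: mult_1 Im_dTcov) (simp add: p_def)
  moreover have "- r_axis (3 * pi / 2) / sqrt 3 > 0" using r_axis_neg[OF pp(3,2)] by (simp add: divide_less_0_iff)
  ultimately obtain d where d: "d > 0" "\<And>h. h > 0 \<Longrightarrow> h < d \<Longrightarrow> Im (T_cov (p 0)) < Im (T_cov (p (0 + h)))"
    using DERIV_pos_inc_right by blast
  have P0: "Im (T_cov (p 0)) = 0" using T_cov_axis[OF pp(1,2)] by (simp add: p_def)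
  have "Im l < 3 * pi / 2" if l: "l \<in> sheet" "Re l < d" "Im (T_cov l) \<le> 0" for l
  proof (cases "Re l > 0")
    case False
    then show ?thesis using l pp by (auto simp: sheet_def)
  next
    case True
    show ?thesis
    proof (rule ccontr)
      assume "\<not> Im l < 3 * pi / 2"
      then have ge: "3 * pi / 2 \<le> Im l" by simp
      define q where "q = (\<lambda>t::real. of_real (Re l) + \<i> * complex_of_real t)"
      have "Im (T_cov (q (3 * pi / 2))) \<le> Im (T_cov (q (Im l)))"
      proof (rule DERIV_nonneg_imp_nondecreasing[OF ge])
        fix t :: real
        have qT: "q t \<in> T_dom" "Re (q t) > 0" using True by (auto simp: q_def intro: Re_pos_T_dom)
        have "(q has_vector_derivative \<i>) (at t)" unfolding q_def by (auto intro!: derivative_eq_intros)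
        from der[OF qT(1) this]
        have "((\<lambda>s. Im (T_cov (q s))) has_real_derivative Im (r_cov (q t)) / sqrt 3) (at t)"
          by (simp add: Im_divide_of_real)
        then show "\<exists>y. ((\<lambda>s. Im (T_cov (q s))) has_real_derivative y) (at t) \<and> 0 \<le> y"
          using Im_r_cov_pos[OF qT(2)] by (intro exI[of _ "Im (r_cov (q t)) / sqrt 3"]) auto
      qed
      moreover have "q (3 * pi / 2) = p (Re l)" "q (Im l) = l" by (auto simp: q_def p_def complex_eq_iff)
      ultimately show False using d(2)[of "Re l"] True l P0 by simp
    qed
  qed
  then show ?thesis using d(1) by blast
qed

section \<open>The reciprocal of \<open>G\<close> on the closed quadrant\<close>

definition quadrant :: "complex set" where "quadrant = {z. 0 \<le> Re z \<and> 0 \<le> Im z}"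

definition quadrant_reg :: "complex set" where "quadrant_reg = quadrant - {0, of_real (sqrt 2)}"

text \<open>Rotating by \<open>\<i>\<close> moves the cut of the logarithm out of \<open>Z_quad ` quadrant\<close>, so that
  \<open>W_quad\<close> covers both cases of \<open>W\<close> at once and is holomorphic around the interval \<open>(0, \<surd>2)\<close>.\<close>

definition Z_quad :: "complex \<Rightarrow> complex" where "Z_quad z = z\<^sup>2 / (z\<^sup>2 - 2)"

definition W_dom :: "complex set" where
  "W_dom = {z. z\<^sup>2 - 2 \<noteq> 0} \<inter> (\<lambda>z. \<i> * (Z_quad z)) -` (- \<real>\<^sub>\<le>\<^sub>0)"

definition W_quad :: "complex \<Rightarrow> complex" where
  "W_quad z = (Ln (\<i> * (Z_quad z)) - \<i> * of_real (pi / 2)) / 2"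

lemma open_W_dom: "open W_dom"
proof -
  have "open {z::complex. z\<^sup>2 - 2 \<noteq> 0}" by (intro open_Collect_neq continuous_intros)
  then show ?thesis unfolding W_dom_def Z_quad_def
    by (intro continuous_open_preimage continuous_intros) (auto intro: closed_nonpos_Reals_complex)
qed

lemma W_quad_holomorphic: "W_quad holomorphic_on W_dom"
  unfolding W_quad_def Z_quad_def by (intro holomorphic_intros) (auto simp: W_dom_def Z_quad_def)

lemma quadrant_sq2: "z \<in> quadrant \<Longrightarrow> z\<^sup>2 = 2 \<Longrightarrow> z = of_real (sqrt 2)"
proof -
  assume z: "z \<in> quadrant" "z\<^sup>2 = 2"
  have "(z - of_real (sqrt 2)) * (z + of_real (sqrt 2)) = z\<^sup>2 - of_real (sqrt 2) * of_real (sqrt 2)"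
    by (simp add: power2_eq_square algebra_simps)
  also have "\<dots> = 0" using z by (simp flip: of_real_mult)
  finally consider "z = of_real (sqrt 2)" | "z = - of_real (sqrt 2)"
    by (auto simp: eq_neg_iff_add_eq_0)
  then show ?thesis using z by cases (auto simp: quadrant_def)
qed

lemma zeta_facts:
  assumes "z \<in> quadrant_reg"
  defines "\<zeta> \<equiv> Z_quad z"
  shows "z\<^sup>2 - 2 \<noteq> 0" "\<zeta> \<noteq> 0" "\<zeta> = 1 + 2 / (z\<^sup>2 - 2)" "Im \<zeta> \<le> 0"
    "Im z > 0 \<Longrightarrow> Re z > 0 \<Longrightarrow> Im \<zeta> < 0"
proof -
  have zQ: "z \<in> quadrant" "z \<noteq> 0" "z \<noteq> of_real (sqrt 2)" using assms by (auto simp: quadrant_reg_def)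
  show 2: "z\<^sup>2 - 2 \<noteq> 0" using quadrant_sq2[OF zQ(1)] zQ(3) by auto
  show "\<zeta> \<noteq> 0" using zQ 2 by (simp add: \<zeta>_def Z_quad_def)
  show e: "\<zeta> = 1 + 2 / (z\<^sup>2 - 2)" using 2 by (simp add: \<zeta>_def Z_quad_def field_simps)
  have "Im \<zeta> = - 2 * Im (z\<^sup>2) / ((Re (z\<^sup>2 - 2))\<^sup>2 + (Im (z\<^sup>2 - 2))\<^sup>2)"
    unfolding e by (simp add: Im_divide)
  also have "Im (z\<^sup>2) = 2 * Re z * Im z" by (simp add: Im_power2)
  finally have I: "Im \<zeta> = - 4 * Re z * Im z / ((Re (z\<^sup>2 - 2))\<^sup>2 + (Im (z\<^sup>2 - 2))\<^sup>2)" by simp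
  have p: "(Re (z\<^sup>2 - 2))\<^sup>2 + (Im (z\<^sup>2 - 2))\<^sup>2 > 0"
    using 2 by (metis complex_eq_iff sum_power2_gt_zero_iff zero_complex.sel)
  show "Im \<zeta> \<le> 0" unfolding I using zQ(1) p by (intro divide_nonpos_pos) (auto simp: quadrant_def)
  show "Im \<zeta> < 0" if "Im z > 0" "Re z > 0"
    unfolding I using that p by (intro divide_neg_pos) auto
qed

lemma quadrant_reg_W_dom: "z \<in> quadrant_reg \<Longrightarrow> z \<in> W_dom"
proof -
  assume z: "z \<in> quadrant_reg"
  note f = zeta_facts[OF z]
  have "\<i> * (Z_quad z) \<notin> \<real>\<^sub>\<le>\<^sub>0"
    using f(2,4) by (auto simp: complex_nonpos_Reals_iff complex_eq_iff simp del: divide_eq_0_iff)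
  then show ?thesis using f(1) by (simp add: W_dom_def)
qed

lemma Im_W_quad:
  assumes "z \<in> quadrant_reg" shows "W_quad z \<in> W_strip" "Im z > 0 \<Longrightarrow> Re z > 0 \<Longrightarrow> Im (W_quad z) < 0"
proof -
  note f = zeta_facts[OF assms]
  have ne: "\<i> * (Z_quad z) \<noteq> 0" using f(2) by simp
  have "\<bar>Im (Ln (\<i> * (Z_quad z)))\<bar> \<le> pi / 2" using Re_Ln_pos_le[OF ne] f(4) by simp
  moreover have "Im (W_quad z) = (Im (Ln (\<i> * Z_quad z)) - pi / 2) / 2" by (simp add: W_quad_def)
  ultimately show "W_quad z \<in> W_strip" by (auto simp: W_strip_def abs_le_iff)
  assume "Im z > 0" "Re z > 0"
  then have "\<bar>Im (Ln (\<i> * (Z_quad z)))\<bar> < pi / 2" using Re_Ln_pos_lt[OF ne] f(5) by simp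
  then show "Im (W_quad z) < 0" by (simp add: W_quad_def)
qed

lemma Re_W_quad: "z \<in> quadrant_reg \<Longrightarrow> Re (W_quad z) = ln (cmod (Z_quad z)) / 2"
  using zeta_facts(1,2)[of z] by (simp add: W_quad_def norm_mult)

text \<open>In the closed lower half-plane the logarithms of Z and \<open>\<i> * Z\<close> differ by
  \<open>\<i> * pi / 2\<close> except on the negative real axis. On this quadrant Z is real only on
  the boundary, and it is positive on the imaginary half-line and beyond sqrt 2, so the interval (0,
  sqrt 2) is the only exception.\<close>

lemma W_quad_eq_Ln:
  assumes z: "z \<in> quadrant_reg" and n: "\<not> (Im z = 0 \<and> 0 < Re z \<and> Re z < sqrt 2)"
  shows "W_quad z = Ln (1 + 2 / (z\<^sup>2 - 2)) / 2"
proof -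
  define \<zeta> where "\<zeta> = Z_quad z"
  note f = zeta_facts[OF z, folded \<zeta>_def]
  have "0 \<le> Re \<zeta> \<or> Im \<zeta> < 0"
  proof (rule ccontr)
    assume "\<not> (0 \<le> Re \<zeta> \<or> Im \<zeta> < 0)"
    then have \<zeta>: "Re \<zeta> < 0" "Im \<zeta> = 0" using f(4) by auto
    then have "\<not> (Im z > 0 \<and> Re z > 0)" using f(5) by auto
    then have "Re z = 0 \<or> Im z = 0" using z by (auto simp: quadrant_reg_def quadrant_def)
    then show False
    proof
      assume "Re z = 0"
      then have "z\<^sup>2 = - of_real ((Im z)\<^sup>2)" by (simp add: complex_eq_iff Re_power2 Im_power2)
      then have "\<zeta> = - of_real ((Im z)\<^sup>2) / (- of_real ((Im z)\<^sup>2) - 2)" by (simp only: \<zeta>_def Z_quad_def)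
      also have "- complex_of_real ((Im z)\<^sup>2) - 2 = - of_real ((Im z)\<^sup>2 + 2)" by simp
      also have "- complex_of_real ((Im z)\<^sup>2) / - of_real ((Im z)\<^sup>2 + 2) = of_real ((Im z)\<^sup>2 / ((Im z)\<^sup>2 + 2))"
        by (simp only: minus_divide_divide of_real_divide)
      finally have "Re \<zeta> = (Im z)\<^sup>2 / ((Im z)\<^sup>2 + 2)" by (simp only: Re_complex_of_real)
      moreover have "(Im z)\<^sup>2 / ((Im z)\<^sup>2 + 2) \<ge> 0" by simp
      ultimately show False using \<zeta>(1) by simp
    next
      assume I: "Im z = 0"
      then have zr: "z = of_real (Re z)" by (simp add: complex_eq_iff)
      have "\<zeta> = of_real ((Re z)\<^sup>2 / ((Re z)\<^sup>2 - 2))" unfolding \<zeta>_def Z_quad_def by (subst (1 2) zr) simp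
      then have "(Re z)\<^sup>2 / ((Re z)\<^sup>2 - 2) < 0" using \<zeta>(1) by (simp only: Re_complex_of_real)
      then have "(Re z)\<^sup>2 < 2" by (auto simp: divide_less_0_iff)
      then have "Re z < sqrt 2" by (simp add: real_less_rsqrt)
      moreover have "Re z \<noteq> 0" using z I by (auto simp: quadrant_reg_def complex_eq_iff)
      moreover have "Re z \<ge> 0" using z by (simp add: quadrant_reg_def quadrant_def)
      ultimately show False using n I by simp
    qed
  qed
  then have "Ln (\<i> * \<zeta>) = Ln \<zeta> + \<i> * of_real pi / 2" using Ln_times_ii[OF f(2)] by auto
  then show ?thesis unfolding W_quad_def \<zeta>_def[symmetric] f(3)[symmetric] by simp
qed

text \<open>Z is negative here and \<open>\<i> * Z\<close> has argument -pi/2: the argument of Z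
  counts as -pi, its boundary value from inside the quadrant, and this yields the term
  \<open>- \<i> * pi / 2\<close> in the second case of W.\<close>

lemma W_quad_gap:
  assumes "0 < x" "x < sqrt 2"
  shows "W_quad (of_real x) = of_real (ln (2 / (2 - x\<^sup>2) - 1) / 2) - \<i> * of_real pi / 2"
proof -
  have "x * x < sqrt 2 * sqrt 2" using assms by (intro mult_strict_mono) auto
  then have x2: "x\<^sup>2 < 2" by (simp add: power2_eq_square)
  define k where "k = 2 / (2 - x\<^sup>2) - 1"
  have k: "k = x\<^sup>2 / (2 - x\<^sup>2)" using x2 by (simp add: k_def field_simps)
  have k0: "k > 0" unfolding k using assms x2 by simp
  have "\<i> * Z_quad (of_real x) = of_real k * (- \<i>)"
  proof -
    have "(of_real x)\<^sup>2 - 2 = (of_real (x\<^sup>2 - 2) :: complex)" by simp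
    moreover have "x\<^sup>2 / (x\<^sup>2 - 2) = - k" unfolding k by (metis minus_diff_eq minus_divide_right)
    ultimately have "(of_real x)\<^sup>2 / ((of_real x)\<^sup>2 - 2) = (of_real (- k) :: complex)"
      by (metis of_real_divide of_real_power)
    then show ?thesis by (simp add: Z_quad_def)
  qed
  then have "W_quad (of_real x) = (Ln (of_real k * (- \<i>)) - \<i> * of_real (pi / 2)) / 2" by (simp only: W_quad_def)
  also have "Ln (of_real k * (- \<i>)) = of_real (ln k) + Ln (- \<i>)"
    by (simp only: Ln_times_of_real[OF k0, of "- \<i>"] Ln_of_real[OF k0] neg_equal_0_iff_equal complex_i_not_zero not_False_eq_True)
  finally show ?thesis unfolding k_def[symmetric] by (simp add: complex_eq_iff)
qed

lemma Wfun_eq_W_quad: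
  assumes "z \<in> quadrant_reg" shows "Wfun z = W_quad z"
proof (cases "z \<in> \<real> \<and> 0 < Re z \<and> Re z < sqrt 2")
  case True
  then obtain x where x: "z = of_real x" by (auto elim: Reals_cases)
  then show ?thesis using True W_quad_gap[of x] by (simp add: Wfun_def)
next
  case False
  then show ?thesis using W_quad_eq_Ln[OF assms] by (auto simp: Wfun_def complex_is_Real_iff)
qed

text \<open>The reciprocal of \<open>G_right\<close>. W is singular at 0 and sqrt 2; the two values
  there are the limits of \<open>z * r\<close>, equivalently the reciprocals of the values
  prescribed for G.\<close>

definition K_quad :: "complex \<Rightarrow> complex" where
  "K_quad z = (if z = 0 then \<i> * of_real (sqrt 2 * exp (- (sqrt 3 * pi / 9)))
     else if z = of_real (sqrt 2) then of_real (sqrt 2) * ((1 + of_real (sqrt 3) * \<i>) / 2)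
     else z * r_cov (sheet_inv (W_quad z)))"

lemma K_quad_quadrant_reg: "z \<in> quadrant_reg \<Longrightarrow> K_quad z = z * r_cov (sheet_inv (W_quad z))"
  by (auto simp: K_quad_def quadrant_reg_def)

lemma G_right_eq: 
  assumes "z \<in> quadrant" shows "G_right z = 1 / K_quad z"
proof (cases "z \<in> quadrant_reg")
  case True
  then have "z \<noteq> 0" "z \<noteq> of_real (sqrt 2)" by (auto simp: quadrant_reg_def)
  then show ?thesis using K_quad_quadrant_reg[OF True] Wfun_eq_W_quad[OF True] T_inv_eq[OF Im_W_quad(1)[OF True]]
    by (simp add: G_right_def)
next
  case False
  then consider "z = 0" | "z = of_real (sqrt 2)" using assms by (auto simp: quadrant_reg_def)
  then show ?thesis
  proof cases
    case 1
    define c2 E1 E2 where "c2 = complex_of_real (sqrt 2)"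
      and "E1 = complex_of_real (exp (- (sqrt 3 * pi / 9)))" and "E2 = complex_of_real (exp (sqrt 3 * pi / 9))"
    have c: "c2 * c2 = 2" by (simp add: c2_def flip: of_real_mult)
    have E: "E1 * E2 = 1" unfolding E1_def E2_def by (simp flip: of_real_mult exp_add)
    have "\<i> * (c2 * E1) * (- (c2 * \<i> / 2) * E2) = (c2 * c2) * (E1 * E2) / 2"
      by (simp add: algebra_simps)
    also have "\<dots> = 1" unfolding c E by simp
    finally have "- (c2 * \<i> / 2) * E2 = 1 / (\<i> * (c2 * E1))"
      by (metis mult_zero_left nonzero_mult_div_cancel_left zero_neq_one)
    then show ?thesis using 1 by (simp only: G_right_def K_quad_def c2_def E1_def E2_def of_real_mult refl if_True)
  next
    case 2
    have s6: "sqrt 6 = sqrt 2 * sqrt 3" by (simp flip: real_sqrt_mult)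
    define c2 c3 where "c2 = complex_of_real (sqrt 2)" and "c3 = complex_of_real (sqrt 3)"
    have c: "c2 * c2 = 2" "c3 * c3 = 3" by (simp_all add: c2_def c3_def flip: of_real_mult)
    have "c2 * ((1 + c3 * \<i>) / 2) * ((c2 - c2 * c3 * \<i>) / 4) = (c2 * c2) * (1 + c3 * c3) / 8"
      by (simp add: algebra_simps)
    also have "\<dots> = 1" unfolding c by simp
    finally have "of_real (sqrt 2) * ((1 + of_real (sqrt 3) * \<i>) / 2) * ((of_real (sqrt 2) - of_real (sqrt 6) * \<i>) / 4) = (1::complex)"
      by (simp add: s6 c2_def c3_def)
    then have "(of_real (sqrt 2) - of_real (sqrt 6) * \<i>) / 4 = 1 / (of_real (sqrt 2) * ((1 + of_real (sqrt 3) * \<i>) / 2))"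
      by (metis mult_zero_left nonzero_mult_div_cancel_left zero_neq_one)
    then show ?thesis using 2 by (simp add: G_right_def K_quad_def)
  qed
qed

lemma DERIV_r_cov:
  assumes "l \<in> T_dom"
  shows "(r_cov has_field_derivative \<i> * ((r_cov l)\<^sup>2 - r_cov l + 1) / of_real (sqrt 3)) (at l)"
proof -
  have ne: "exp l - 1 \<noteq> 0" using T_dom_exp_ne[OF assms] by simp
  have "(r_cov has_field_derivative - (\<i> * of_real (sqrt 3) * exp l) / (exp l - 1)\<^sup>2) (at l)"
    unfolding r_cov_def[abs_def] using ne by (auto intro!: derivative_eq_intros simp: power2_eq_square)
  also have "- (\<i> * of_real (sqrt 3) * exp l) / (exp l - 1)\<^sup>2 = \<i> * ((r_cov l)\<^sup>2 - r_cov l + 1) / of_real (sqrt 3)"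
  proof -
    define s where "s = complex_of_real (sqrt 3)"
    have s: "s * s = 3" "s \<noteq> 0" unfolding s_def by (simp_all flip: of_real_mult)
    define u where "u = 1 / (exp l - 1)"
    have r: "r_cov l = (1 + s * \<i>) / 2 + \<i> * s * u" by (simp add: r_cov_def s_def u_def)
    have "(r_cov l)\<^sup>2 - r_cov l + 1 = (1 - s * s) / 4 + 1 / 2 - (s * s) * u - (s * s) * u * u"
      unfolding r by (simp add: power2_eq_square field_simps)
    also have "\<dots> = - 3 * (u * (u + 1))" unfolding s by (simp add: field_simps)
    also have "u * (u + 1) = exp l / (exp l - 1)\<^sup>2" unfolding u_def using ne by (simp add: field_simps power2_eq_square)
    finally have q: "(r_cov l)\<^sup>2 - r_cov l + 1 = - (s * s) * (exp l / (exp l - 1)\<^sup>2)"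
      unfolding s by simp
    show ?thesis unfolding q s_def[symmetric] using s(2) ne by (simp add: field_simps)
  qed
  finally show ?thesis .
qed

lemma DERIV_W_quad:
  assumes "z \<in> W_dom" "z \<noteq> 0"
  shows "(W_quad has_field_derivative - 2 / (z * (z\<^sup>2 - 2))) (at z)"
proof -
  have n: "z\<^sup>2 - 2 \<noteq> 0" and d: "\<i> * (Z_quad z) \<notin> \<real>\<^sub>\<le>\<^sub>0" using assms by (auto simp: W_dom_def)
  define D where "D = (2 * z * (z\<^sup>2 - 2) - z\<^sup>2 * (2 * z)) / ((z\<^sup>2 - 2) * (z\<^sup>2 - 2))"
  have "(Z_quad has_field_derivative D) (at z)"
    unfolding D_def Z_quad_def[abs_def] using n by (auto intro!: derivative_eq_intros)
  then have "((\<lambda>z. \<i> * (Z_quad z)) has_field_derivative \<i> * D) (at z)"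
    by (rule DERIV_cmult)
  from DERIV_chain2[OF has_field_derivative_Ln[OF d] this]
  have "((\<lambda>z. Ln (\<i> * (Z_quad z))) has_field_derivative inverse (\<i> * (Z_quad z)) * (\<i> * D)) (at z)" .
  from DERIV_cdivide[OF DERIV_diff[OF this DERIV_const], of "\<i> * of_real (pi / 2)" 2]
  have "(W_quad has_field_derivative (inverse (\<i> * (Z_quad z)) * (\<i> * D) - 0) / 2) (at z)"
    by (simp only: W_quad_def[abs_def])
  also have "inverse (\<i> * (Z_quad z)) * (\<i> * D) = (z\<^sup>2 - 2) / z\<^sup>2 * D"
    using assms n by (simp add: Z_quad_def field_simps)
  also have "\<dots> = - 4 / (z * (z\<^sup>2 - 2))"
  proof -
    define m where "m = z\<^sup>2 - 2"
    have "D = - 4 * z / (m * m)" unfolding D_def m_def by (simp add: algebra_simps)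
    then show ?thesis using n assms(2) unfolding m_def[symmetric] by (simp add: power2_eq_square)
  qed
  finally show ?thesis by simp
qed

text \<open>Away from 0, sqrt 2 and the fold, \<open>sheet_inv\<close> extends holomorphically, and
  K with it, across the edges of the quadrant. The derivative combines
  \<open>dr/dW = - (r\<^sup>2 - r + 1) / r\<close> with
  \<open>dW/dz = - 2 / (z * (z\<^sup>2 - 2))\<close>; at the pole it yields the mass of the atom.
  The quantifier over r abbreviates K/z at the point.\<close>

lemma K_quad_local:
  assumes z0: "z0 \<in> quadrant_reg" and ne: "W_quad z0 \<noteq> of_real (sqrt 3 * pi / 9)"
  shows "\<exists>e>0. \<exists>f. f holomorphic_on ball z0 e \<and> (\<forall>z\<in>ball z0 e \<inter> quadrant. K_quad z = f z) \<and>
     (\<forall>r. r = f z0 / z0 \<longrightarrow> r \<noteq> 0 \<and> (f has_field_derivative r + 2 * (r\<^sup>2 - r + 1) / (r * (z0\<^sup>2 - 2))) (at z0))"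
proof -
  obtain e1 g where g: "e1 > 0" "g holomorphic_on ball (W_quad z0) e1" "g ` ball (W_quad z0) e1 \<subseteq> T_dom"
    "\<And>w. w \<in> ball (W_quad z0) e1 \<Longrightarrow> T_cov (g w) = w" "\<And>w. w \<in> ball (W_quad z0) e1 \<inter> W_strip \<Longrightarrow> sheet_inv w = g w"
    using sheet_inv_local[OF Im_W_quad(1)[OF z0] ne] by blast
  have "open (W_dom \<inter> W_quad -` ball (W_quad z0) e1)"
    by (intro continuous_open_preimage open_W_dom holomorphic_on_imp_continuous_on W_quad_holomorphic open_ball)
  then have "open ((W_dom \<inter> W_quad -` ball (W_quad z0) e1) - {0, of_real (sqrt 2)})" by (intro open_Diff) auto
  moreover have "z0 \<in> (W_dom \<inter> W_quad -` ball (W_quad z0) e1) - {0, of_real (sqrt 2)}"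
    using z0 quadrant_reg_W_dom[OF z0] g(1) by (auto simp: quadrant_reg_def)
  ultimately obtain e where e: "e > 0" "ball z0 e \<subseteq> (W_dom \<inter> W_quad -` ball (W_quad z0) e1) - {0, of_real (sqrt 2)}"
    using open_contains_ball by metis
  define f where "f = (\<lambda>z. z * r_cov (g (W_quad z)))"
  have WB: "W_quad ` ball z0 e \<subseteq> ball (W_quad z0) e1" using e by auto
  have h1: "(\<lambda>z. g (W_quad z)) holomorphic_on ball z0 e"
    using holomorphic_on_compose_gen[OF holomorphic_on_subset[OF W_quad_holomorphic] g(2) WB] e by (auto simp: o_def)
  have "(\<lambda>z. r_cov (g (W_quad z))) holomorphic_on ball z0 e"
    using holomorphic_on_compose_gen[OF h1 r_cov_holomorphic] g(3) WB by (auto simp: o_def image_subset_iff)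
  then have "f holomorphic_on ball z0 e" unfolding f_def by (intro holomorphic_intros)
  moreover have "\<forall>z\<in>ball z0 e \<inter> quadrant. K_quad z = f z"
  proof
    fix z assume z: "z \<in> ball z0 e \<inter> quadrant"
    then have "z \<notin> {0, of_real (sqrt 2)}" using e(2) by blast
    then have zq: "z \<in> quadrant_reg" using z by (auto simp: quadrant_reg_def)
    have "W_quad z \<in> ball (W_quad z0) e1" using z e by auto
    then have "sheet_inv (W_quad z) = g (W_quad z)" using g(5) Im_W_quad(1)[OF zq] by blast
    then show "K_quad z = f z" by (simp add: K_quad_quadrant_reg[OF zq] f_def)
  qed
  moreover have "r \<noteq> 0 \<and> (f has_field_derivative r + 2 * (r\<^sup>2 - r + 1) / (r * (z0\<^sup>2 - 2))) (at z0)"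
    if r: "r = f z0 / z0" for r
  proof -
    define l where "l = g (W_quad z0)"
    have c: "W_quad z0 \<in> ball (W_quad z0) e1" using g(1) by simp
    have lT: "l \<in> T_dom" using g(3) c by (auto simp: l_def)
    have zz: "z0 \<noteq> 0" "z0\<^sup>2 - 2 \<noteq> 0" using z0 zeta_facts(1)[OF z0] by (auto simp: quadrant_reg_def)
    have rl: "r = r_cov l" using zz by (simp add: r f_def l_def)
    obtain g' where g': "(g has_field_derivative g') (at (W_quad z0))"
      using g(2) c holomorphic_on_open open_ball by blast
    \<comment> \<open>Differentiating \<open>T_cov (g w) = w\<close> gives the derivative of g and,
      the product being 1, also r \<noteq> 0.\<close>
    have "((\<lambda>w. T_cov (g w)) has_field_derivative (- \<i> * r_cov l / of_real (sqrt 3)) * g') (at (W_quad z0))"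
      using DERIV_chain2[OF DERIV_T_cov[OF lT, unfolded l_def] g'] by (simp only: l_def)
    moreover have "((\<lambda>w. T_cov (g w)) has_field_derivative 1) (at (W_quad z0))"
      by (rule has_field_derivative_transform_within[OF DERIV_ident g(1)]) (auto simp: g(4) dist_commute)
    ultimately have p: "(- \<i> * r_cov l / of_real (sqrt 3)) * g' = 1" by (rule DERIV_unique)
    then have r0: "r \<noteq> 0" unfolding rl by auto
    have g'eq: "g' = \<i> * of_real (sqrt 3) / r"
    proof -
      have "g' = (\<i> * of_real (sqrt 3) / r) * ((- \<i> * r_cov l / of_real (sqrt 3)) * g')"
        using r0 unfolding rl by (simp add: field_simps)
      then show ?thesis unfolding p by simp
    qed
    have dW: "(W_quad has_field_derivative - 2 / (z0 * (z0\<^sup>2 - 2))) (at z0)"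
      by (rule DERIV_W_quad[OF quadrant_reg_W_dom[OF z0] zz(1)])
    have "((\<lambda>z. r_cov (g (W_quad z))) has_field_derivative
       (\<i> * (r\<^sup>2 - r + 1) / of_real (sqrt 3)) * (g' * (- 2 / (z0 * (z0\<^sup>2 - 2))))) (at z0)"
      using DERIV_chain2[OF DERIV_r_cov[OF lT, unfolded l_def] DERIV_chain2[OF g' dW]]
      by (simp only: rl l_def)
    also have "(\<i> * (r\<^sup>2 - r + 1) / of_real (sqrt 3)) * (g' * (- 2 / (z0 * (z0\<^sup>2 - 2)))) =
        2 * (r\<^sup>2 - r + 1) / (r * (z0 * (z0\<^sup>2 - 2)))"
    proof -
      have "(\<i> * q / s) * ((\<i> * s / r) * (- 2 / m)) = 2 * q / (r * m)" if "s \<noteq> 0" for q s m :: complex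
        using that by (cases "r = 0 \<or> m = 0") (auto simp: field_simps)
      from this[of "of_real (sqrt 3)"] show ?thesis unfolding g'eq by simp
    qed
    finally have "(f has_field_derivative 1 * r_cov (g (W_quad z0)) + 2 * (r\<^sup>2 - r + 1) / (r * (z0 * (z0\<^sup>2 - 2))) * z0) (at z0)"
      unfolding f_def by (rule DERIV_mult[OF DERIV_ident])
    also have "1 * r_cov (g (W_quad z0)) + 2 * (r\<^sup>2 - r + 1) / (r * (z0 * (z0\<^sup>2 - 2))) * z0 =
       r + 2 * (r\<^sup>2 - r + 1) / (r * (z0\<^sup>2 - 2))"
      unfolding rl l_def[symmetric] using zz by simp
    finally show ?thesis using r0 by blast
  qed
  ultimately show ?thesis using e(1) by blast
qed

lemma K_quad_differentiable:
  assumes "Re z > 0" "Im z > 0" shows "K_quad field_differentiable (at z)"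
proof -
  have zq: "z \<in> quadrant_reg" using assms by (auto simp: quadrant_reg_def quadrant_def)
  have "W_quad z \<noteq> of_real (sqrt 3 * pi / 9)" 
    using Im_W_quad(2)[OF zq assms(2,1)] by (metis Im_complex_of_real less_irrefl)
  then obtain e f where e: "e > 0" "f holomorphic_on ball z e" "\<And>w. w \<in> ball z e \<inter> quadrant \<Longrightarrow> K_quad w = f w"
    using K_quad_local[OF zq] by blast
  define S where "S = ball z e \<inter> {w. Re w > 0} \<inter> {w. Im w > 0}"
  have S: "open S" "z \<in> S" using e assms by (auto simp: S_def intro!: open_Int open_halfspace_Re_gt open_halfspace_Im_gt)
  have "f holomorphic_on S" using e(2) by (rule holomorphic_on_subset) (auto simp: S_def)
  then have "K_quad holomorphic_on S"
    by (rule holomorphic_transform) (use e(3) in \<open>auto simp: S_def quadrant_def\<close>)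
  then show ?thesis using S holomorphic_on_imp_differentiable_at by blast
qed

text \<open>Near sqrt 2 the modulus of Z, hence Re W, tends to infinity. By
  \<open>Re_sheet_inv_lower\<close> so does Re l, and then \<open>exp l - 1\<close> blows up, which
  leaves r at the root \<omega>.\<close>

lemma K_quad_tendsto_sqrt2: "(K_quad \<longlongrightarrow> K_quad (of_real (sqrt 2))) (at (of_real (sqrt 2)) within quadrant)"
proof -
  define F where "F = at (complex_of_real (sqrt 2)) within quadrant"
  have s2: "(complex_of_real (sqrt 2))\<^sup>2 = 2" by (simp flip: of_real_power)
  have evQ: "eventually (\<lambda>z. z \<in> quadrant_reg) F"
    unfolding F_def eventually_at
    by (intro exI[of _ "sqrt 2"]) (auto simp: quadrant_reg_def dist_norm)
  have id: "((\<lambda>z. z) \<longlongrightarrow> of_real (sqrt 2)) F" unfolding F_def by (rule tendsto_ident_at)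
  have "((\<lambda>z. cmod ((z\<^sup>2 - 2) / z\<^sup>2)) \<longlongrightarrow> cmod (((of_real (sqrt 2))\<^sup>2 - 2) / (of_real (sqrt 2))\<^sup>2)) F"
    by (intro tendsto_intros id) (simp add: s2)
  then have t0: "((\<lambda>z. cmod ((z\<^sup>2 - 2) / z\<^sup>2)) \<longlongrightarrow> 0) F" by (simp add: s2)
  moreover have "eventually (\<lambda>z. 0 < cmod ((z\<^sup>2 - 2) / z\<^sup>2)) F"
    using evQ by eventually_elim (use zeta_facts(1) in \<open>auto simp: quadrant_reg_def\<close>)
  ultimately have "filterlim (\<lambda>z. cmod ((z\<^sup>2 - 2) / z\<^sup>2)) (at_right 0) F"
    by (simp add: filterlim_at eventually_conj_iff)
  then have "filterlim (\<lambda>z. ln (cmod ((z\<^sup>2 - 2) / z\<^sup>2))) at_bot F"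
    by (rule filterlim_compose[OF ln_at_0])
  then have lt: "filterlim (\<lambda>z. - ln (cmod ((z\<^sup>2 - 2) / z\<^sup>2))) at_top F" by (simp add: filterlim_uminus_at_top)
  obtain C where C: "\<forall>w\<in>W_strip. Re w \<le> Re (sheet_inv w) + C" using Re_sheet_inv_lower by blast
  have "filterlim (\<lambda>z. Re (sheet_inv (W_quad z))) at_top F"
    unfolding filterlim_at_top
  proof
    fix Z
    have "eventually (\<lambda>z. 2 * (Z + C) \<le> - ln (cmod ((z\<^sup>2 - 2) / z\<^sup>2))) F"
      using lt by (simp add: filterlim_at_top)
    then show "eventually (\<lambda>z. Z \<le> Re (sheet_inv (W_quad z))) F"
      using evQ
    proof eventually_elim
      case (elim z)
      have "- ln (cmod ((z\<^sup>2 - 2) / z\<^sup>2)) = ln (cmod (Z_quad z))"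
        using zeta_facts(1)[OF elim(2)] elim(2) by (simp add: quadrant_reg_def Z_quad_def norm_divide ln_div)
      then have "Z + C \<le> Re (W_quad z)" using elim Re_W_quad[OF elim(2)] by simp
      then show ?case using C Im_W_quad(1)[OF elim(2)] by force
    qed
  qed
  then have ex: "filterlim (\<lambda>z. exp (Re (sheet_inv (W_quad z))) - 1) at_top F"
    by (intro filterlim_tendsto_add_at_top[of "\<lambda>_. -1" "-1", unfolded add.commute[of "-1"], simplified]
        filterlim_compose[OF exp_at_top]) auto
  have "((\<lambda>z. r_cov (sheet_inv (W_quad z)) - (1 + of_real (sqrt 3) * \<i>) / 2) \<longlongrightarrow> 0) F"
  proof (rule Lim_null_comparison)
    show "((\<lambda>z. sqrt 3 / (exp (Re (sheet_inv (W_quad z))) - 1)) \<longlongrightarrow> 0) F"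
      by (rule real_tendsto_divide_at_top[OF tendsto_const ex])
    have "eventually (\<lambda>z. 0 < exp (Re (sheet_inv (W_quad z))) - 1) F"
      using ex unfolding filterlim_at_top_dense by blast
    then show "eventually (\<lambda>z. norm (r_cov (sheet_inv (W_quad z)) - (1 + of_real (sqrt 3) * \<i>) / 2)
        \<le> sqrt 3 / (exp (Re (sheet_inv (W_quad z))) - 1)) F"
    proof eventually_elim
      case (elim z)
      have "exp (Re (sheet_inv (W_quad z))) - 1 \<le> cmod (exp (sheet_inv (W_quad z)) - 1)"
        using norm_triangle_ineq2[of "exp (sheet_inv (W_quad z))" 1] by simp
      then show ?case using elim by (simp add: r_cov_def norm_divide norm_mult frac_le)
    qed
  qed
  then have "((\<lambda>z. z * (r_cov (sheet_inv (W_quad z)) - (1 + of_real (sqrt 3) * \<i>) / 2 + (1 + of_real (sqrt 3) * \<i>) / 2)) \<longlongrightarrow>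
     of_real (sqrt 2) * (0 + (1 + of_real (sqrt 3) * \<i>) / 2)) F"
    by (intro tendsto_intros id)
  then have "((\<lambda>z. z * r_cov (sheet_inv (W_quad z))) \<longlongrightarrow> K_quad (of_real (sqrt 2))) F"
    by (simp add: K_quad_def)
  moreover have "eventually (\<lambda>z. z * r_cov (sheet_inv (W_quad z)) = K_quad z) F"
    using evQ by eventually_elim (simp add: K_quad_quadrant_reg)
  ultimately show ?thesis unfolding F_def by (rule Lim_transform_eventually)
qed

lemma exp_2Wq: 
  assumes "z \<in> quadrant_reg" shows "exp (2 * W_quad z) = Z_quad z"
proof -
  have "exp (\<i> * of_real (pi / 2)) = \<i>" using cis_conv_exp[of "pi / 2"] by simp
  moreover have "2 * W_quad z = Ln (\<i> * Z_quad z) - \<i> * of_real (pi / 2)" by (simp add: W_quad_def)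
  moreover have "\<i> * Z_quad z \<noteq> 0" using zeta_facts(2)[OF assms] by simp
  ultimately show ?thesis by (simp only: exp_diff exp_Ln) simp
qed

text \<open>For Im l between -pi and 3 pi / 2 this keeps \<open>exp (- l / 2)\<close> away from -1,
  so that, of the two square roots of a number near 1, it is the one near 1.\<close>

lemma cos_ge_neg34:
  assumes "- (pi / 2) \<le> y" "y \<le> 3 * pi / 4" shows "cos y \<ge> - (3 / 4)"
proof (cases "y \<le> pi / 2")
  case True
  then have "cos y \<ge> 0" using assms by (intro cos_ge_zero) auto
  then show ?thesis by linarith
next
  case False
  have "cos (3 * pi / 4) \<le> cos y"
    using False assms pi_gt_zero by (intro cos_monotone_0_pi_le) auto
  moreover have "cos (3 * pi / 4) = - (sqrt 2 / 2)"
  proof -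
    have "3 * pi / 4 = pi - pi / 4" by simp
    then show ?thesis by (simp only: cos_pi_minus cos_45)
  qed
  moreover have "sqrt 2 \<le> 3 / 2" by (rule real_le_lsqrt) (auto simp: power2_eq_square)
  ultimately show ?thesis by linarith
qed

text \<open>As z tends to 0, r becomes infinite and \<open>z * r\<close> is indeterminate. Since
  \<open>T_cov l = W\<close>, the product equals
  \<open>(z * exp (- W)) * (exp (T_cov l) * r)\<close>: the first factor is a square root of
  \<open>z\<^sup>2 - 2\<close>, and in the second the factor \<open>1 - exp (- l)\<close> of
  \<open>exp (T_cov l)\<close> cancels the pole of r.\<close>

lemma K_quad_tendsto_0: "(K_quad \<longlongrightarrow> K_quad 0) (at 0 within quadrant)"
proof -
  define F where "F = at (0 :: complex) within quadrant"
  have evQ: "eventually (\<lambda>z. z \<in> quadrant_reg) F"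
    unfolding F_def eventually_at
    by (intro exI[of _ 1]) (auto simp: quadrant_reg_def dist_norm)
  have id: "((\<lambda>z. z) \<longlongrightarrow> 0) F" unfolding F_def by (rule tendsto_ident_at)
  define l where "l = (\<lambda>z. sheet_inv (W_quad z))"
  have l: "l z \<in> sheet" "l z \<in> T_dom" "Re (l z) \<ge> 0" "T_cov (l z) = W_quad z" if "z \<in> quadrant_reg" for z
    using sheet_inv[OF Im_W_quad(1)[OF that]] sheet_T_dom by (auto simp: l_def sheet_def)
  have Im_low: "Im (l z) > - pi" if "z \<in> quadrant_reg" for z
  proof -
    have "Re (l z) / sqrt 3 \<ge> 0" using l[OF that] by simp
    then show ?thesis using Im_bounds(1)[OF l(2)[OF that]] Im_W_quad(1)[OF that]
      unfolding l(4)[OF that] W_strip_def by auto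
  qed
  have "((\<lambda>z. sqrt (cmod (Z_quad z)) * exp (pi / (2 * sqrt 3) + T_const)) \<longlongrightarrow>
      sqrt (cmod (0\<^sup>2 / (0\<^sup>2 - 2))) * exp (pi / (2 * sqrt 3) + T_const)) F"
    unfolding Z_quad_def by (intro tendsto_intros id) auto
  then have Z0: "((\<lambda>z. sqrt (cmod (Z_quad z)) * exp (pi / (2 * sqrt 3) + T_const)) \<longlongrightarrow> 0) F" by simp
  \<comment> \<open>Apart from the logarithm, all terms of \<open>Re (T_cov l)\<close> are bounded
    below, so \<open>exp (Re W) = sqrt (cmod Z)\<close> controls \<open>1 - exp (- l)\<close>, up to
    a constant.\<close>
  have e0: "((\<lambda>z. 1 - exp (- l z)) \<longlongrightarrow> 0) F"
  proof (rule Lim_null_comparison[OF _ Z0])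
    show "eventually (\<lambda>z. norm (1 - exp (- l z)) \<le> sqrt (cmod (Z_quad z)) * exp (pi / (2 * sqrt 3) + T_const)) F"
      using evQ
    proof eventually_elim
      case (elim z)
      have p: "cmod (1 - exp (- l z)) > 0" using T_dom_Re_pos[OF l(2)[OF elim]] by auto
      have "- pi / (2 * sqrt 3) \<le> Im (l z) / (2 * sqrt 3)"
        using Im_low[OF elim] by (intro divide_right_mono) auto
      then have "ln (cmod (1 - exp (- l z))) \<le> Re (W_quad z) + (pi / (2 * sqrt 3) + T_const)"
        using Re_T_cov[OF l(2)[OF elim]] l(3)[OF elim] unfolding l(4)[OF elim] by simp
      then have "exp (ln (cmod (1 - exp (- l z)))) \<le> exp (Re (W_quad z) + (pi / (2 * sqrt 3) + T_const))"
        by (simp only: exp_le_cancel_iff)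
      then have "cmod (1 - exp (- l z)) \<le> exp (Re (W_quad z) + (pi / (2 * sqrt 3) + T_const))"
        by (simp only: exp_ln[OF p])
      also have "\<dots> = exp (Re (W_quad z)) * exp (pi / (2 * sqrt 3) + T_const)" by (rule exp_add)
      also have "exp (Re (W_quad z)) = sqrt (cmod (Z_quad z))"
      proof -
        have "cmod (Z_quad z) = (exp (Re (W_quad z)))\<^sup>2"
          unfolding exp_2Wq[OF elim, symmetric] by (simp add: exp_double norm_power)
        then show ?thesis by simp
      qed
      finally show ?case .
    qed
  qed
  from tendsto_diff[OF tendsto_const[of 1] e0] have e1: "((\<lambda>z. exp (- l z)) \<longlongrightarrow> 1) F" by simp
  have "((\<lambda>z. - ln (cmod (exp (- l z)))) \<longlongrightarrow> - ln (cmod 1)) F"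
    by (intro tendsto_intros e1) auto
  then have R0: "((\<lambda>z. Re (l z)) \<longlongrightarrow> 0) F" by simp
  obtain d where d: "d > 0" "\<forall>l\<in>sheet. Re l < d \<and> Im (T_cov l) \<le> 0 \<longrightarrow> Im l < 3 * pi / 2"
    using Im_lt_small by blast
  \<comment> \<open>\<open>exp (- l)\<close> near 1 alone would allow l near 0 as well as l near
    \<open>2 * pi * \<i>\<close>; the height bound removes the second case.\<close>
  have evI: "eventually (\<lambda>z. z \<in> quadrant_reg \<and> Im (l z) < 3 * pi / 2) F"
    using evQ order_tendstoD(2)[OF R0 d(1)]
  proof eventually_elim
    case (elim z)
    have "Im (T_cov (l z)) \<le> 0" using Im_W_quad(1)[OF elim(1)] by (simp add: l(4)[OF elim(1)] W_strip_def)
    then show ?case using d(2) l(1)[OF elim(1)] elim by blast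
  qed
  \<comment> \<open>The real part of x + 1 will be at least 1/4, so \<open>cmod (x - 1)\<close> is
    at most 4 times \<open>cmod (x\<^sup>2 - 1)\<close>; afterwards l is recovered as
    \<open>- 2 * Ln x\<close>.\<close>
  define x where "x = (\<lambda>z. exp (- (l z / 2)))"
  have x2: "x z * x z = exp (- l z)" for z unfolding x_def by (simp flip: exp_add)
  have "((\<lambda>z. x z - 1) \<longlongrightarrow> 0) F"
  proof (rule Lim_null_comparison)
    show "((\<lambda>z. 4 * cmod (1 - exp (- l z))) \<longlongrightarrow> 0) F"
      using tendsto_mult[OF tendsto_const[of 4] tendsto_norm[OF e0]] by simp
    show "eventually (\<lambda>z. norm (x z - 1) \<le> 4 * cmod (1 - exp (- l z))) F"
      using evI
    proof eventually_elim
      case (elim z)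
      have "Re (x z) = exp (- (Re (l z) / 2)) * cos (Im (l z) / 2)" by (simp add: x_def Re_exp)
      moreover have c: "cos (Im (l z) / 2) \<ge> - (3 / 4)"
        using elim Im_low[of z] by (intro cos_ge_neg34) auto
      moreover have "exp (- (Re (l z) / 2)) \<le> 1" using l(3)[of z] elim by simp
      ultimately have "Re (x z) \<ge> - (3 / 4)"
      proof -
        assume e: "Re (x z) = exp (- (Re (l z) / 2)) * cos (Im (l z) / 2)" "exp (- (Re (l z) / 2)) \<le> 1"
        have "exp (- (Re (l z) / 2)) * (- (3 / 4)) \<le> exp (- (Re (l z) / 2)) * cos (Im (l z) / 2)"
          using c by (intro mult_left_mono) auto
        then show ?thesis using e by linarith
      qed
      then have "1 / 4 \<le> Re (x z + 1)" by simp
      also have "\<dots> \<le> cmod (x z + 1)" by (rule complex_Re_le_cmod)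
      finally have "cmod (x z - 1) * (1 / 4) \<le> cmod (x z - 1) * cmod (x z + 1)" by (intro mult_left_mono) auto
      also have "\<dots> = cmod (x z * x z - 1)" by (simp add: algebra_simps flip: norm_mult)
      finally show ?case unfolding x2 by (simp add: norm_minus_commute)
    qed
  qed
  from tendsto_add[OF this tendsto_const[of 1]] have x1: "(x \<longlongrightarrow> 1) F" by simp
  have "((\<lambda>z. - 2 * Ln (x z)) \<longlongrightarrow> - 2 * Ln 1) F" by (intro tendsto_intros tendsto_Ln x1) auto
  moreover have "eventually (\<lambda>z. - 2 * Ln (x z) = l z) F"
    using evI
  proof eventually_elim
    case (elim z)
    then have "Ln (x z) = - (l z / 2)"
      unfolding x_def using Im_low[of z] by (intro Ln_exp) auto
    then show ?case by simp
  qed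
  ultimately have l0: "(l \<longlongrightarrow> 0) F"
    using Lim_transform_eventually by fastforce
  define c where "c = exp (- (\<i> * of_real (pi / 2) + of_real T_const))"
  have c: "\<i> * of_real (sqrt 3) * c = of_real (exp (- (sqrt 3 * pi / 9)))"
  proof -
    have "c = exp (- (\<i> * of_real (pi / 2))) * of_real (exp (- T_const))"
      unfolding c_def minus_add_distrib exp_add by (simp add: exp_of_real[symmetric])
    moreover have "exp (- (\<i> * of_real (pi / 2))) = - \<i>" using cis_conv_exp[of "- (pi / 2)"] by simp
    moreover have "exp (- T_const) = exp (- (sqrt 3 * pi / 9)) / sqrt 3"
    proof -
      have "exp (- T_const) = exp (- (sqrt 3 * pi / 9)) * exp (- (ln 3 / 2))"
        by (simp add: T_const_def flip: exp_add)
      also have "exp (- (ln 3 / 2)) = 1 / sqrt (3::real)"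
      proof -
        have l: "ln (sqrt 3) = ln 3 / (2::real)" by (simp add: ln_sqrt)
        have e: "exp (ln (sqrt 3)) = sqrt (3::real)" by (rule exp_ln) simp
        show ?thesis unfolding l[symmetric] exp_minus e by (rule inverse_eq_divide)
      qed
      finally show ?thesis by simp
    qed
    ultimately show ?thesis by simp
  qed
  \<comment> \<open>\<open>s * s = z\<^sup>2 - 2\<close> tends to -2. The sign of the root is
    decided by Im s \<ge> 0, which holds because z and \<open>exp (- W)\<close> both lie in the
    closed first quadrant.\<close>
  define s where "s = (\<lambda>z. z * exp (- W_quad z))"
  have "((\<lambda>z. s z - \<i> * of_real (sqrt 2)) \<longlongrightarrow> 0) F"
  proof (rule Lim_null_comparison)
    have "((\<lambda>z. cmod (z\<^sup>2)) \<longlongrightarrow> cmod (0\<^sup>2)) F" by (intro tendsto_intros id)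
    then show "((\<lambda>z. cmod (z\<^sup>2)) \<longlongrightarrow> 0) F" by simp
    show "eventually (\<lambda>z. norm (s z - \<i> * of_real (sqrt 2)) \<le> cmod (z\<^sup>2)) F"
      using evQ
    proof eventually_elim
      case (elim z)
      note f = zeta_facts[OF elim]
      have "s z * s z = z\<^sup>2 / exp (2 * W_quad z)"
      proof -
        have "exp (- W_quad z) * exp (- W_quad z) = 1 / exp (2 * W_quad z)"
          by (simp only: exp_add[symmetric] inverse_eq_divide[symmetric] exp_minus[symmetric]) simp
        moreover have "s z * s z = z\<^sup>2 * (exp (- W_quad z) * exp (- W_quad z))"
          by (simp add: s_def power2_eq_square)
        ultimately show ?thesis by simp
      qed
      also have "\<dots> = z\<^sup>2 - 2" unfolding exp_2Wq[OF elim] Z_quad_def using f(1) elim by (auto simp: quadrant_reg_def)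
      finally have ss: "s z * s z = z\<^sup>2 - 2" .
      have "- (pi / 2) \<le> Im (W_quad z)" "Im (W_quad z) \<le> 0" using Im_W_quad(1)[OF elim] by (auto simp: W_strip_def)
      then have "0 \<le> cos (Im (W_quad z))" "0 \<le> sin (- Im (W_quad z))"
        using pi_gt_zero by (intro cos_ge_zero sin_ge_zero; linarith)+
      then have "0 \<le> Re (exp (- W_quad z))" "0 \<le> Im (exp (- W_quad z))"
        by (auto simp: Re_exp Im_exp mult_nonneg_nonpos)
      moreover have "0 \<le> Re z" "0 \<le> Im z" using elim by (auto simp: quadrant_reg_def quadrant_def)
      ultimately have "Im (s z) \<ge> 0" by (simp add: s_def)
      then have "1 \<le> Im (s z + \<i> * of_real (sqrt 2))" by (simp add: add_increasing)
      also have "\<dots> \<le> cmod (s z + \<i> * of_real (sqrt 2))" using abs_Im_le_cmod[of "s z + \<i> * of_real (sqrt 2)"] by linarith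
      finally have "cmod (s z - \<i> * of_real (sqrt 2)) * 1 \<le> cmod (s z - \<i> * of_real (sqrt 2)) * cmod (s z + \<i> * of_real (sqrt 2))"
        by (intro mult_left_mono) auto
      also have "\<dots> = cmod ((s z - \<i> * of_real (sqrt 2)) * (s z + \<i> * of_real (sqrt 2)))"
        by (simp only: norm_mult)
      also have "(s z - \<i> * of_real (sqrt 2)) * (s z + \<i> * of_real (sqrt 2)) = z\<^sup>2"
      proof -
        have "(a - \<i> * c) * (a + \<i> * c) = a * a + c * c" for a c :: complex
          by (simp add: algebra_simps)
        moreover have "complex_of_real (sqrt 2) * of_real (sqrt 2) = 2" by (simp flip: of_real_mult)
        ultimately show ?thesis using ss by simp
      qed
      finally show ?case by simp
    qed
  qed
  from tendsto_add[OF this tendsto_const[of "\<i> * of_real (sqrt 2)"]]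
  have s0: "(s \<longlongrightarrow> \<i> * of_real (sqrt 2)) F" by simp
  have "((\<lambda>z. s z * (exp (l z / 2) * ((1 - exp (- l z)) * ((1 + of_real (sqrt 3) * \<i>) / 2) + \<i> * of_real (sqrt 3) * exp (- l z))
     * exp (- (\<i> * l z / of_real (2 * sqrt 3))) * c)) \<longlongrightarrow>
     \<i> * of_real (sqrt 2) * (exp (0 / 2) * (0 * ((1 + of_real (sqrt 3) * \<i>) / 2) + \<i> * of_real (sqrt 3) * 1)
     * exp (- (\<i> * 0 / of_real (2 * sqrt 3))) * c)) F"
    by (intro tendsto_intros s0 l0 e0 e1) auto
  also have "\<i> * of_real (sqrt 2) * (exp (0 / 2) * (0 * ((1 + of_real (sqrt 3) * \<i>) / 2) + \<i> * of_real (sqrt 3) * 1)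
     * exp (- (\<i> * 0 / of_real (2 * sqrt 3))) * c) = \<i> * of_real (sqrt 2) * (\<i> * of_real (sqrt 3) * c)"
    by simp
  also have "\<dots> = K_quad 0" unfolding c by (simp add: K_quad_def)
  finally have "((\<lambda>z. s z * (exp (l z / 2) * ((1 - exp (- l z)) * ((1 + of_real (sqrt 3) * \<i>) / 2) + \<i> * of_real (sqrt 3) * exp (- l z))
     * exp (- (\<i> * l z / of_real (2 * sqrt 3))) * c)) \<longlongrightarrow> K_quad 0) F" .
  moreover have "eventually (\<lambda>z. s z * (exp (l z / 2) * ((1 - exp (- l z)) * ((1 + of_real (sqrt 3) * \<i>) / 2) + \<i> * of_real (sqrt 3) * exp (- l z))
     * exp (- (\<i> * l z / of_real (2 * sqrt 3))) * c) = K_quad z) F"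
    using evQ
  proof eventually_elim
    case (elim z)
    have ne: "exp (l z) - 1 \<noteq> 0" using T_dom_exp_ne[OF l(2)[OF elim]] by simp
    have "(1 - exp (- l z)) / (exp (l z) - 1) = exp (- l z)" using ne by (simp add: exp_minus field_simps)
    then have r: "(1 - exp (- l z)) * ((1 + of_real (sqrt 3) * \<i>) / 2) + \<i> * of_real (sqrt 3) * exp (- l z) = (1 - exp (- l z)) * r_cov (l z)"
    proof -
      assume e: "(1 - exp (- l z)) / (exp (l z) - 1) = exp (- l z)"
      have "(1 - exp (- l z)) * r_cov (l z) = (1 - exp (- l z)) * ((1 + of_real (sqrt 3) * \<i>) / 2)
          + \<i> * of_real (sqrt 3) * ((1 - exp (- l z)) / (exp (l z) - 1))"
      proof -
        have "a * (b + c / d) = a * b + c * (a / d)" for a b c d :: complex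
          by (simp add: distrib_left)
        then show ?thesis unfolding r_cov_def .
      qed
      then show ?thesis unfolding e by simp
    qed
    have "exp (l z / 2) * ((1 - exp (- l z)) * r_cov (l z)) * exp (- (\<i> * l z / of_real (2 * sqrt 3))) * c
       = exp (T_cov (l z)) * r_cov (l z)"
      unfolding exp_T_cov[OF l(2)[OF elim]] c_def by (simp only: mult_ac)
    then have "s z * (exp (l z / 2) * ((1 - exp (- l z)) * r_cov (l z)) * exp (- (\<i> * l z / of_real (2 * sqrt 3))) * c)
       = z * (exp (- W_quad z) * exp (W_quad z)) * r_cov (l z)"
      unfolding l(4)[OF elim] s_def by (simp only: mult_ac)
    also have "exp (- W_quad z) * exp (W_quad z) = 1" by (simp flip: exp_add)
    finally show ?case unfolding r by (simp add: K_quad_quadrant_reg[OF elim] l_def)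
  qed
  ultimately show ?thesis unfolding F_def by (rule Lim_transform_eventually)
qed

lemma K_quad_continuous: "continuous_on quadrant K_quad"
  unfolding continuous_on_def
proof
  fix z0 assume z0: "z0 \<in> quadrant"
  show "(K_quad \<longlongrightarrow> K_quad z0) (at z0 within quadrant)"
  proof (cases "z0 \<in> quadrant_reg")
    case True
    have 1: "continuous_on quadrant_reg (\<lambda>z. sheet_inv (W_quad z))"
      by (rule continuous_on_compose2[OF sheet_inv_continuous
            continuous_on_subset[OF holomorphic_on_imp_continuous_on[OF W_quad_holomorphic]]])
         (auto intro: quadrant_reg_W_dom Im_W_quad)
    have "continuous_on quadrant_reg (\<lambda>z. z * r_cov (sheet_inv (W_quad z)))"
      by (intro continuous_intros continuous_on_compose2[OF r_cov_continuous 1])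
         (auto intro: sheet_T_dom sheet_inv Im_W_quad)
    then have "continuous_on quadrant_reg K_quad" by (rule continuous_on_cong[THEN iffD1, rotated 2]) (auto simp: K_quad_quadrant_reg)
    then have "(K_quad \<longlongrightarrow> K_quad z0) (at z0 within quadrant_reg)" using True by (simp add: continuous_on_def)
    moreover have "at z0 within quadrant_reg = at z0 within quadrant"
      by (rule at_within_nhd[of _ "- {0, of_real (sqrt 2)}"]) (use True in \<open>auto simp: quadrant_reg_def\<close>)
    ultimately show ?thesis by simp
  next
    case False
    then have "z0 = 0 \<or> z0 = of_real (sqrt 2)" using z0 by (auto simp: quadrant_reg_def)
    then show ?thesis using K_quad_tendsto_0 K_quad_tendsto_sqrt2 by auto
  qed
qed

lemma W_quad_real:
  assumes z: "z \<in> quadrant_reg" and t: "Z_quad z = of_real t" "t > 0" and n: "\<not> (Im z = 0 \<and> 0 < Re z \<and> Re z < sqrt 2)"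
  shows "W_quad z = of_real (ln t / 2)"
proof -
  have e: "1 + 2 / (z\<^sup>2 - 2) = of_real t" using zeta_facts(3)[OF z] t(1) by simp
  show ?thesis using W_quad_eq_Ln[OF z n] unfolding e Ln_of_real[OF t(2)] by simp
qed

text \<open>On the imaginary axis Z lies in (0, 1), so W is real and below the fold value and r is
  real. This makes K and its mirror image agree along the axis.\<close>

lemma K_quad_imag:
  assumes "z \<in> quadrant" "Re z = 0" shows "Re (K_quad z) = 0"
proof (cases "z = 0")
  case False
  define y where "y = Im z"
  have zy: "z = \<i> * of_real y" using assms by (simp add: complex_eq_iff y_def)
  have "y \<ge> 0" using assms by (simp add: quadrant_def y_def)
  moreover have "y \<noteq> 0" using False assms(2) by (auto simp: y_def complex_eq_iff)
  ultimately have y: "y > 0" by simp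
  have zq: "z \<in> quadrant_reg" using assms False by (auto simp: quadrant_reg_def)
  have "Z_quad z = - of_real (y\<^sup>2) / - of_real (y\<^sup>2 + 2)"
    unfolding Z_quad_def zy by (simp add: power_mult_distrib)
  then have Z: "Z_quad z = of_real (y\<^sup>2 / (y\<^sup>2 + 2))" by (simp only: minus_divide_divide of_real_divide)
  have t: "y\<^sup>2 / (y\<^sup>2 + 2) > 0" using y by (intro divide_pos_pos add_pos_pos) auto
  have W: "W_quad z = of_real (ln (y\<^sup>2 / (y\<^sup>2 + 2)) / 2)" by (rule W_quad_real[OF zq Z t]) (use assms in auto)
  have "y\<^sup>2 / (y\<^sup>2 + 2) \<le> 1" using y by (simp add: divide_le_eq add_pos_pos)
  then have "ln (y\<^sup>2 / (y\<^sup>2 + 2)) \<le> 0" using t by simp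
  then have "ln (y\<^sup>2 / (y\<^sup>2 + 2)) / 2 \<le> 0" by simp
  also have "0 \<le> sqrt 3 * pi / 9" by simp
  finally obtain t where t: "0 < t" "t \<le> 4 * pi / 3" "sheet_inv (W_quad z) = \<i> * of_real t"
    using sheet_inv_axis[of "W_quad z"] W by auto
  have "t < 2 * pi" using t pi_gt_zero by linarith
  then show ?thesis using K_quad_quadrant_reg[OF zq] t r_cov_axis[of t] assms(2) by simp
qed (simp add: K_quad_def)

section \<open>Boundary values on the real line and behaviour at infinity\<close>

lemma exp_gamma0: "exp (2 * sqrt 3 * pi / 9) > (1::real)"
  by simp

lemma gamma0_pos: "gamma0 > 0"
  unfolding gamma0_def using exp_gamma0 by (intro divide_pos_pos) auto

text \<open>The origin of \<open>gamma0\<close>: with \<open>x\<^sup>2 = 2 + \<gamma>\<close> the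
  equation W(x) = \<open>sqrt 3 * pi / 9\<close> reads
  \<open>1 + 2 / \<gamma> = exp (2 * sqrt 3 * pi / 9)\<close>, and W decreases beyond sqrt
  2.\<close>

lemma outer_iff:
  assumes "x > sqrt 2"
  shows "x\<^sup>2 > 2" "x\<^sup>2 / (x\<^sup>2 - 2) > 1" "ln (x\<^sup>2 / (x\<^sup>2 - 2)) / 2 \<le> sqrt 3 * pi / 9 \<longleftrightarrow> sqrt (2 + gamma0) \<le> x"
    "ln (x\<^sup>2 / (x\<^sup>2 - 2)) / 2 < sqrt 3 * pi / 9 \<longleftrightarrow> sqrt (2 + gamma0) < x"
proof -
  have x0: "x > 0" using less_trans[OF _ assms, of 0] by simp
  then have "sqrt 2 * sqrt 2 < x * x" using assms by (intro mult_strict_mono) auto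
  then show x2: "x\<^sup>2 > 2" by (simp add: power2_eq_square)
  then show r: "x\<^sup>2 / (x\<^sup>2 - 2) > 1" by simp
  define E where "E = exp (2 * sqrt 3 * pi / 9)"
  have E: "E > 1" using exp_gamma0 by (simp add: E_def)
  have g: "gamma0 = 2 / (E - 1)" by (simp add: gamma0_def E_def)
  have q: "x\<^sup>2 / (x\<^sup>2 - 2) = 1 + 2 / (x\<^sup>2 - 2)" using x2 by (simp add: field_simps)
  have "ln (x\<^sup>2 / (x\<^sup>2 - 2)) / 2 \<le> sqrt 3 * pi / 9 \<longleftrightarrow> ln (x\<^sup>2 / (x\<^sup>2 - 2)) \<le> 2 * sqrt 3 * pi / 9" by (simp add: mult_ac)
  also have "\<dots> \<longleftrightarrow> x\<^sup>2 / (x\<^sup>2 - 2) \<le> E" unfolding E_def using r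
    ln_le_cancel_iff[of "x\<^sup>2 / (x\<^sup>2 - 2)" "exp (2 * sqrt 3 * pi / 9)"] by simp
  also have "\<dots> \<longleftrightarrow> 2 / (E - 1) \<le> x\<^sup>2 - 2" unfolding q using E x2 by (simp add: field_simps)
  also have "\<dots> \<longleftrightarrow> 2 + gamma0 \<le> x\<^sup>2" unfolding g by linarith
  also have "\<dots> \<longleftrightarrow> sqrt (2 + gamma0) \<le> x" using x0 real_sqrt_le_iff[of "2 + gamma0" "x\<^sup>2"] by simp
  finally show "ln (x\<^sup>2 / (x\<^sup>2 - 2)) / 2 \<le> sqrt 3 * pi / 9 \<longleftrightarrow> sqrt (2 + gamma0) \<le> x" .
  have "ln (x\<^sup>2 / (x\<^sup>2 - 2)) / 2 < sqrt 3 * pi / 9 \<longleftrightarrow> ln (x\<^sup>2 / (x\<^sup>2 - 2)) < 2 * sqrt 3 * pi / 9" by (simp add: mult_ac)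
  also have "\<dots> \<longleftrightarrow> x\<^sup>2 / (x\<^sup>2 - 2) < E" unfolding E_def using r
    ln_less_cancel_iff[of "x\<^sup>2 / (x\<^sup>2 - 2)" "exp (2 * sqrt 3 * pi / 9)"] by simp
  also have "\<dots> \<longleftrightarrow> 2 / (E - 1) < x\<^sup>2 - 2" unfolding q using E x2 by (simp add: field_simps)
  also have "\<dots> \<longleftrightarrow> 2 + gamma0 < x\<^sup>2" unfolding g by linarith
  also have "\<dots> \<longleftrightarrow> sqrt (2 + gamma0) < x" using x0 real_sqrt_less_iff[of "2 + gamma0" "x\<^sup>2"] by simp
  finally show "ln (x\<^sup>2 / (x\<^sup>2 - 2)) / 2 < sqrt 3 * pi / 9 \<longleftrightarrow> sqrt (2 + gamma0) < x" .
qed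

lemma W_quad_outer:
  assumes "x > sqrt 2"
  shows "of_real x \<in> quadrant_reg" "W_quad (of_real x) = of_real (ln (x\<^sup>2 / (x\<^sup>2 - 2)) / 2)"
proof -
  have x0: "x > 0" using less_trans[OF _ assms, of 0] by simp
  then show q: "of_real x \<in> quadrant_reg" using assms x0 by (auto simp: quadrant_reg_def quadrant_def)
  have "Z_quad (of_real x) = of_real (x\<^sup>2 / (x\<^sup>2 - 2))" by (simp add: Z_quad_def)
  moreover have "x\<^sup>2 / (x\<^sup>2 - 2) > 0" using outer_iff(2)[OF assms] by linarith
  ultimately show "W_quad (of_real x) = of_real (ln (x\<^sup>2 / (x\<^sup>2 - 2)) / 2)"
    by (intro W_quad_real[OF q]) (use assms in auto)
qed

lemma K_quad_outer:
  assumes "x \<ge> sqrt (2 + gamma0)"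
  shows "K_quad (of_real x) = of_real (x * T0_inv (ln (x\<^sup>2 / (x\<^sup>2 - 2)) / 2))"
    "T0_inv (ln (x\<^sup>2 / (x\<^sup>2 - 2)) / 2) \<ge> 0"
    "x > sqrt (2 + gamma0) \<Longrightarrow> T0_inv (ln (x\<^sup>2 / (x\<^sup>2 - 2)) / 2) > 0"
    "x = sqrt (2 + gamma0) \<Longrightarrow> K_quad (of_real x) = 0"
proof -
  have x: "x > sqrt 2" using assms gamma0_pos by (metis less_add_same_cancel1 less_le_trans real_sqrt_less_iff)
  define w where "w = ln (x\<^sup>2 / (x\<^sup>2 - 2)) / 2"
  have w: "w \<le> sqrt 3 * pi / 9" using outer_iff(3)[OF x] assms by (simp add: w_def)
  obtain t where t: "0 < t" "t \<le> 4 * pi / 3" "sheet_inv (of_real w) = \<i> * of_real t" "T_axis t = w"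
    using sheet_inv_axis[of "of_real w"] w by auto
  have t2: "t < 2 * pi" using t pi_gt_zero by linarith
  have "r_axis t \<ge> 0" by (rule r_axis_nonneg[OF t(1,2)])
  then have r: "T0_inv w = r_axis t" using T0_inv_T0 T0_r_axis[OF t(1) t2] t(4) by metis
  have K: "K_quad (of_real x) = of_real (x * r_axis t)"
    using K_quad_quadrant_reg[OF W_quad_outer(1)[OF x]] r_cov_axis[OF t(1) t2] t(3)
    unfolding W_quad_outer(2)[OF x] w_def[symmetric] by simp
  show "K_quad (of_real x) = of_real (x * T0_inv (ln (x\<^sup>2 / (x\<^sup>2 - 2)) / 2))"
    unfolding K w_def[symmetric] r ..
  show "T0_inv (ln (x\<^sup>2 / (x\<^sup>2 - 2)) / 2) \<ge> 0" unfolding w_def[symmetric] r by fact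
  show "T0_inv (ln (x\<^sup>2 / (x\<^sup>2 - 2)) / 2) > 0" if "x > sqrt (2 + gamma0)"
  proof -
    have "w < sqrt 3 * pi / 9" using outer_iff(4)[OF x] that by (simp add: w_def)
    then have "t \<noteq> 4 * pi / 3" using t(4) T_axis_crit by (metis less_irrefl)
    then show ?thesis unfolding w_def[symmetric] r using r_axis_pos[OF t(1)] t(2) by simp
  qed
  show "K_quad (of_real x) = 0" if "x = sqrt (2 + gamma0)"
  proof -
    have "w = sqrt 3 * pi / 9" using outer_iff(3,4)[OF x] that by (simp add: w_def)
    then have "t = 4 * pi / 3" using T_axis_max_eq[OF t(1) t2] t(4) by simp
    then have "r_axis t = 0" by (simp only: r_axis_zero)
    then show ?thesis unfolding K by simp
  qed
qed

text \<open>Inside the edge W is never a real number below or at the fold value: on (0, sqrt 2) its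
  imaginary part is -pi/2, and between sqrt 2 and the edge it is real but too large. Hence l is
  interior to the half-plane and Im r > 0.\<close>

lemma Im_K_quad_inner:
  assumes "0 \<le> x" "x < sqrt (2 + gamma0)" shows "Im (K_quad (of_real x)) > 0"
proof -
  consider "x = 0" | "x = sqrt 2" | "0 < x" "x < sqrt 2" | "x > sqrt 2" using assms by linarith
  then show ?thesis
  proof cases
    case 1 then show ?thesis by (simp add: K_quad_def)
  next
    case 2 then show ?thesis by (simp add: K_quad_def)
  next
    case 3
    then have q: "of_real x \<in> quadrant_reg" by (auto simp: quadrant_reg_def quadrant_def)
    have "Im (W_quad (of_real x)) \<noteq> 0" unfolding W_quad_gap[OF 3] by simp
    then have "Re (sheet_inv (W_quad (of_real x))) > 0"
      by (intro sheet_inv_not_axis Im_W_quad(1)[OF q]) (auto simp: complex_is_Real_iff)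
    from Im_r_cov_pos[OF this] show ?thesis using 3 by (simp add: K_quad_quadrant_reg[OF q])
  next
    case 4
    have q: "of_real x \<in> quadrant_reg" by (rule W_quad_outer[OF 4])
    have "\<not> Re (W_quad (of_real x)) \<le> sqrt 3 * pi / 9"
      using outer_iff(3)[OF 4] assms unfolding W_quad_outer(2)[OF 4] by simp
    then have "Re (sheet_inv (W_quad (of_real x))) > 0"
      by (intro sheet_inv_not_axis Im_W_quad(1)[OF q]) auto
    moreover have "x > 0" by (rule less_trans[OF _ 4]) simp
    ultimately show ?thesis using Im_r_cov_pos by (simp add: K_quad_quadrant_reg[OF q])
  qed
qed

text \<open>W is of order \<open>1 / z\<^sup>2\<close>, and r is a holomorphic function h of W near
  0 with value 1 there, because \<open>T0 1 = 0\<close>. So \<open>z * r - z\<close> is z times a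
  term of order W.\<close>

lemma K_quad_asymp: "\<exists>C R. \<forall>z\<in>quadrant. cmod z \<ge> R \<longrightarrow> cmod (K_quad z - z) \<le> C / cmod z"
proof -
  have c0: "0 \<in> W_strip" by (simp add: W_strip_def)
  have "(0::complex) \<noteq> of_real (sqrt 3 * pi / 9)" by simp
  from sheet_inv_local[OF c0 this] obtain e f where f: "e > 0" "f holomorphic_on ball 0 e" "f ` ball 0 e \<subseteq> T_dom"
    "\<And>w. w \<in> ball 0 e \<inter> W_strip \<Longrightarrow> sheet_inv w = f w" by blast
  define h where "h = (\<lambda>w. r_cov (f w))"
  have "h holomorphic_on ball 0 e"
    unfolding h_def using holomorphic_on_compose_gen[OF f(2) r_cov_holomorphic f(3)] by (simp add: o_def)
  then obtain D where D: "(h has_field_derivative D) (at 0)"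
    using f(1) holomorphic_on_open[OF open_ball] by (metis centre_in_ball)
  have h0: "h 0 = 1"
  proof -
    have pp: "0 < 2 * pi / 3" "2 * pi / 3 < 2 * pi" "2 * pi / 3 \<le> 4 * pi / 3" using pi_gt_zero by linarith+
    have "sheet_inv (T_cov (\<i> * of_real (2 * pi / 3))) = \<i> * of_real (2 * pi / 3)"
      by (rule sheet_inv_T_cov) (use pp in \<open>simp add: sheet_def\<close>)
    then have "sheet_inv 0 = \<i> * of_real (2 * pi / 3)" unfolding T_cov_axis[OF pp(1,2)] T_axis_zero by simp
    then have "r_cov (sheet_inv 0) = 1" by (simp only: r_cov_axis[OF pp(1,2)] r_axis_one of_real_1)
    then show ?thesis using f(4)[of 0] f(1) c0 by (simp add: h_def)
  qed
  have "((\<lambda>w. cmod ((h w - 1) / w)) \<longlongrightarrow> cmod D) (at 0)"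
    using D unfolding DERIV_def h0 by (intro tendsto_norm) simp
  from order_tendstoD(2)[OF this, of "cmod D + 1"]
  have "eventually (\<lambda>w. cmod ((h w - 1) / w) < cmod D + 1) (at 0)" by simp
  then obtain d where d: "d > 0" "\<And>w. w \<noteq> 0 \<Longrightarrow> dist w 0 < d \<Longrightarrow> cmod ((h w - 1) / w) < cmod D + 1"
    unfolding eventually_at by blast
  have hb: "cmod (h w - 1) \<le> (cmod D + 1) * cmod w" if "cmod w < d" for w
  proof (cases "w = 0")
    case False
    then show ?thesis using d(2)[of w] that by (simp add: norm_divide field_simps)
  qed (simp add: h0)
  \<comment> \<open>Large enough for |W| \<le> 4 / |z|^2, and for this bound to fall below both e,
    where f is the inverse, and d, where the difference quotient of h is controlled.\<close>
  define R where "R = max 3 (max (4 / e) (4 / d) + 1)"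
  have main: "cmod (K_quad z - z) \<le> 4 * (cmod D + 1) / cmod z" if z: "z \<in> quadrant" "cmod z \<ge> R" for z
  proof -
    define m where "m = cmod z"
    have m: "m \<ge> 3" "m > 4 / e" "m > 4 / d" using z(2) by (auto simp: R_def m_def)
    have s2: "sqrt 2 < 3" by (rule real_less_lsqrt) auto
    have zq: "z \<in> quadrant_reg" using z(1) m(1) s2 by (auto simp: quadrant_reg_def m_def)
    have n: "\<not> (Im z = 0 \<and> 0 < Re z \<and> Re z < sqrt 2)"
    proof
      assume "Im z = 0 \<and> 0 < Re z \<and> Re z < sqrt 2"
      then have "m < 3" using s2 by (simp add: m_def cmod_def)
      then show False using m by simp
    qed
    define u where "u = 2 / (z\<^sup>2 - 2)"
    have mm: "m * m \<ge> 9" using mult_mono[of 3 m 3 m] m(1) by simp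
    have "m\<^sup>2 - 2 \<le> cmod (z\<^sup>2 - 2)" using norm_triangle_ineq2[of "z\<^sup>2" 2] by (simp add: m_def norm_power)
    then have "m * m / 2 \<le> cmod (z\<^sup>2 - 2)" using mm by (simp add: power2_eq_square)
    then have "2 / cmod (z\<^sup>2 - 2) \<le> 2 / (m * m / 2)" using mm by (intro divide_left_mono mult_pos_pos) auto
    then have u: "cmod u \<le> 4 / (m * m)" by (simp add: u_def norm_divide)
    have "4 / (m * m) < 1 / 2" using mm by (simp add: field_simps)
    with u have "cmod u < 1 / 2" by linarith
    from norm_Ln_le[OF this] have "cmod (W_quad z) \<le> cmod u"
      unfolding W_quad_eq_Ln[OF zq n] u_def[symmetric] by (simp add: norm_divide)
    with u have W: "cmod (W_quad z) \<le> 4 / (m * m)" by linarith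
    have "4 / (m * m) \<le> 4 / m"
      using m(1) by (simp add: field_simps)
    moreover have "4 / m < e" "4 / m < d" using m f(1) d(1) by (simp_all add: field_simps)
    ultimately have We: "cmod (W_quad z) < e" "cmod (W_quad z) < d" using W by linarith+
    have "K_quad z = z * h (W_quad z)"
      using K_quad_quadrant_reg[OF zq] f(4)[of "W_quad z"] We(1) Im_W_quad(1)[OF zq] by (simp add: h_def)
    then have "cmod (K_quad z - z) = m * cmod (h (W_quad z) - 1)"
      by (simp add: m_def right_diff_distrib flip: norm_mult)
    also have "\<dots> \<le> m * ((cmod D + 1) * (4 / (m * m)))"
    proof (intro mult_left_mono)
      show "cmod (h (W_quad z) - 1) \<le> (cmod D + 1) * (4 / (m * m))"
        using hb[OF We(2)] W by (meson add_nonneg_nonneg mult_left_mono norm_ge_zero order_trans zero_le_one)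
    qed (use m in auto)
    also have "\<dots> = 4 * (cmod D + 1) / m" using m(1) by (simp add: field_simps)
    finally show ?thesis by (simp add: m_def)
  qed
  then show ?thesis by blast
qed

section \<open>The resolvent of a weighted tree\<close>

lemma V_word_single: "V_word [i]"
  by (auto simp: V_word_def intro!: bexI[of _ 1])

text \<open>The children of a word in the tree: a larger letter can always be put in front, a
  smaller one only while the word is still increasing. Hence nodes come in two kinds, with two kinds
  of subtrees below them.\<close>

lemma V_word_Cons_Cons:
  "V_word (j # i # w) \<longleftrightarrow> V_word (i # w) \<and> (i < j \<or> j < i \<and> sorted_wrt (<) (i # w))"
proof
  assume V: "V_word (j # i # w)"
  then obtain m where m: "m \<in> {1..Suc (Suc (length w))}" "sorted_wrt (>) (take m (j # i # w))"
    "sorted_wrt (<) (drop (m - 1) (j # i # w))"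
    by (auto simp: V_word_def)
  show "V_word (i # w) \<and> (i < j \<or> j < i \<and> sorted_wrt (<) (i # w))"
  proof (cases "m = 1")
    case True
    then show ?thesis using m V_word_ConsD[OF V] by simp
  next
    case False
    then obtain k where "m = Suc (Suc k)" using m(1)
      by (metis atLeastAtMost_iff not0_implies_Suc not_one_le_zero One_nat_def)
    then show ?thesis using m V_word_ConsD[OF V] by simp
  qed
next
  assume *: "V_word (i # w) \<and> (i < j \<or> j < i \<and> sorted_wrt (<) (i # w))"
  show "V_word (j # i # w)"
  proof (cases "i < j")
    case True
    from * obtain m where m: "m \<in> {1..Suc (length w)}" "sorted_wrt (>) (take m (i # w))"
      "sorted_wrt (<) (drop (m - 1) (i # w))"
      by (auto simp: V_word_def)
    then obtain k where k: "m = Suc k" by (cases m) auto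
    have "sorted_wrt (>) (take (Suc m) (j # i # w))" using m(2) True by (auto simp: k)
    moreover have "sorted_wrt (<) (drop (Suc m - 1) (j # i # w))" using m(3) by (simp add: k)
    ultimately show ?thesis using m(1) unfolding V_word_def
      by (intro disjI2 bexI[of _ "Suc m"]) auto
  next
    case False
    with * have "j < i" "sorted_wrt (<) (i # w)" by auto
    then show ?thesis unfolding V_word_def
      by (intro disjI2 bexI[of _ 1]) auto
  qed
qed

lemma creation_sum:
  "(\<Sum>i=1..N. creation i f w) = (if V_word w \<and> w \<noteq> [] \<and> hd w \<in> {1..N} then f (tl w) else 0)"
  unfolding creation_def by (cases "V_word w \<and> w \<noteq> []") auto

lemma conservation_sum:
  "(\<Sum>i=1..N. conservation i f w) = (if w \<noteq> [] \<and> hd w \<in> {1..N} then f w else 0)"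
  unfolding conservation_def by (cases "w \<noteq> []") auto

lemma S_op_eq:
  "S_op lam N f w =
     ((if V_word w \<and> w \<noteq> [] \<and> hd w \<in> {1..N} then f (tl w) else 0)
        + (\<Sum>i=1..N. annihilation i f w)) / of_real (sqrt (real N))
     + of_real lam * (if w \<noteq> [] \<and> hd w \<in> {1..N} then f w else 0)"
  unfolding S_op_def creation_sum[symmetric] conservation_sum[symmetric]
  by (simp only: sum.distrib sum_divide_distrib[symmetric] sum_distrib_left[symmetric])

text \<open>Linearity in the shape in which it is applied: the resolvent equation is used as
  \<open>psi = (1 / z) * (vacuum + S psi)\<close>.\<close>

lemma S_op_linear:
  "S_op lam N (\<lambda>w. c * (f w + g w)) = (\<lambda>w. c * (S_op lam N f w + S_op lam N g w))"
proof
  fix w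
  have 1: "creation i (\<lambda>w. c * (f w + g w)) w = c * (creation i f w + creation i g w)"
    "annihilation i (\<lambda>w. c * (f w + g w)) w = c * (annihilation i f w + annihilation i g w)"
    "conservation i (\<lambda>w. c * (f w + g w)) w = c * (conservation i f w + conservation i g w)" for i
    by (auto simp: creation_def annihilation_def conservation_def)
  show "S_op lam N (\<lambda>w. c * (f w + g w)) w = c * (S_op lam N f w + S_op lam N g w)"
    unfolding S_op_def 1 sum.distrib[symmetric] sum_distrib_left
    by (rule sum.cong) (auto simp: algebra_simps add_divide_distrib)
qed

lemma S_op_pow_linear:
  "(S_op lam N ^^ n) (\<lambda>w. c * (f w + g w)) = (\<lambda>w. c * ((S_op lam N ^^ n) f w + (S_op lam N ^^ n) g w))"
  by (induction n) (auto simp: S_op_linear)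

text \<open>The weight \<open>N\<^sup>-\<^sup>|\<^sup>w\<^sup>|\<^sup>/\<^sup>2\<close> turns the tree into one on which \<open>S_op\<close> is bounded in
  supremum norm uniformly in \<open>N\<close>.\<close>

lemma S_op_bound:
  assumes N: "N \<ge> 1" and lam: "lam \<ge> 0" and f: "\<And>w. cmod (f w) \<le> B * (1 / sqrt (real N)) ^ length w"
  shows "cmod (S_op lam N f w) \<le> (2 + lam) * B * (1 / sqrt (real N)) ^ length w"
proof -
  define q where "q = 1 / sqrt (real N)"
  have q: "q > 0" "real N * q * q = 1" using N by (auto simp: q_def)
  have B: "B \<ge> 0" using f[of "[]"] norm_ge_zero[of "f []"] by (simp del: norm_ge_zero)
  have f': "cmod (f w) \<le> B * q ^ length w" for w using f by (simp add: q_def)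
  have 1: "cmod (if V_word w \<and> w \<noteq> [] \<and> hd w \<in> {1..N} then f (tl w) else 0) * q \<le> B * q ^ length w"
  proof (cases "V_word w \<and> w \<noteq> [] \<and> hd w \<in> {1..N}")
    case True
    then obtain h t where w: "w = h # t" by (cases w) auto
    show ?thesis using True f'[of t] q(1) by (simp add: w mult_ac)
  next
    case False
    then have "(if V_word w \<and> w \<noteq> [] \<and> hd w \<in> {1..N} then f (tl w) else 0) = 0" by auto
    then show ?thesis using q B by (simp only: norm_zero mult_zero_left) simp
  qed
  have 2: "cmod (\<Sum>i=1..N. annihilation i f w) * q \<le> B * q ^ length w"
  proof -
    have "cmod (\<Sum>i=1..N. annihilation i f w) \<le> (\<Sum>i=1..N. cmod (annihilation i f w))" by (rule norm_sum)
    also have "\<dots> \<le> (\<Sum>i=1..N. B * q ^ Suc (length w))"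
      using f'[of "_ # w"] B q by (intro sum_mono) (auto simp: annihilation_def)
    finally have "cmod (\<Sum>i=1..N. annihilation i f w) * q \<le> (\<Sum>i=1..N. B * q ^ Suc (length w)) * q"
      using q by (intro mult_right_mono) auto
    also have "\<dots> = B * q ^ length w * (real N * q * q)" by simp
    finally show ?thesis unfolding q(2) by simp
  qed
  have 3: "cmod (if w \<noteq> [] \<and> hd w \<in> {1..N} then f w else 0) \<le> B * q ^ length w"
    using f'[of w] B q by auto
  have "cmod (S_op lam N f w) \<le>
      cmod (((if V_word w \<and> w \<noteq> [] \<and> hd w \<in> {1..N} then f (tl w) else 0)
        + (\<Sum>i=1..N. annihilation i f w)) / of_real (sqrt (real N)))
     + cmod (of_real lam * (if w \<noteq> [] \<and> hd w \<in> {1..N} then f w else 0))"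
    unfolding S_op_eq by (rule norm_triangle_ineq)
  also have "cmod (of_real lam * (if w \<noteq> [] \<and> hd w \<in> {1..N} then f w else 0)) \<le> lam * (B * q ^ length w)"
    unfolding norm_mult using 3 lam by (intro mult_mono) auto
  also have "cmod (((if V_word w \<and> w \<noteq> [] \<and> hd w \<in> {1..N} then f (tl w) else 0)
        + (\<Sum>i=1..N. annihilation i f w)) / of_real (sqrt (real N))) \<le>
      (cmod (if V_word w \<and> w \<noteq> [] \<and> hd w \<in> {1..N} then f (tl w) else 0)
        + cmod (\<Sum>i=1..N. annihilation i f w)) * q"
    unfolding norm_divide q_def by (simp add: divide_right_mono norm_triangle_ineq)
  finally show ?thesis using 1 2 unfolding q_def[symmetric] by (simp add: algebra_simps)
qed

lemma S_op_pow_bound: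
  assumes N: "N \<ge> 1" and lam: "lam \<ge> 0" and f: "\<And>w. cmod (f w) \<le> B * (1 / sqrt (real N)) ^ length w"
  shows "cmod ((S_op lam N ^^ n) f w) \<le> (2 + lam) ^ n * B * (1 / sqrt (real N)) ^ length w"
proof (induction n arbitrary: w)
  case (Suc n)
  show ?case using S_op_bound[OF N lam Suc.IH] by (simp add: mult_ac)
qed (use f in simp)

lemma V_word_Nil: "V_word []"
  by (simp add: V_word_def)

lemma vacuum_state_eq: "vacuum_state b = b vacuum []"
proof -
  have "vacuum_state b = (\<Sum>\<^sub>\<infinity>w\<in>{[]}. b vacuum w * cnj (vacuum w))"
    unfolding vacuum_state_def fock_inner_def
    by (rule infsum_cong_neutral) (auto simp: vacuum_def fock_basis_def)
  then show ?thesis by (simp add: vacuum_def fock_basis_def V_word_Nil)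
qed

lemma moment_bound:
  assumes "N \<ge> 1" "lam \<ge> 0" shows "cmod (vacuum_state (S_op lam N ^^ n)) \<le> (2 + lam) ^ n"
proof -
  have "cmod (vacuum w) \<le> 1 * (1 / sqrt (real N)) ^ length w" for w
    by (auto simp: vacuum_def fock_basis_def)
  from S_op_pow_bound[OF assms this, of n "[]"] show ?thesis by (simp add: vacuum_state_eq)
qed

text \<open>A Neumann series obtained by telescoping. With
  \<open>psi = (1 / z) * (vacuum + S psi)\<close>, the remainders \<open>S^n psi / z^n\<close> at
  the empty word differ successively by the terms of the series. They tend to 0 because each
  application of S multiplies the weighted bound by at most 2 + \<lambda>, which is smaller than the
  modulus of z.\<close>

lemma resolvent_sums:
  assumes N: "N \<ge> 1" and lam: "lam \<ge> 0" and z: "cmod z > 2 + lam"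
    and psi: "\<And>w. cmod (psi w) \<le> B * (1 / sqrt (real N)) ^ length w"
    and res: "\<And>w. z * psi w - S_op lam N psi w = vacuum w"
  shows "(\<lambda>n. vacuum_state (S_op lam N ^^ n) / z ^ Suc n) sums psi []"
proof -
  have z0: "z \<noteq> 0" using z lam by auto
  define x where "x = (\<lambda>n. (S_op lam N ^^ n) psi [] / z ^ n)"
  have "psi = (\<lambda>w. (1 / z) * (vacuum w + S_op lam N psi w))"
    using res z0 by (auto simp: fun_eq_iff field_simps simp flip: res)
  then have step: "(S_op lam N ^^ n) psi =
     (\<lambda>w. (1 / z) * ((S_op lam N ^^ n) vacuum w + (S_op lam N ^^ n) (S_op lam N psi) w))" for n
    using S_op_pow_linear[of n lam N "1 / z" vacuum "S_op lam N psi"] by metis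
  have x: "x n - x (Suc n) = vacuum_state (S_op lam N ^^ n) / z ^ Suc n" for n
    unfolding x_def vacuum_state_eq using z0
    by (subst step) (simp add: funpow_swap1 field_simps)
  have lim: "x \<longlonglongrightarrow> 0"
  proof (rule Lim_null_comparison)
    show "eventually (\<lambda>n. norm (x n) \<le> ((2 + lam) / cmod z) ^ n * B) sequentially"
    proof (rule always_eventually, rule allI)
      fix n show "norm (x n) \<le> ((2 + lam) / cmod z) ^ n * B"
        using S_op_pow_bound[OF N lam psi, of n "[]"] z0
        by (simp add: x_def norm_divide norm_power power_divide divide_right_mono)
    qed
    have "(\<lambda>n. ((2 + lam) / cmod z) ^ n) \<longlonglongrightarrow> 0"
    proof (rule LIMSEQ_realpow_zero)
      have "cmod z > 0" using z lam by linarith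
      then show "0 \<le> (2 + lam) / cmod z" "(2 + lam) / cmod z < 1"
        using z lam by (auto simp: divide_less_eq)
    qed
    then show "(\<lambda>n. ((2 + lam) / cmod z) ^ n * B) \<longlonglongrightarrow> 0" by (rule tendsto_mult_left_zero)
  qed
  from telescope_sums'[OF lim] have "(\<lambda>n. x n - x (Suc n)) sums (x 0 - 0)" .
  then show ?thesis by (simp add: x) (simp add: x_def)
qed

text \<open>Product form of the resolvent vector: each letter contributes the weight q of its edge
  and the reciprocal of the denominator of its subtree. The kind of subtree depends on whether the
  word from that letter on is increasing.\<close>

primrec tree_resolvent :: "real \<Rightarrow> (nat \<Rightarrow> real) \<Rightarrow> (nat \<Rightarrow> real) \<Rightarrow> real \<Rightarrow> nat list \<Rightarrow> real" where
  "tree_resolvent q a b G [] = G"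
| "tree_resolvent q a b G (i # w) =
     q * (if sorted_wrt (<) (i # w) then a i else b i) * tree_resolvent q a b G w"

lemma tree_resolvent_bound:
  assumes "q \<ge> 0" "set w \<subseteq> I" "\<And>i. i \<in> I \<Longrightarrow> \<bar>a i\<bar> \<le> 1" "\<And>i. i \<in> I \<Longrightarrow> \<bar>b i\<bar> \<le> 1"
  shows "\<bar>tree_resolvent q a b G w\<bar> \<le> \<bar>G\<bar> * q ^ length w"
  using assms(2)
proof (induction w)
  case (Cons i w)
  define c where "c = (if sorted_wrt (<) (i # w) then a i else b i)"
  have c: "\<bar>c\<bar> \<le> 1" using Cons.prems assms(3,4)[of i] by (auto simp: c_def)
  have "\<bar>tree_resolvent q a b G (i # w)\<bar> = \<bar>c\<bar> * (q * \<bar>tree_resolvent q a b G w\<bar>)"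
    using assms(1) by (simp add: abs_mult c_def)
  also have "\<dots> \<le> 1 * (q * (\<bar>G\<bar> * q ^ length w))"
    using c Cons assms(1) by (intro mult_mono) auto
  finally show ?case by (simp add: mult_ac)
qed simp

text \<open>The hypotheses are the continued fraction relations of the tree. An increasing word has
  children of kind a for smaller letters and of kind b for larger ones; any other word only has
  children of kind b for larger letters. All children of the root are of kind a, and \<lambda> is
  absent there since the conservation operators kill the vacuum.\<close>

lemma S_op_tree_resolvent:
  fixes a b :: "nat \<Rightarrow> real" and N :: nat
  assumes N: "N \<ge> 1"
    and a: "\<And>i. i \<in> {1..N} \<Longrightarrow> a i * (z - lam - ((\<Sum>j\<in>{1..<i}. a j) + (\<Sum>j\<in>{i<..N}. b j)) / N) = 1"
    and b: "\<And>i. i \<in> {1..N} \<Longrightarrow> b i * (z - lam - (\<Sum>j\<in>{i<..N}. b j) / N) = 1"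
    and G: "G * (z - (\<Sum>j\<in>{1..N}. a j) / N) = 1"
  defines "psi \<equiv> \<lambda>w. complex_of_real (if V_word w \<and> set w \<subseteq> {1..N} then tree_resolvent (1 / sqrt N) a b G w else 0)"
  shows "of_real z * psi w - S_op lam N psi w = vacuum w"
proof -
  define q where "q = 1 / sqrt (real N)"
  define t where "t = tree_resolvent q a b G"
  have q: "q > 0" "q * q = 1 / N" using N by (auto simp: q_def)
  have psi: "psi w = of_real (if V_word w \<and> set w \<subseteq> {1..N} then t w else 0)" for w
    by (simp add: psi_def t_def q_def)
  have S: "S_op lam N psi w =
     ((if V_word w \<and> w \<noteq> [] \<and> hd w \<in> {1..N} then psi (tl w) else 0)
        + (\<Sum>i=1..N. annihilation i psi w)) * of_real q
     + of_real lam * (if w \<noteq> [] \<and> hd w \<in> {1..N} then psi w else 0)" for w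
    unfolding S_op_eq q_def by simp
  consider "w = []" | "\<not> V_word w" | "V_word w" "\<not> set w \<subseteq> {1..N}" 
    | h w' where "w = h # w'" "V_word w" "set w \<subseteq> {1..N}"
    by (cases w) auto
  then show ?thesis
  proof cases
    case 1
    have "(\<Sum>i=1..N. annihilation i psi []) = (\<Sum>i=1..N. of_real (q * a i * G))"
      by (rule sum.cong) (auto simp: annihilation_def psi V_word_single t_def)
    also have "\<dots> * of_real q = of_real ((q * q) * G * (\<Sum>i=1..N. a i))"
      by (simp add: sum_distrib_left sum_distrib_right mult_ac)
    also have "\<dots> = of_real (G * ((\<Sum>i=1..N. a i) / N))" unfolding q(2) by simp
    finally have "of_real z * psi w - S_op lam N psi w = of_real (G * (z - (\<Sum>i=1..N. a i) / N))"
      unfolding 1 S by (simp add: psi V_word_Nil t_def algebra_simps)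
    then show ?thesis unfolding G by (simp add: 1 vacuum_def fock_basis_def V_word_Nil)
  next
    case 2
    then have "annihilation i psi w = 0" for i by (auto simp: annihilation_def dest: V_word_ConsD)
    with 2 show ?thesis unfolding S by (auto simp: psi vacuum_def fock_basis_def)
  next
    case 3
    then have "annihilation i psi w = 0" for i by (auto simp: annihilation_def psi)
    moreover have "w \<noteq> []" using 3 by auto
    moreover have "psi (tl w) = 0" if "hd w \<in> {1..N}"
      using 3 that \<open>w \<noteq> []\<close> by (cases w) (auto simp: psi)
    ultimately show ?thesis unfolding S using 3 by (auto simp: psi vacuum_def fock_basis_def)
  next
    case 4
    have h: "h \<in> {1..N}" and w': "V_word w'" "set w' \<subseteq> {1..N}" using 4 V_word_ConsD by auto
    \<comment> \<open>\<open>c i\<close> is the factor belonging to the child \<open>i # w\<close>,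
      and 0 if that is no V-word; the equation at w thereby takes the same shape for both kinds of
      nodes.\<close>
    define c where "c = (\<lambda>i. if sorted_wrt (<) w then (if i < h then a i else if i > h then b i else 0)
       else (if i > h then b i else 0))"
    have "(\<Sum>i=1..N. annihilation i psi w) = (\<Sum>i=1..N. of_real (q * c i * t w))"
    proof (rule sum.cong)
      fix i assume i: "i \<in> {1..N}"
      show "annihilation i psi w = of_real (q * c i * t w)"
      proof (cases "sorted_wrt (<) w")
        case True
        then have "sorted_wrt (<) (i # w) \<longleftrightarrow> i < h" by (auto simp: 4)
        then show ?thesis using True i 4 unfolding annihilation_def psi t_def c_def
          by (auto simp: V_word_Cons_Cons simp del: sorted_wrt.simps)
      next
        case False
        then have "\<not> sorted_wrt (<) (i # w)" by auto
        then show ?thesis using False i 4 unfolding annihilation_def psi t_def c_def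
          by (auto simp: V_word_Cons_Cons simp del: sorted_wrt.simps)
      qed
    qed simp
    also have "\<dots> * of_real q = of_real ((q * q) * t w * (\<Sum>i=1..N. c i))"
      by (simp add: sum_distrib_left sum_distrib_right mult_ac)
    also have "\<dots> = of_real (t w * ((\<Sum>i=1..N. c i) / N))" unfolding q(2) by simp
    finally have "of_real z * psi w - S_op lam N psi w =
       of_real (t w * (z - lam - (\<Sum>i=1..N. c i) / N) - q * t w')"
      unfolding S using 4 h w' by (simp add: psi algebra_simps)
    moreover have "t w * (z - lam - (\<Sum>i=1..N. c i) / N) = q * t w'"
    proof (cases "sorted_wrt (<) w")
      case True
      have "(\<Sum>i=1..N. c i) = (\<Sum>i\<in>{1..<h}. c i) + (\<Sum>i\<in>{h<..N}. c i)"
      proof -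
        have "{1..N} = insert h ({1..<h} \<union> {h<..N})" using h by auto
        then have "(\<Sum>i=1..N. c i) = c h + (\<Sum>i\<in>{1..<h} \<union> {h<..N}. c i)" by simp
        also have "(\<Sum>i\<in>{1..<h} \<union> {h<..N}. c i) = (\<Sum>i\<in>{1..<h}. c i) + (\<Sum>i\<in>{h<..N}. c i)"
          by (rule sum.union_disjoint) auto
        finally show ?thesis by (simp add: c_def)
      qed
      also have "(\<Sum>i\<in>{1..<h}. c i) = (\<Sum>i\<in>{1..<h}. a i)" using True by (intro sum.cong) (auto simp: c_def)
      also have "(\<Sum>i\<in>{h<..N}. c i) = (\<Sum>i\<in>{h<..N}. b i)" using True by (intro sum.cong) (auto simp: c_def)
      finally have "t w * (z - lam - (\<Sum>i=1..N. c i) / N) =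
        q * t w' * (a h * (z - lam - ((\<Sum>j\<in>{1..<h}. a j) + (\<Sum>j\<in>{h<..N}. b j)) / N))"
        using True by (simp add: 4 t_def del: sorted_wrt.simps)
      then show ?thesis unfolding a[OF h] by simp
    next
      case False
      have "(\<Sum>i=1..N. c i) = (\<Sum>i\<in>{h<..N}. c i)"
        using False by (intro sum.mono_neutral_right) (auto simp: c_def)
      also have "\<dots> = (\<Sum>i\<in>{h<..N}. b i)" using False by (intro sum.cong) (auto simp: c_def)
      finally have "t w * (z - lam - (\<Sum>i=1..N. c i) / N) =
        q * t w' * (b h * (z - lam - (\<Sum>j\<in>{h<..N}. b j) / N))"
        using False by (simp add: 4 t_def del: sorted_wrt.simps)
      then show ?thesis unfolding b[OF h] by simp
    qed
    ultimately have "of_real z * psi w - S_op lam N psi w = 0" by (simp only: diff_self of_real_0)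
    then show ?thesis using 4 by (simp add: vacuum_def fock_basis_def)
  qed
qed

section \<open>Moments determine compactly supported measures\<close>

lemma bounded_powers_integrable:
  fixes M :: "real measure"
  assumes "finite_measure M" "sets M = sets borel" "AE x in M. \<bar>x\<bar> \<le> R"
  shows "integrable M (\<lambda>x. x ^ n)"
proof (rule finite_measure.integrable_const_bound[OF assms(1), of _ "R ^ n"])
  show "AE x in M. norm (x ^ n) \<le> R ^ n"
    using assms(3) by eventually_elim (auto simp: power_abs intro!: power_mono)
  show "(\<lambda>x. x ^ n) \<in> borel_measurable M" 
    by (subst measurable_cong_sets[OF assms(2) refl]) simp
qed

text \<open>For a support bounded by r the exponential series of the characteristic function
  converges, the n-th error being at most \<open>2 * (\<bar>t\<bar> * r) ^ n / fact n\<close>, and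
  its coefficients are the moments. Equal characteristic functions then force equal
  measures.\<close>

lemma moments_determine_measure:
  fixes M M' :: "real measure"
  assumes M: "prob_space M" "sets M = sets borel" "AE x in M. \<bar>x\<bar> \<le> R"
    and M': "prob_space M'" "sets M' = sets borel" "AE x in M'. \<bar>x\<bar> \<le> R'"
    and eq: "\<And>n. (\<integral>x. x ^ n \<partial>M) = (\<integral>x. x ^ n \<partial>M')"
  shows "M = M'"
proof -
  have conv: "(\<lambda>n. \<Sum>k\<le>n. ((\<i> * of_real t) ^ k / fact k) * of_real (\<integral>x. x ^ k \<partial>N)) \<longlonglongrightarrow> char N t"
    if N: "prob_space N" "sets N = sets borel" "AE x in N. \<bar>x\<bar> \<le> r" for N r t
  proof -
    interpret real_distribution N
      using N by (simp add: real_distribution_def real_distribution_axioms_def)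
    have fm: "finite_measure N" by unfold_locales
    have int: "integrable N (\<lambda>x. x ^ k)" for k
      by (rule bounded_powers_integrable[OF fm N(2,3)])
    have r: "r \<ge> 0"
    proof (rule ccontr)
      assume "\<not> r \<ge> 0"
      have "AE x in N. False" 
        by (rule AE_mp[OF N(3)]) (rule AE_I2, use \<open>\<not> r \<ge> 0\<close> in auto)
      then show False by (simp add: AE_False)
    qed
    have bd: "cmod (char N t - (\<Sum>k\<le>n. ((\<i> * of_real t) ^ k / fact k) * of_real (\<integral>x. x ^ k \<partial>N)))
        \<le> 2 * ((\<bar>t\<bar> * r) ^ n / fact n)" for n
    proof -
      have "cmod (char N t - (\<Sum>k\<le>n. ((\<i> * of_real t) ^ k / fact k) * of_real (\<integral>x. x ^ k \<partial>N)))
         \<le> (2 * \<bar>t\<bar> ^ n / fact n) * (\<integral>x. \<bar>x\<bar> ^ n \<partial>N)"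
        by (rule char_approx1) (rule int)
      moreover have "(\<integral>x. \<bar>x\<bar> ^ n \<partial>N) \<le> (\<integral>x. r ^ n \<partial>N)"
      proof (rule integral_mono_AE)
        show "integrable N (\<lambda>x. \<bar>x\<bar> ^ n)" using integrable_norm[OF int[of n]] by (simp add: power_abs)
        show "AE x in N. \<bar>x\<bar> ^ n \<le> r ^ n" using N(3) by eventually_elim (auto intro!: power_mono)
      qed simp
      then have "(2 * \<bar>t\<bar> ^ n / fact n) * (\<integral>x. \<bar>x\<bar> ^ n \<partial>N) \<le> (2 * \<bar>t\<bar> ^ n / fact n) * r ^ n"
        using prob_space by (intro mult_left_mono) auto
      ultimately show ?thesis by (simp only: power_mult_distrib times_divide_eq_left times_divide_eq_right mult.assoc)
    qed
    have "(\<lambda>n. 2 * ((\<bar>t\<bar> * r) ^ n / fact n)) \<longlonglongrightarrow> 2 * 0"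
      using summable_LIMSEQ_zero[OF summable_exp[of "\<bar>t\<bar> * r"]]
      by (intro tendsto_mult tendsto_const) (simp add: field_simps)
    then have "(\<lambda>n. char N t - (\<Sum>k\<le>n. ((\<i> * of_real t) ^ k / fact k) * of_real (\<integral>x. x ^ k \<partial>N))) \<longlonglongrightarrow> 0"
      by (intro Lim_null_comparison[OF always_eventually[rule_format, OF bd]]) simp
    from tendsto_diff[OF tendsto_const[of "char N t"] this] show ?thesis by simp
  qed
  have "char M = char M'"
  proof
    fix t
    show "char M t = char M' t"
      using conv[OF M, of t] conv[OF M', of t] eq by (simp add: LIMSEQ_unique)
  qed
  then show ?thesis
    using M M' by (intro Levy_uniqueness) (simp_all add: real_distribution_def real_distribution_axioms_def)
qed

lemma mu_eqI:
  assumes "is_limit_distribution lam M" shows "mu lam = M"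
  unfolding mu_def
proof (rule the_equality)
  show "is_limit_distribution lam M" by fact
next
  fix M' assume M': "is_limit_distribution lam M'"
  from assms obtain R where R: "prob_space M" "sets M = sets borel" "AE x in M. \<bar>x\<bar> \<le> R"
    and l: "\<And>n. (\<lambda>N. vacuum_state (S_op lam N ^^ n)) \<longlonglongrightarrow> of_real (\<integral>x. x ^ n \<partial>M)"
    by (auto simp: is_limit_distribution_def)
  from M' obtain R' where R': "prob_space M'" "sets M' = sets borel" "AE x in M'. \<bar>x\<bar> \<le> R'"
    and l': "\<And>n. (\<lambda>N. vacuum_state (S_op lam N ^^ n)) \<longlonglongrightarrow> of_real (\<integral>x. x ^ n \<partial>M')"
    by (auto simp: is_limit_distribution_def)
  show "M' = M"
  proof (rule moments_determine_measure[OF R' R])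
    fix n
    have "complex_of_real (\<integral>x. x ^ n \<partial>M') = of_real (\<integral>x. x ^ n \<partial>M)"
      by (rule LIMSEQ_unique[OF l' l])
    then show "(\<integral>x. x ^ n \<partial>M') = (\<integral>x. x ^ n \<partial>M)" by (simp only: of_real_eq_iff)
  qed
qed

section \<open>The continuum limit\<close>

lemma T0_T0_inv:
  assumes "w \<le> sqrt 3 * pi / 9" shows "T0 (T0_inv w) = w" "T0_inv w \<ge> 0"
proof -
  obtain t where t: "0 < t" "t \<le> 4 * pi / 3" "T_axis t = w" using T_axis_surj[OF assms] by blast
  then have t2: "t < 2 * pi" using pi_gt_zero by linarith
  have r: "r_axis t \<ge> 0" by (rule r_axis_nonneg[OF t(1,2)])
  have "T0_inv w = r_axis t" using T0_inv_T0[OF r] T0_r_axis[OF t(1) t2] t(3) by simp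
  then show "T0 (T0_inv w) = w" "T0_inv w \<ge> 0" using T0_r_axis[OF t(1) t2] t(3) r by simp_all
qed

lemma T0_zero: "T0 0 = sqrt 3 * pi / 9"
proof -
  have "0 < 4 * pi / 3" "4 * pi / 3 < 2 * pi" using pi_gt_zero by linarith+
  from T0_r_axis[OF this] show ?thesis by (simp only: r_axis_zero T_axis_crit)
qed

lemma DERIV_T0_inv:
  assumes "w < sqrt 3 * pi / 9"
  defines "r \<equiv> T0_inv w"
  shows "r > 0" "(T0_inv has_real_derivative - ((r\<^sup>2 - r + 1) / r)) (at w)"
proof -
  have T: "T0 r = w" "r \<ge> 0" using T0_T0_inv[of w] assms by auto
  show r: "r > 0" using T T0_zero assms by (cases "r = 0") auto
  have "isCont T0_inv (T0 r)"
  proof (rule isCont_inverse_function[where f = T0 and x = r and d = "r / 2"])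
    show "r / 2 > 0" using r by simp
    fix z assume "\<bar>z - r\<bar> \<le> r / 2"
    then have "z \<ge> 0" using r by linarith
    then show "T0_inv (T0 z) = z" by (rule T0_inv_T0)
    show "isCont T0 z" using DERIV_T0 by (rule DERIV_isCont)
  qed
  then have c: "isCont T0_inv w" using T by simp
  have "(T0_inv has_real_derivative inverse (- (r / (r\<^sup>2 - r + 1)))) (at w)"
  proof (rule DERIV_inverse_function[of T0 _ _ _ "w - 1" "sqrt 3 * pi / 9"])
    show "(T0 has_real_derivative - (r / (r\<^sup>2 - r + 1))) (at (T0_inv w))"
      unfolding r_def[symmetric] by (rule DERIV_T0)
    show "- (r / (r\<^sup>2 - r + 1)) \<noteq> 0" using r quad_pos[of r] by simp
    show "T0 (T0_inv y) = y" if "y < sqrt 3 * pi / 9" for y using that T0_T0_inv by simp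
  qed (use assms c in auto)
  then show "(T0_inv has_real_derivative - ((r\<^sup>2 - r + 1) / r)) (at w)" by simp
qed

text \<open>Keeps r \<ge> 1/2 along the flow, where \<open>T0 r\<close> never exceeds 1/14: on
  [1/2, 1] the integrand is at least 1/2 because \<open>t\<^sup>2 - t + 1 \<le> 1\<close>
  there.\<close>

lemma T0_half: "T0 (1 / 2) \<ge> 1 / 4"
proof -
  obtain x where x: "1 / 2 < x" "x < 1" "T0 1 - T0 (1 / 2) = (1 - 1 / 2) * (- (x / (x\<^sup>2 - x + 1)))"
    using MVT2[of "1 / 2" 1 T0 "\<lambda>s. - (s / (s\<^sup>2 - s + 1))"] DERIV_T0 by auto
  have "x\<^sup>2 - x \<le> 0" using x by (simp add: power2_eq_square mult_left_le_one_le)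
  then have "x * (x\<^sup>2 - x + 1) \<le> x * 1" using x by (intro mult_left_mono) auto
  then have "x \<le> x / (x\<^sup>2 - x + 1)" using quad_pos[of x] by (simp add: pos_le_divide_eq)
  then have "1 / 2 \<le> x / (x\<^sup>2 - x + 1)" using x by linarith
  moreover have "T0 1 = 0" by (simp add: T0_eq)
  moreover have "1 / 4 \<le> b" if "1 / 2 \<le> q" "a = 0" "a - b = (1 - 1 / 2) * (- q)" for a b q :: real
    using that by simp
  ultimately show ?thesis using x(3) by metis
qed

section \<open>The limiting differential equations and their Euler schemes\<close>

definition u_flow :: "real \<Rightarrow> real \<Rightarrow> real" where
  "u_flow y t = sqrt (y\<^sup>2 - 2 + 2 * t)"

text \<open>Solves \<open>w' = 1/u - 1/w\<close> with w = u at time 0. In terms of r = w/u and the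
  new time log u the equation becomes \<open>dr/d log u = - (r\<^sup>2 - r + 1) / r\<close>, which
  separates to \<open>T0 r = log (u / u(0))\<close>; this is where \<open>T0\<close> comes
  from.\<close>

definition w_flow :: "real \<Rightarrow> real \<Rightarrow> real" where
  "w_flow y t = u_flow y t * T0_inv (ln (u_flow y t / u_flow y 0))"

lemma u_flow_bounds:
  assumes "y \<ge> 4" "0 \<le> t" "t \<le> 1"
  shows "u_flow y t \<ge> 3" "u_flow y t \<le> y" "(u_flow y t)\<^sup>2 = y\<^sup>2 - 2 + 2 * t"
proof -
  have y: "y\<^sup>2 \<ge> 16" using power_mono[of 4 y 2] assms by simp
  show "u_flow y t \<ge> 3" unfolding u_flow_def by (rule real_le_rsqrt) (use y assms in simp)
  show "u_flow y t \<le> y" unfolding u_flow_def by (rule real_le_lsqrt) (use y assms in auto)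
  show "(u_flow y t)\<^sup>2 = y\<^sup>2 - 2 + 2 * t" unfolding u_flow_def using y assms by simp
qed

lemma DERIV_u_flow:
  assumes "y \<ge> 4" "0 \<le> t" "t \<le> 1"
  shows "(u_flow y has_real_derivative 1 / u_flow y t) (at t)"
proof -
  have "y\<^sup>2 \<ge> 16" using power_mono[of 4 y 2] assms by simp
  then have p: "y\<^sup>2 - 2 + 2 * t > 0" using assms by simp
  have "((\<lambda>t. y\<^sup>2 - 2 + 2 * t) has_real_derivative 2) (at t)" by (auto intro!: derivative_eq_intros)
  from DERIV_chain2[OF DERIV_real_sqrt[OF p] this]
  show ?thesis by (simp add: u_flow_def[abs_def] field_simps)
qed

lemma w_flow_props:
  assumes "y \<ge> 4" "0 \<le> t" "t \<le> 1"
  shows "w_flow y t \<ge> 1" "(w_flow y has_real_derivative 1 / u_flow y t - 1 / w_flow y t) (at t)"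
proof -
  note u = u_flow_bounds[OF assms] and u0 = u_flow_bounds[OF assms(1), of 0]
  define L where "L = ln (u_flow y t / u_flow y 0)"
  have y: "y\<^sup>2 \<ge> 16" using power_mono[of 4 y 2] assms by simp
  \<comment> \<open>For y \<ge> 4 the flow changes the square of u by at most 2 against a size of at
    least 14, so the argument of \<open>T0_inv\<close> is at most 1/14, well inside its domain and
    below \<open>T0 (1 / 2)\<close>.\<close>
  have "2 * L = ln ((u_flow y t / u_flow y 0)\<^sup>2)" unfolding L_def using u u0 by (simp add: ln_realpow)
  also have "\<dots> \<le> (u_flow y t / u_flow y 0)\<^sup>2 - 1" using u u0 by (intro ln_le_minus_one) simp
  also have "\<dots> = 2 * t / (y\<^sup>2 - 2)"
    unfolding power_divide u(3) using u0(3) y by (simp add: field_simps)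
  also have "\<dots> \<le> 2 / 14" using y assms by (intro frac_le) auto
  finally have L: "L \<le> 1 / 14" by simp
  have "1 * 3 \<le> sqrt 3 * pi" using pi_gt3 by (intro mult_mono) auto
  then have Lw: "L < sqrt 3 * pi / 9" using L by simp
  define r where "r = T0_inv L"
  note D = DERIV_T0_inv[OF Lw, folded r_def]
  have "r \<ge> 1 / 2"
  proof (rule ccontr)
    assume "\<not> r \<ge> 1 / 2"
    then have "T0 (1 / 2) < T0 r" using D(1) by (intro T0_strict_antimono) auto
    also have "T0 r = L" using T0_T0_inv[of L] Lw by (simp add: r_def)
    finally show False using L T0_half by linarith
  qed
  then have "3 * (1 / 2) \<le> u_flow y t * r" using u by (intro mult_mono) auto
  moreover have w: "w_flow y t = u_flow y t * r" by (simp add: w_flow_def r_def L_def)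
  ultimately show "w_flow y t \<ge> 1" by simp
  have up: "u_flow y t > 0" "u_flow y 0 > 0" using u u0 by auto
  have "((\<lambda>t. u_flow y t / u_flow y 0) has_real_derivative 1 / u_flow y t / u_flow y 0) (at t)"
    by (intro DERIV_cdivide DERIV_u_flow assms)
  from DERIV_chain2[OF DERIV_ln_divide this]
  have "((\<lambda>t. ln (u_flow y t / u_flow y 0)) has_real_derivative 1 / (u_flow y t / u_flow y 0) * (1 / u_flow y t / u_flow y 0)) (at t)"
    using up by simp
  from DERIV_chain2[OF D(2)[unfolded L_def] this]
  have "((\<lambda>t. T0_inv (ln (u_flow y t / u_flow y 0))) has_real_derivative
     - ((r\<^sup>2 - r + 1) / r) * (1 / (u_flow y t / u_flow y 0) * (1 / u_flow y t / u_flow y 0))) (at t)" .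
  from DERIV_mult[OF DERIV_u_flow[OF assms] this]
  have "(w_flow y has_real_derivative 1 / u_flow y t * T0_inv (ln (u_flow y t / u_flow y 0)) +
     - ((r\<^sup>2 - r + 1) / r) * (1 / (u_flow y t / u_flow y 0) * (1 / u_flow y t / u_flow y 0)) * u_flow y t) (at t)"
    by (simp only: w_flow_def[abs_def])
  also have "1 / u_flow y t * T0_inv (ln (u_flow y t / u_flow y 0)) +
     - ((r\<^sup>2 - r + 1) / r) * (1 / (u_flow y t / u_flow y 0) * (1 / u_flow y t / u_flow y 0)) * u_flow y t =
     1 / u_flow y t - 1 / w_flow y t"
    unfolding w L_def[symmetric] r_def[symmetric] using up D(1) by (simp add: field_simps power2_eq_square)
  finally show "(w_flow y has_real_derivative 1 / u_flow y t - 1 / w_flow y t) (at t)" .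
qed

text \<open>Index convention: \<open>u_euler y N k\<close> approximates \<open>u_flow y\<close> at \<open>1 - k/N\<close> (the recursion runs
  downwards from the last letter), \<open>w_euler y N i\<close> approximates \<open>w_flow y\<close> at \<open>i/N\<close>.\<close>

primrec u_euler :: "real \<Rightarrow> nat \<Rightarrow> nat \<Rightarrow> real" where
  "u_euler y N 0 = y"
| "u_euler y N (Suc k) = u_euler y N k - 1 / (N * u_euler y N k)"

primrec w_euler :: "real \<Rightarrow> nat \<Rightarrow> nat \<Rightarrow> real" where
  "w_euler y N 0 = u_euler y N N"
| "w_euler y N (Suc i) = (w_euler y N i + 1 / (N * u_euler y N (N - Suc i)))
     - 1 / (N * (w_euler y N i + 1 / (N * u_euler y N (N - Suc i))))"

lemma frac_le_1: "k \<le> N \<Longrightarrow> real k / real N \<le> 1"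
  by (cases "N = 0") (auto simp: divide_le_eq)

lemma u_euler_lower:
  assumes "N \<ge> 1" "y \<ge> 4" "k \<le> N" shows "u_euler y N k \<ge> y - k / N" "u_euler y N k \<ge> 3"
proof -
  have *: "k \<le> N \<Longrightarrow> u_euler y N k \<ge> y - k / N" for k
  proof (induction k)
    case (Suc k)
    then have 1: "u_euler y N k \<ge> y - k / N" by simp
    then have "u_euler y N k \<ge> 1" using frac_le_1[of k N] Suc.prems assms by linarith
    then have "1 / (N * u_euler y N k) \<le> 1 / N" using assms by (intro divide_left_mono) auto
    then show ?case using 1 by (simp add: add_divide_distrib)
  qed simp
  show "u_euler y N k \<ge> y - k / N" using * assms by simp
  then show "u_euler y N k \<ge> 3" using frac_le_1[of k N] assms by linarith
qed

lemma w_euler_lower: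
  assumes "N \<ge> 1" "y \<ge> 4" "i \<le> N" shows "w_euler y N i \<ge> 2"
proof -
  have *: "i \<le> N \<Longrightarrow> w_euler y N i \<ge> 3 - i / N" for i
  proof (induction i)
    case 0
    then show ?case using u_euler_lower[OF assms(1,2), of N] by simp
  next
    case (Suc i)
    define v where "v = w_euler y N i + 1 / (N * u_euler y N (N - Suc i))"
    have "u_euler y N (N - Suc i) \<ge> 3" by (rule u_euler_lower[OF assms(1,2)]) simp
    then have v: "v \<ge> w_euler y N i" using assms by (simp add: v_def)
    have 1: "w_euler y N i \<ge> 3 - i / N" using Suc by simp
    then have "v \<ge> 1" using frac_le_1[of i N] Suc.prems v by linarith
    then have "1 / (N * v) \<le> 1 / N" using assms by (intro divide_left_mono) auto
    then show ?case using 1 v by (simp add: v_def[symmetric] add_divide_distrib)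
  qed
  show ?thesis using *[OF assms(3)] frac_le_1[OF assms(3)] by linarith
qed

lemma inverse_lipschitz: "a \<ge> 1 \<Longrightarrow> b \<ge> 1 \<Longrightarrow> \<bar>1 / a - 1 / b\<bar> \<le> \<bar>a - b\<bar>" for a b :: real
proof -
  assume ab: "a \<ge> 1" "b \<ge> 1"
  have "1 / a - 1 / b = (b - a) / (a * b)" using ab by (simp add: field_simps)
  then have "\<bar>1 / a - 1 / b\<bar> = \<bar>a - b\<bar> / (a * b)" using ab by (simp add: abs_minus_commute)
  also have "\<dots> \<le> \<bar>a - b\<bar> / 1"
    using mult_mono[of 1 a 1 b] ab by (intro divide_left_mono) auto
  finally show ?thesis by simp
qed

text \<open>The square is followed instead of u: one step changes it by exactly
  \<open>- 2 / N\<close> plus \<open>(1 / (N * U))\<^sup>2\<close>, and the square of the flow is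
  linear in time. The errors just add up, to at most 1/N, and dividing by the sum of both functions
  returns to u.\<close>

lemma u_euler_error:
  assumes N: "N \<ge> 1" and y: "y \<ge> 4" and k: "k \<le> N"
  shows "\<bar>u_euler y N k - u_flow y (real (N - k) / N)\<bar> \<le> 1 / N"
proof -
  have *: "k \<le> N \<Longrightarrow> \<bar>(u_euler y N k)\<^sup>2 - (y\<^sup>2 - 2 * (k / N))\<bar> \<le> (k / N) / N" for k
  proof (induction k)
    case (Suc k)
    define U where "U = u_euler y N k"
    have U: "U \<ge> 3" using u_euler_lower[OF N y, of k] Suc.prems by (simp add: U_def)
    have e1: "(U - 1 / (N * U))\<^sup>2 = U\<^sup>2 - 2 * (1 / N) + (1 / (N * U))\<^sup>2"
      using U N by (simp add: power2_diff)
    have e2: "(1 / (N * U))\<^sup>2 \<le> (1 / N)\<^sup>2"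
      using U N by (intro power_mono divide_left_mono) auto
    have e3: "(1 / real N)\<^sup>2 = (1 / N) / N" by (simp add: power2_eq_square)
    have e4: "(1 / (N * U))\<^sup>2 \<ge> 0" by simp
    have e5: "\<bar>U\<^sup>2 - (y\<^sup>2 - 2 * (k / N))\<bar> \<le> (k / N) / N" using Suc by (simp add: U_def)
    have e6: "real (Suc k) / N = k / N + 1 / N" by (simp add: add_divide_distrib)
    have e7: "(k / N + 1 / N) / N = (k / N) / N + (1 / real N) / N" by (rule add_divide_distrib)
    have "\<bar>A - 2 * n + P - (Y - 2 * (K + n))\<bar> \<le> E + Q"
      if "\<bar>A - (Y - 2 * K)\<bar> \<le> E" "0 \<le> P" "P \<le> Q" for A Y K n E P Q :: real
    proof (rule abs_leI)
      have "A - (Y - 2 * K) \<le> E" "- (A - (Y - 2 * K)) \<le> E" using that(1) by (simp_all add: abs_le_iff)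
      with that(2,3) show "A - 2 * n + P - (Y - 2 * (K + n)) \<le> E + Q"
        "- (A - 2 * n + P - (Y - 2 * (K + n))) \<le> E + Q" by argo+
    qed
    from this[OF e5 e4 e2[unfolded e3], of "1 / N"] show ?case
      by (simp only: u_euler.simps U_def[symmetric] e6 e7 e1)
  qed simp
  define t where "t = real (N - k) / N"
  have t: "0 \<le> t" "t \<le> 1" using frac_le_1[of "N - k" N] by (auto simp: t_def)
  have tk: "t = 1 - k / N" using k N by (simp add: t_def of_nat_diff diff_divide_distrib)
  note u = u_flow_bounds[OF y t]
  define U where "U = u_euler y N k"
  have U: "U \<ge> 3" using u_euler_lower[OF N y k] by (simp add: U_def)
  have "\<bar>U\<^sup>2 - (u_flow y t)\<^sup>2\<bar> \<le> (k / N) / N"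
  proof -
    have "(u_flow y t)\<^sup>2 = y\<^sup>2 - 2 * (k / N)" using u(3) tk by simp
    then show ?thesis using *[OF k] by (simp only: U_def)
  qed
  also have "\<dots> \<le> 1 / N" using frac_le_1[OF k] by (intro divide_right_mono) auto
  also have "U\<^sup>2 - (u_flow y t)\<^sup>2 = (U - u_flow y t) * (U + u_flow y t)"
    by (simp add: power2_eq_square algebra_simps)
  finally have 1: "\<bar>U - u_flow y t\<bar> * \<bar>U + u_flow y t\<bar> \<le> 1 / N" by (simp add: abs_mult)
  have "\<bar>U - u_flow y t\<bar> * 1 \<le> \<bar>U - u_flow y t\<bar> * \<bar>U + u_flow y t\<bar>"
    using U u by (intro mult_left_mono) auto
  with 1 show ?thesis by (simp add: U_def t_def)
qed

lemma lipschitz_1: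
  assumes "\<And>t. a \<le> t \<Longrightarrow> t \<le> b \<Longrightarrow> (f has_real_derivative f' t) (at t)" "\<And>t. a \<le> t \<Longrightarrow> t \<le> b \<Longrightarrow> \<bar>f' t\<bar> \<le> 1"
    "a \<le> s" "s \<le> b" "a \<le> t" "t \<le> b"
  shows "\<bar>f s - f t\<bar> \<le> \<bar>s - t\<bar>"
proof -
  have *: "\<bar>f q - f p\<bar> \<le> q - p" if pq: "a \<le> p" "p < q" "q \<le> b" for p q
  proof -
    obtain z where z: "p < z" "z < q" "f q - f p = (q - p) * f' z"
      using MVT2[OF pq(2), of f f'] assms(1) pq by (metis order_trans less_imp_le)
    have "\<bar>f q - f p\<bar> = (q - p) * \<bar>f' z\<bar>" using z pq by (simp add: abs_mult)
    also have "\<dots> \<le> (q - p) * 1" using z pq assms(2)[of z] by (intro mult_left_mono) auto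
    finally show ?thesis by simp
  qed
  show ?thesis using *[of s t] *[of t s] assms(3-6) by (cases s t rule: linorder_cases) (auto simp: abs_minus_commute)
qed

text \<open>A discrete Gronwall argument. If e is the old error, the new one is at most
  \<open>e + (1 / N) * (e + 4 / N)\<close>, with 2/N coming from each of the two reciprocals; so
  error plus 4/N grows by the factor 1 + 1/N per step. It starts at 5/N or less, since
  \<open>w_euler\<close> begins with the final value of \<open>u_euler\<close>, whose error is at
  most 1/N.\<close>

lemma w_euler_error:
  assumes N: "N \<ge> 1" and y: "y \<ge> 4" and i: "i \<le> N"
  shows "\<bar>w_euler y N i - w_flow y (real i / N)\<bar> + 4 / N \<le> (1 + 1 / N) ^ i * (5 / N)"
  using i
proof (induction i)
  case 0
  have "T0 1 = 0" by (simp add: T0_eq)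
  then have "T0_inv 0 = 1" using T0_inv_T0[of 1] by simp
  then have "w_flow y 0 = u_flow y 0" using u_flow_bounds(1)[OF y, of 0] by (simp add: w_flow_def)
  then show ?case using u_euler_error[OF N y, of N] by simp
next
  case (Suc i)
  define e where "e = \<bar>w_euler y N i - w_flow y (real i / N)\<bar>"
  have IH: "e + 4 / N \<le> (1 + 1 / N) ^ i * (5 / N)" using Suc by (simp add: e_def)
  define s t where "s = real i / N" and "t = real (Suc i) / N"
  have st: "0 \<le> s" "t \<le> 1" "t - s = 1 / N" "s < t"
    using Suc.prems N frac_le_1[of "Suc i" N] by (auto simp: s_def t_def add_divide_distrib divide_strict_right_mono)
  define U where "U = u_euler y N (N - Suc i)"
  have U3: "U \<ge> 3" unfolding U_def by (rule u_euler_lower[OF N y]) simp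
  have Ue: "\<bar>U - u_flow y t\<bar> \<le> 1 / N"
    using u_euler_error[OF N y, of "N - Suc i"] Suc.prems by (simp add: U_def t_def)
  define W where "W = w_euler y N i"
  have W2: "W \<ge> 2" unfolding W_def using w_euler_lower[OF N y] Suc.prems by simp
  define v where "v = W + 1 / (N * U)"
  have NU: "1 / (N * U) \<le> 1 / N" "1 / (N * U) \<ge> 0" using U3 N by (auto intro!: divide_left_mono)
  have v: "v \<ge> 1" using NU W2 unfolding v_def by linarith
  have D: "(w_flow y has_real_derivative 1 / u_flow y x - 1 / w_flow y x) (at x)" if "s \<le> x" "x \<le> t" for x
    by (rule w_flow_props(2)[OF y]) (use st that in linarith)+
  obtain z where z: "s < z" "z < t" "w_flow y t - w_flow y s = (t - s) * (1 / u_flow y z - 1 / w_flow y z)"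
    using MVT2[OF st(4) D] by blast
  have z01: "0 \<le> z" "z \<le> 1" using z st by linarith+
  have ul: "\<bar>u_flow y t - u_flow y z\<bar> \<le> \<bar>t - z\<bar>"
  proof (rule lipschitz_1[of 0 1 "u_flow y" "\<lambda>t. 1 / u_flow y t"])
    show "(u_flow y has_real_derivative 1 / u_flow y t) (at t)" if "0 \<le> t" "t \<le> 1" for t
      by (rule DERIV_u_flow[OF y that])
    show "\<bar>1 / u_flow y t\<bar> \<le> 1" if "0 \<le> t" "t \<le> 1" for t using u_flow_bounds(1)[OF y that] by simp
  qed (use z01 st z in auto)
  have wl: "\<bar>w_flow y s - w_flow y z\<bar> \<le> \<bar>s - z\<bar>"
  proof (rule lipschitz_1[of 0 1 "w_flow y" "\<lambda>t. 1 / u_flow y t - 1 / w_flow y t"])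
    show "(w_flow y has_real_derivative 1 / u_flow y t - 1 / w_flow y t) (at t)" if "0 \<le> t" "t \<le> 1" for t
      by (rule w_flow_props(2)[OF y that])
    show "\<bar>1 / u_flow y t - 1 / w_flow y t\<bar> \<le> 1" if "0 \<le> t" "t \<le> 1" for t
    proof -
      have "0 \<le> 1 / u_flow y t" "1 / u_flow y t \<le> 1" "0 \<le> 1 / w_flow y t" "1 / w_flow y t \<le> 1"
        using u_flow_bounds(1)[OF y that] w_flow_props(1)[OF y that] by auto
      then show ?thesis by linarith
    qed
  qed (use z01 st z in auto)
  have A: "\<bar>1 / U - 1 / u_flow y z\<bar> \<le> 2 / N"
  proof -
    have "\<bar>1 / U - 1 / u_flow y z\<bar> \<le> \<bar>U - u_flow y z\<bar>"
      using U3 u_flow_bounds(1)[OF y z01] by (intro inverse_lipschitz) auto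
    also have "\<dots> \<le> \<bar>U - u_flow y t\<bar> + \<bar>u_flow y t - u_flow y z\<bar>" by linarith
    also have "\<dots> \<le> 1 / N + 1 / N" using Ue ul z st by linarith
    finally show ?thesis by simp
  qed
  have B: "\<bar>1 / v - 1 / w_flow y z\<bar> \<le> e + 2 / N"
  proof -
    have "\<bar>1 / v - 1 / w_flow y z\<bar> \<le> \<bar>v - w_flow y z\<bar>"
      using v w_flow_props(1)[OF y z01] by (intro inverse_lipschitz) auto
    also have "\<dots> \<le> \<bar>W - w_flow y s\<bar> + 1 / (N * U) + \<bar>w_flow y s - w_flow y z\<bar>"
    proof -
      have "v - w_flow y z = (W - w_flow y s) + 1 / (N * U) + (w_flow y s - w_flow y z)" by (simp add: v_def)
      then have "\<bar>v - w_flow y z\<bar> \<le> \<bar>(W - w_flow y s) + 1 / (N * U)\<bar> + \<bar>w_flow y s - w_flow y z\<bar>"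
        by (simp only: abs_triangle_ineq)
      also have "\<bar>(W - w_flow y s) + 1 / (N * U)\<bar> \<le> \<bar>W - w_flow y s\<bar> + \<bar>1 / (N * U)\<bar>"
        by (rule abs_triangle_ineq)
      also have "\<bar>1 / (N * U)\<bar> = 1 / (N * U)" using NU(2) by (rule abs_of_nonneg)
      finally show ?thesis by simp
    qed
    also have "\<dots> \<le> e + 1 / N + 1 / N" using NU wl z st by (simp add: e_def W_def s_def)
    finally show ?thesis by simp
  qed
  have "w_euler y N (Suc i) - w_flow y t = (W - w_flow y s) + (1 / N) * ((1 / U - 1 / u_flow y z) - (1 / v - 1 / w_flow y z))"
  proof -
    have "w_euler y N (Suc i) = W + (1 / N) * (1 / U) - (1 / N) * (1 / v)"
      by (simp add: W_def[symmetric] U_def[symmetric] v_def)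
    moreover have "w_flow y t = w_flow y s + (1 / N) * (1 / u_flow y z - 1 / w_flow y z)" using z(3) st(3) by simp
    ultimately show ?thesis by (simp add: algebra_simps)
  qed
  then have "\<bar>w_euler y N (Suc i) - w_flow y t\<bar> \<le> e + \<bar>(1 / N) * ((1 / U - 1 / u_flow y z) - (1 / v - 1 / w_flow y z))\<bar>"
    unfolding e_def W_def s_def by linarith
  also have "\<bar>(1 / N) * ((1 / U - 1 / u_flow y z) - (1 / v - 1 / w_flow y z))\<bar> =
     (1 / N) * \<bar>(1 / U - 1 / u_flow y z) - (1 / v - 1 / w_flow y z)\<bar>"
    by (simp add: abs_mult)
  also have "\<dots> \<le> (1 / N) * (e + 4 / N)"
  proof (rule mult_left_mono)
    have "2 / real N + 2 / N = 4 / N" by simp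
    then show "\<bar>(1 / U - 1 / u_flow y z) - (1 / v - 1 / w_flow y z)\<bar> \<le> e + 4 / N" using A B by linarith
  qed simp
  finally have "\<bar>w_euler y N (Suc i) - w_flow y t\<bar> \<le> e + (1 / N) * (e + 4 / N)" by simp
  moreover have "(1 + 1 / N) * (e + 4 / N) = (e + (1 / N) * (e + 4 / N)) + 4 / N"
    by (simp only: distrib_right mult_1_left)
  ultimately have "\<bar>w_euler y N (Suc i) - w_flow y t\<bar> + 4 / N \<le> (1 + 1 / N) * (e + 4 / N)"
    by (simp only: add_le_cancel_right)
  also have "\<dots> \<le> (1 + 1 / N) * ((1 + 1 / N) ^ i * (5 / N))" using IH by (intro mult_left_mono) auto
  finally show ?case by (simp only: t_def power_Suc mult.assoc)
qed

lemma w_euler_limit: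
  assumes y: "y \<ge> 4"
  shows "(\<lambda>N. w_euler y N N) \<longlonglongrightarrow> y * T0_inv (ln (y\<^sup>2 / (y\<^sup>2 - 2)) / 2)"
proof -
  have y2: "y\<^sup>2 \<ge> 16" using power_mono[of 4 y 2] assms by simp
  have "(\<lambda>N. w_euler y N N - w_flow y 1) \<longlonglongrightarrow> 0"
  proof (rule Lim_null_comparison)
    show "(\<lambda>N. exp 1 * (5 / real N)) \<longlonglongrightarrow> 0" by real_asymp
    show "eventually (\<lambda>N. norm (w_euler y N N - w_flow y 1) \<le> exp 1 * (5 / real N)) sequentially"
      using eventually_ge_at_top[of 1]
    proof eventually_elim
      case (elim N)
      have "(1 + 1 / real N) ^ N \<le> exp (1 / real N) ^ N" by (intro power_mono exp_ge_add_one_self) auto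
      also have "\<dots> = exp 1" using elim by (simp flip: exp_of_nat_mult)
      finally have "(1 + 1 / real N) ^ N * (5 / N) \<le> exp 1 * (5 / N)" by (intro mult_right_mono) auto
      moreover have "4 / real N \<ge> 0" by simp
      moreover have e: "real N / real N = 1" using elim by simp
      ultimately show ?case using w_euler_error[OF elim y order_refl] unfolding e real_norm_def by linarith
    qed
  qed
  from tendsto_add[OF this tendsto_const[of "w_flow y 1"]]
  have "(\<lambda>N. w_euler y N N) \<longlonglongrightarrow> w_flow y 1" by simp
  moreover have "w_flow y 1 = y * T0_inv (ln (y\<^sup>2 / (y\<^sup>2 - 2)) / 2)"
  proof -
    have "u_flow y 1 = y" "u_flow y 0 = sqrt (y\<^sup>2 - 2)" using y by (simp_all add: u_flow_def)
    moreover have "ln (y / sqrt (y\<^sup>2 - 2)) = ln (y\<^sup>2 / (y\<^sup>2 - 2)) / 2"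
      using y y2 by (simp add: ln_div ln_sqrt ln_realpow)
    ultimately show ?thesis by (simp only: w_flow_def)
  qed
  ultimately show ?thesis by simp
qed

text \<open>Both Euler schemes are the denominators of the tree recursion, y minus averaged partial
  sums of a and b. Every node except the root carries -\<lambda>, so the choice z = y + \<lambda>
  removes \<lambda> from the recursion and leaves it only in the root denominator
  \<open>\<lambda> + w_euler y N N\<close>.\<close>

lemma vacuum_moments_sums:
  assumes N: "N \<ge> 1" and y: "y \<ge> 4" and lam: "lam \<ge> 0"
  shows "(\<lambda>n. vacuum_state (S_op lam N ^^ n) / of_real (y + lam) ^ Suc n) sums of_real (1 / (lam + w_euler y N N))"
proof -
  define b where "b = (\<lambda>i. 1 / u_euler y N (N - i))"
  \<comment> \<open>The denominator for letter i omits i from both sums. \<open>w_euler\<close> at i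
    - 1 still has i among the larger letters, so its share \<open>b i / N\<close> is added
    back.\<close>
  define a where "a = (\<lambda>i. 1 / (w_euler y N (i - 1) + b i / N))"
  have U: "u_euler y N k = y - (\<Sum>j\<in>{N - k<..N}. b j) / N" if "k \<le> N" for k
    using that
  proof (induction k)
    case (Suc k)
    have "{N - Suc k<..N} = insert (N - k) {N - k<..N}" using Suc.prems by auto
    then have "(\<Sum>j\<in>{N - Suc k<..N}. b j) = b (N - k) + (\<Sum>j\<in>{N - k<..N}. b j)" by simp
    moreover have "b (N - k) = 1 / u_euler y N k" using Suc.prems by (simp add: b_def)
    ultimately show ?case using Suc by (simp add: add_divide_distrib)
  qed simp
  have W: "w_euler y N i = y - ((\<Sum>j\<in>{1..i}. a j) + (\<Sum>j\<in>{i<..N}. b j)) / N" if "i \<le> N" for i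
    using that
  proof (induction i)
    case 0
    then show ?case using U[of N] by simp
  next
    case (Suc i)
    have "{i<..N} = insert (Suc i) {Suc i<..N}" using Suc.prems by auto
    then have "(\<Sum>j\<in>{i<..N}. b j) = b (Suc i) + (\<Sum>j\<in>{Suc i<..N}. b j)" by simp
    moreover have "w_euler y N (Suc i) = w_euler y N i + b (Suc i) / N - a (Suc i) / N"
      by (simp add: a_def b_def mult.commute)
    ultimately show ?case using Suc by (simp add: add_divide_distrib)
  qed
  have b1: "0 < b i \<and> b i \<le> 1" for i using u_euler_lower(2)[OF N y, of "N - i"] by (simp add: b_def)
  have v1: "1 \<le> w_euler y N (i - 1) + b i / N" if "i \<in> {1..N}" for i
  proof -
    have "w_euler y N (i - 1) \<ge> 2" using that by (intro w_euler_lower N y) auto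
    moreover have "b i / N \<ge> 0" using b1[of i] by simp
    ultimately show ?thesis by linarith
  qed
  define G where "G = 1 / (lam + w_euler y N N)"
  have WN: "w_euler y N N \<ge> 2" by (rule w_euler_lower[OF N y order_refl])
  have A: "a i * (y + lam - lam - ((\<Sum>j\<in>{1..<i}. a j) + (\<Sum>j\<in>{i<..N}. b j)) / N) = 1" if i: "i \<in> {1..N}" for i
  proof -
    have "{i - 1<..N} = insert i {i<..N}" using i by auto
    then have "(\<Sum>j\<in>{i - 1<..N}. b j) = b i + (\<Sum>j\<in>{i<..N}. b j)" by simp
    moreover have "{1..i - 1} = {1..<i}" using i by auto
    ultimately have "w_euler y N (i - 1) = y - ((\<Sum>j\<in>{1..<i}. a j) + (b i + (\<Sum>j\<in>{i<..N}. b j))) / N"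
      using W[of "i - 1"] i by auto
    then have "y + lam - lam - ((\<Sum>j\<in>{1..<i}. a j) + (\<Sum>j\<in>{i<..N}. b j)) / N = w_euler y N (i - 1) + b i / N"
      by (simp add: add_divide_distrib)
    then show ?thesis using v1[OF i] by (simp add: a_def)
  qed
  have B: "b i * (y + lam - lam - (\<Sum>j\<in>{i<..N}. b j) / N) = 1" if i: "i \<in> {1..N}" for i
  proof -
    have "N - (N - i) = i" using i by auto
    then have "u_euler y N (N - i) = y - (\<Sum>j\<in>{i<..N}. b j) / N" using U[of "N - i"] by simp
    then show ?thesis using u_euler_lower(2)[OF N y, of "N - i"] by (simp add: b_def)
  qed
  have G: "G * (y + lam - (\<Sum>j\<in>{1..N}. a j) / N) = 1"
    using W[of N] WN lam by (simp add: G_def)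
  define psi where "psi = (\<lambda>w. complex_of_real (if V_word w \<and> set w \<subseteq> {1..N} then tree_resolvent (1 / sqrt N) a b G w else 0))"
  have "(\<lambda>n. vacuum_state (S_op lam N ^^ n) / of_real (y + lam) ^ Suc n) sums psi []"
  proof (rule resolvent_sums[OF N lam])
    have "cmod (of_real (y + lam)) = y + lam" using y lam by (simp only: norm_of_real)
    then show "2 + lam < cmod (of_real (y + lam))" using y lam by simp
    show "of_real (y + lam) * psi w - S_op lam N psi w = vacuum w" for w
      unfolding psi_def by (rule S_op_tree_resolvent[OF N A B G])
    show "cmod (psi w) \<le> \<bar>G\<bar> * (1 / sqrt (real N)) ^ length w" for w
    proof (cases "V_word w \<and> set w \<subseteq> {1..N}")
      case True
      have "\<bar>tree_resolvent (1 / sqrt N) a b G w\<bar> \<le> \<bar>G\<bar> * (1 / sqrt (real N)) ^ length w"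
      proof (rule tree_resolvent_bound)
        show "set w \<subseteq> {1..N}" using True by simp
        show "\<bar>a i\<bar> \<le> 1" if "i \<in> {1..N}" for i using v1[OF that] by (simp add: a_def)
        show "\<bar>b i\<bar> \<le> 1" for i using b1[of i] by simp
      qed simp
      then show ?thesis using True by (simp add: psi_def)
    qed (auto simp: psi_def)
  qed
  then show ?thesis by (simp add: psi_def V_word_Nil G_def)
qed

text \<open>Induction on k. After removal of the lower terms, which tend to 0 by induction, and
  division by \<open>x ^ k\<close>, the series is \<open>d N k\<close> plus a tail of order x,
  uniformly in N because of the geometric bound. So x is fixed first, according to e, and N is
  chosen afterwards.\<close>

lemma power_series_coeff_tendsto_0:
  fixes d :: "nat \<Rightarrow> nat \<Rightarrow> complex"
  assumes C: "C > 0" and x0: "x0 > 0" and bd: "\<And>N j. N \<ge> 1 \<Longrightarrow> cmod (d N j) \<le> B * C ^ j"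
    and lim: "\<And>x. 0 < x \<Longrightarrow> x < x0 \<Longrightarrow> (\<lambda>N. \<Sum>j. d N j * of_real x ^ j) \<longlonglongrightarrow> 0"
  shows "(\<lambda>N. d N k) \<longlonglongrightarrow> 0"
proof (induction k rule: less_induct)
  case (less k)
  have B: "B \<ge> 0" using bd[of 1 0] norm_ge_zero[of "d 1 0"] by (simp del: norm_ge_zero)
  show ?case
  proof (rule LIMSEQ_I)
    fix e :: real assume e: "e > 0"
    \<comment> \<open>For \<open>C * x \<le> 1 / 2\<close> the terms beyond k add up to at most
      \<open>M * x * x ^ k\<close>; the summand 1 only makes M positive.\<close>
    define M where "M = 2 * B * C ^ Suc k + 1"
    have M: "M > 0" using B C by (simp add: M_def add_nonneg_pos)
    define x where "x = min (x0 / 2) (min (1 / (2 * C)) (e / (2 * M)))"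
    have x: "0 < x" "x < x0" "C * x \<le> 1 / 2" "M * x \<le> e / 2"
    proof -
      show "0 < x" "x < x0" using x0 C e M by (auto simp: x_def min_def)
      have "x \<le> 1 / (2 * C)" "x \<le> e / (2 * M)" by (auto simp: x_def)
      then show "C * x \<le> 1 / 2" "M * x \<le> e / 2" using C M by (simp_all add: field_simps)
    qed
    have "(\<lambda>N. (\<Sum>j. d N j * of_real x ^ j) - (\<Sum>j<k. d N j * of_real x ^ j)) \<longlonglongrightarrow> 0 - (\<Sum>j<k. 0 * of_real x ^ j)"
      by (intro tendsto_diff tendsto_sum tendsto_mult lim x less tendsto_const) auto
    then have "(\<lambda>N. (\<Sum>j. d N j * of_real x ^ j) - (\<Sum>j<k. d N j * of_real x ^ j)) \<longlonglongrightarrow> 0" by simp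
    from LIMSEQ_D[OF this, of "e / 2 * x ^ k"] obtain no where no:
      "\<And>N. N \<ge> no \<Longrightarrow> cmod ((\<Sum>j. d N j * of_real x ^ j) - (\<Sum>j<k. d N j * of_real x ^ j)) < e / 2 * x ^ k"
      using e x(1) by auto
    show "\<exists>no. \<forall>N\<ge>no. norm (d N k - 0) < e"
    proof (intro exI allI impI)
      fix N assume N: "max 1 no \<le> N"
      define g where "g = (\<lambda>j. d N j * of_real x ^ j)"
      have gb: "cmod (g j) \<le> B * (C * x) ^ j" for j
      proof -
        have "cmod (g j) = cmod (d N j) * x ^ j" using x by (simp add: g_def norm_mult norm_power)
        also have "\<dots> \<le> B * C ^ j * x ^ j" using bd[of N j] N x by (intro mult_right_mono) auto
        finally show ?thesis by (simp add: power_mult_distrib mult_ac)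
      qed
      have Cx: "0 < C * x" "C * x < 1" using x C by auto
      have sgeo: "summable (\<lambda>j. B * (C * x) ^ j)" using Cx by (intro summable_mult summable_geometric) auto
      have sg: "summable g" by (rule summable_comparison_test[OF _ sgeo]) (use gb in auto)
      have "suminf g = (\<Sum>j. g (j + Suc k)) + (\<Sum>j<Suc k. g j)" by (rule suminf_split_initial_segment[OF sg])
      then have gk: "g k = (suminf g - (\<Sum>j<k. g j)) - (\<Sum>j. g (j + Suc k))" by simp
      have "cmod (\<Sum>j. g (j + Suc k)) \<le> (\<Sum>j. B * (C * x) ^ Suc k * (C * x) ^ j)"
      proof (rule norm_suminf_le)
        show "cmod (g (j + Suc k)) \<le> B * (C * x) ^ Suc k * (C * x) ^ j" for j
          using gb[of "j + Suc k"] by (simp add: power_add mult_ac)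
        show "summable (\<lambda>j. B * (C * x) ^ Suc k * (C * x) ^ j)"
          using Cx by (intro summable_mult summable_geometric) auto
      qed
      also have "\<dots> = B * (C * x) ^ Suc k * (1 / (1 - C * x))"
        using Cx by (subst suminf_mult) (auto simp: suminf_geometric summable_geometric)
      also have "\<dots> \<le> B * (C * x) ^ Suc k * 2"
        using B Cx x C by (intro mult_left_mono) (auto simp: field_simps)
      also have "\<dots> = (2 * B * C ^ Suc k) * x * x ^ k" by (simp add: power_mult_distrib mult_ac)
      also have "\<dots> \<le> (M * x) * x ^ k" using x by (intro mult_right_mono) (auto simp: M_def)
      also have "\<dots> \<le> e / 2 * x ^ k" using x by (intro mult_right_mono) auto
      finally have tail: "cmod (\<Sum>j. g (j + Suc k)) \<le> e / 2 * x ^ k" .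
      have "cmod (d N k) * x ^ k = cmod (g k)" using x by (simp add: g_def norm_mult norm_power)
      also have "\<dots> \<le> cmod (suminf g - (\<Sum>j<k. g j)) + cmod (\<Sum>j. g (j + Suc k))"
        unfolding gk by (rule norm_triangle_ineq4)
      also have "\<dots> < e / 2 * x ^ k + e / 2 * x ^ k" using no[of N] N tail by (simp add: g_def)
      also have "\<dots> = e * x ^ k" by simp
      finally show "norm (d N k - 0) < e" using x by simp
    qed
  qed
qed

section \<open>The closed upper half-plane\<close>

definition upper_half :: "complex set" where "upper_half = {z. 0 \<le> Im z}"

definition K_upper :: "complex \<Rightarrow> complex" where
  "K_upper z = (if 0 \<le> Re z then K_quad z else - cnj (K_quad (- cnj z)))"

lemma Gfun_eq: "z \<in> upper_half \<Longrightarrow> Gfun z = 1 / K_upper z"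
  using G_right_eq[of z] G_right_eq[of "- cnj z"]
  by (auto simp: Gfun_def K_upper_def upper_half_def quadrant_def)

lemma K_upper_mirror: "z \<in> upper_half \<Longrightarrow> Re z \<le> 0 \<Longrightarrow> K_upper z = - cnj (K_quad (- cnj z))"
proof (cases "Re z = 0")
  case True
  assume z: "z \<in> upper_half"
  have e: "- cnj z = z" using True by (simp add: complex_eq_iff)
  have "Re (K_quad z) = 0" using z True by (intro K_quad_imag) (auto simp: upper_half_def quadrant_def)
  then show ?thesis using True unfolding e by (simp add: K_upper_def complex_eq_iff)
qed (auto simp: K_upper_def)

lemma K_upper_continuous: "continuous_on upper_half K_upper"
proof -
  have "continuous_on {z. Re z \<le> 0 \<and> 0 \<le> Im z} (\<lambda>z. - cnj (K_quad (- cnj z)))"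
    by (intro continuous_intros continuous_on_compose2[OF K_quad_continuous]) (auto simp: quadrant_def)
  moreover have "closed {z. Re z \<le> 0 \<and> 0 \<le> Im z}" "closed quadrant"
    unfolding quadrant_def by (intro closed_Collect_conj closed_Collect_le continuous_intros)+
  ultimately have "continuous_on (quadrant \<union> {z. Re z \<le> 0 \<and> 0 \<le> Im z})
      (\<lambda>z. if 0 \<le> Re z then K_quad z else - cnj (K_quad (- cnj z)))"
  proof (intro continuous_on_cases K_quad_continuous)
    show "\<forall>z. z \<in> quadrant \<and> \<not> 0 \<le> Re z \<or> z \<in> {z. Re z \<le> 0 \<and> 0 \<le> Im z} \<and> 0 \<le> Re z \<longrightarrow> K_quad z = - cnj (K_quad (- cnj z))"
    proof (intro allI impI)
      fix z assume "z \<in> quadrant \<and> \<not> 0 \<le> Re z \<or> z \<in> {z. Re z \<le> 0 \<and> 0 \<le> Im z} \<and> 0 \<le> Re z"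
      then have "Re z = 0" "z \<in> upper_half" by (auto simp: quadrant_def upper_half_def)
      then show "K_quad z = - cnj (K_quad (- cnj z))" using K_upper_mirror[of z] by (simp add: K_upper_def)
    qed
  qed auto
  moreover have "quadrant \<union> {z. Re z \<le> 0 \<and> 0 \<le> Im z} = upper_half" by (auto simp: quadrant_def upper_half_def)
  ultimately show ?thesis by (simp only: K_upper_def[abs_def])
qed

text \<open>A reflection argument: the function is holomorphic on either side of the imaginary axis
  and continuous across it, so the axis is removable. Continuity there rests on
  \<open>K_quad_imag\<close>.\<close>

lemma K_upper_holomorphic: "K_upper holomorphic_on {z. 0 < Im z}"
proof (rule holomorphic_on_paste_across_line[of _ 1 _ 0])
  show o: "open {z. 0 < Im z}" by (rule open_halfspace_Im_gt)
  show "continuous_on {z. 0 < Im z} K_upper"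
    by (rule continuous_on_subset[OF K_upper_continuous]) (auto simp: upper_half_def)
  have e: "(1::complex) \<bullet> z = Re z" for z by (simp add: inner_complex_def)
  have K_quad: "K_quad holomorphic_on {z. 0 < Re z \<and> 0 < Im z}"
    unfolding holomorphic_on_def using K_quad_differentiable field_differentiable_at_within by blast
  show "K_upper holomorphic_on {z. 0 < Im z} \<inter> {z. 0 < 1 \<bullet> z}"
    unfolding e by (rule holomorphic_transform[OF holomorphic_on_subset[OF K_quad]]) (auto simp: K_upper_def)
  have "(K_quad \<circ> uminus) holomorphic_on {z. Re z < 0 \<and> Im z < 0}"
    by (rule holomorphic_on_compose_gen[OF _ K_quad]) (auto intro!: holomorphic_intros)
  then have "(\<lambda>z. K_quad (- z)) holomorphic_on {z. Re z < 0 \<and> Im z < 0}" by (simp add: o_def)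
  then have "(\<lambda>z. K_quad (- z)) holomorphic_on cnj ` {z. Re z < 0 \<and> 0 < Im z}"
    by (rule holomorphic_on_subset) auto
  moreover have "open {z. Re z < 0 \<and> 0 < Im z}"
    by (intro open_Collect_conj open_Collect_less continuous_intros)
  ultimately have "(\<lambda>z. cnj (K_quad (- cnj z))) holomorphic_on {z. Re z < 0 \<and> 0 < Im z}"
    using holomorphic_on_compose_cnj_cnj by (fastforce simp: o_def)
  then have "(\<lambda>z. - cnj (K_quad (- cnj z))) holomorphic_on {z. Re z < 0 \<and> 0 < Im z}"
    by (rule holomorphic_on_minus)
  then show "K_upper holomorphic_on {z. 0 < Im z} \<inter> {z. 1 \<bullet> z < 0}"
    unfolding e by (rule holomorphic_transform[OF holomorphic_on_subset]) (auto simp: K_upper_def)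
qed simp

definition edge :: real where "edge = sqrt (2 + gamma0)"

definition r_outer :: "real \<Rightarrow> real" where "r_outer x = T0_inv (ln (x\<^sup>2 / (x\<^sup>2 - 2)) / 2)"

lemma edge_gt: "edge > sqrt 2" "edge > 0"
  using gamma0_pos by (auto simp: edge_def)

lemma K_upper_real:
  shows "\<bar>x\<bar> < edge \<Longrightarrow> Im (K_upper (of_real x)) > 0"
    and "\<bar>x\<bar> \<ge> edge \<Longrightarrow> K_upper (of_real x) = of_real (x * r_outer x)"
    and "\<bar>x\<bar> \<ge> edge \<Longrightarrow> r_outer x \<ge> 0"
    and "\<bar>x\<bar> > edge \<Longrightarrow> r_outer x > 0"
    and "\<bar>x\<bar> = edge \<Longrightarrow> K_upper (of_real x) = 0"
proof -
  have m: "K_upper (of_real x) = (if 0 \<le> x then K_quad (of_real \<bar>x\<bar>) else - cnj (K_quad (of_real \<bar>x\<bar>)))"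
    by (simp add: K_upper_def)
  have r: "r_outer \<bar>x\<bar> = r_outer x" by (simp add: r_outer_def)
  show "\<bar>x\<bar> < edge \<Longrightarrow> Im (K_upper (of_real x)) > 0"
    using Im_K_quad_inner[of "\<bar>x\<bar>"] unfolding m by (cases "0 \<le> x") (auto simp: edge_def)
  show "\<bar>x\<bar> \<ge> edge \<Longrightarrow> K_upper (of_real x) = of_real (x * r_outer x)"
    using K_quad_outer(1)[of "\<bar>x\<bar>", folded r_outer_def] unfolding m r by (cases "0 \<le> x") (auto simp: edge_def)
  show "\<bar>x\<bar> \<ge> edge \<Longrightarrow> r_outer x \<ge> 0"
    using K_quad_outer(2)[of "\<bar>x\<bar>", folded r_outer_def] unfolding r by (simp add: edge_def)
  show "\<bar>x\<bar> > edge \<Longrightarrow> r_outer x > 0"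
    using K_quad_outer(3)[of "\<bar>x\<bar>", folded r_outer_def] unfolding r by (simp add: edge_def)
  show "\<bar>x\<bar> = edge \<Longrightarrow> K_upper (of_real x) = 0"
    using K_quad_outer(4)[of "\<bar>x\<bar>"] unfolding m by (cases "0 \<le> x") (auto simp: edge_def)
qed

lemma Im_K_upper_real_nonneg: "Im (K_upper (of_real x)) \<ge> 0"
  using K_upper_real(1,2)[of x] by (cases "\<bar>x\<bar> < edge") auto

lemma K_upper_asymp: "\<exists>C R. C \<ge> 0 \<and> R \<ge> 1 \<and> (\<forall>z\<in>upper_half. cmod z \<ge> R \<longrightarrow> cmod (K_upper z - z) \<le> C / cmod z)"
proof -
  obtain C R where CR: "\<forall>z\<in>quadrant. cmod z \<ge> R \<longrightarrow> cmod (K_quad z - z) \<le> C / cmod z" using K_quad_asymp by blast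
  have "cmod (K_upper z - z) \<le> max C 0 / cmod z" if z: "z \<in> upper_half" "cmod z \<ge> max R 1" for z
  proof (cases "0 \<le> Re z")
    case True
    then have "cmod (K_upper z - z) \<le> C / cmod z" using CR z by (auto simp: K_upper_def upper_half_def quadrant_def)
    also have "\<dots> \<le> max C 0 / cmod z" by (intro divide_right_mono) auto
    finally show ?thesis .
  next
    case False
    then have "cmod (K_quad (- cnj z) - (- cnj z)) \<le> C / cmod (- cnj z)"
      using CR[rule_format, of "- cnj z"] z by (auto simp: upper_half_def quadrant_def simp del: diff_minus_eq_add)
    also have "\<dots> \<le> max C 0 / cmod z" by (simp add: divide_right_mono)
    also have "cmod (K_quad (- cnj z) - (- cnj z)) = cmod (K_upper z - z)"
    proof -
      have "K_upper z - z = - cnj (K_quad (- cnj z) - (- cnj z))" using False by (simp add: K_upper_def)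
      then show ?thesis by (simp only: norm_minus_cancel complex_mod_cnj)
    qed
    finally show ?thesis .
  qed
  then show ?thesis by (intro exI[of _ "max C 0"] exI[of _ "max R 1"]) auto
qed

text \<open>Maximum principle for \<open>\<i> (K_upper z - z)\<close>, whose real part is nonpositive on the real axis and
  tends to 0 at infinity.\<close>

lemma Im_K_upper_ge:
  assumes "Im z > 0" shows "Im (K_upper z) \<ge> Im z"
proof -
  obtain C R where CR: "C \<ge> 0" "R \<ge> 1" "\<And>z. z \<in> upper_half \<Longrightarrow> cmod z \<ge> R \<Longrightarrow> cmod (K_upper z - z) \<le> C / cmod z"
    using K_upper_asymp by blast
  have bound: "Im z - Im (K_upper z) \<le> C / \<rho>" if \<rho>: "\<rho> > max R (cmod z)" for \<rho>
  proof -
    define S where "S = {w. 0 < Im w} \<inter> ball 0 \<rho>"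
    have oS: "open S" unfolding S_def by (intro open_Int open_halfspace_Im_gt open_ball)
    have clS: "closure S \<subseteq> upper_half \<inter> cball 0 \<rho>"
    proof (rule closure_minimal)
      show "closed (upper_half \<inter> cball 0 \<rho>)"
        unfolding upper_half_def by (intro closed_Int closed_Collect_le continuous_intros closed_cball)
    qed (auto simp: S_def upper_half_def)
    have "Re (\<i> * (K_upper z - z)) \<le> C / \<rho>"
    proof (rule maximum_real_frontier[of "\<lambda>z. \<i> * (K_upper z - z)" S])
      show "(\<lambda>z. \<i> * (K_upper z - z)) holomorphic_on interior S"
        unfolding interior_open[OF oS]
        by (intro holomorphic_intros holomorphic_on_subset[OF K_upper_holomorphic]) (auto simp: S_def)
      show "continuous_on (closure S) (\<lambda>z. \<i> * (K_upper z - z))"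
        using clS by (intro continuous_intros continuous_on_subset[OF K_upper_continuous]) auto
      show "bounded S" unfolding S_def by (rule bounded_subset[OF bounded_ball]) auto
      show "z \<in> S" using assms \<rho> by (simp add: S_def)
      fix w assume "w \<in> frontier S"
      then have w: "w \<in> upper_half" "cmod w \<le> \<rho>" "w \<notin> S"
        using clS interior_open[OF oS] by (auto simp: frontier_def)
      show "Re (\<i> * (K_upper w - w)) \<le> C / \<rho>"
      proof (cases "cmod w < \<rho>")
        case True
        then have "Im w = 0" using w by (auto simp: S_def upper_half_def)
        then have "w = of_real (Re w)" by (simp add: complex_eq_iff)
        then have "Im (K_upper w) \<ge> 0" using Im_K_upper_real_nonneg[of "Re w"] by simp
        moreover have "C / \<rho> \<ge> 0" using CR \<rho> by simp
        ultimately show ?thesis using \<open>Im w = 0\<close> by simp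
      next
        case False
        then have wr: "cmod w = \<rho>" using w by simp
        have "Re (\<i> * (K_upper w - w)) \<le> cmod (\<i> * (K_upper w - w))" by (rule complex_Re_le_cmod)
        also have "\<dots> \<le> C / \<rho>" using CR(3)[OF w(1)] wr \<rho> by (simp add: norm_mult)
        finally show ?thesis .
      qed
    qed
    then show ?thesis by simp
  qed
  have "Im z - Im (K_upper z) \<le> 0"
  proof (rule tendsto_lowerbound)
    show "((\<lambda>\<rho>. C / \<rho>) \<longlongrightarrow> 0) at_top" by real_asymp
    show "eventually (\<lambda>\<rho>. Im z - Im (K_upper z) \<le> C / \<rho>) at_top"
      using eventually_gt_at_top[of "max R (cmod z)"] by eventually_elim (rule bound)
  qed simp
  then show ?thesis by simp
qed

text \<open>Beyond the edge l lies on the axis strictly below the fold, so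
  \<open>K_quad_local\<close> applies and K continues across the real line. Negative y follow by
  reflection, under which the derivative, a real and even expression in y, is unchanged.\<close>

lemma K_upper_local:
  assumes "\<bar>y\<bar> > edge"
  shows "\<exists>e>0. \<exists>f. f holomorphic_on ball (of_real y) e \<and> (\<forall>z\<in>ball (of_real y) e \<inter> upper_half. K_upper z = f z) \<and>
     (f has_field_derivative of_real (r_outer y + 2 * ((r_outer y)\<^sup>2 - r_outer y + 1) / (r_outer y * (y\<^sup>2 - 2)))) (at (of_real y))"
proof -
  have *: "\<exists>e>0. \<exists>f. f holomorphic_on ball (of_real y) e \<and> (\<forall>z\<in>ball (of_real y) e \<inter> upper_half. K_quad z = f z \<and> Re z > 0) \<and>
     (f has_field_derivative of_real (r_outer y + 2 * ((r_outer y)\<^sup>2 - r_outer y + 1) / (r_outer y * (y\<^sup>2 - 2)))) (at (of_real y))"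
    if y: "y > edge" for y
  proof -
    have y2: "y > sqrt 2" "y > 0" using y edge_gt by linarith+
    have W: "W_quad (of_real y) \<noteq> of_real (sqrt 3 * pi / 9)"
      using outer_iff(4)[OF y2(1)] y unfolding W_quad_outer(2)[OF y2(1)] edge_def by (metis less_irrefl of_real_eq_iff)
    obtain e f where ef: "e > 0" "f holomorphic_on ball (of_real y) e"
      "\<And>z. z \<in> ball (of_real y) e \<inter> quadrant \<Longrightarrow> K_quad z = f z"
      "\<And>r. r = f (of_real y) / of_real y \<Longrightarrow>
        (f has_field_derivative r + 2 * (r\<^sup>2 - r + 1) / (r * ((of_real y)\<^sup>2 - 2))) (at (of_real y))"
      using K_quad_local[OF W_quad_outer(1)[OF y2(1)] W] by metis
    have "f (of_real y) = K_quad (of_real y)" using ef(1) y2 by (intro ef(3)[symmetric]) (auto simp: quadrant_def)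
    also have "\<dots> = of_real (y * r_outer y)" using K_quad_outer(1)[of y] y by (simp add: edge_def r_outer_def)
    finally have "of_real (r_outer y) = f (of_real y) / of_real y" using y2 by simp
    from ef(4)[OF this]
    have D: "(f has_field_derivative of_real (r_outer y + 2 * ((r_outer y)\<^sup>2 - r_outer y + 1) / (r_outer y * (y\<^sup>2 - 2)))) (at (of_real y))"
      by simp
    have sub: "ball (of_real y) (min e y) \<subseteq> ball (complex_of_real y) e" by auto
    have "Re z > 0" if "z \<in> ball (of_real y) (min e y)" for z
      using that abs_Re_le_cmod[of "of_real y - z"] by (auto simp: dist_norm)
    then have "\<forall>z\<in>ball (of_real y) (min e y) \<inter> upper_half. K_quad z = f z \<and> Re z > 0"
      using ef(3) by (force simp: upper_half_def quadrant_def)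
    then show ?thesis using ef(1) y2 holomorphic_on_subset[OF ef(2) sub] D
      by (intro exI[of _ "min e y"] conjI exI[of _ f]) auto
  qed
  show ?thesis
  proof (cases "y > 0")
    case True
    then obtain e f where ef: "e > 0" "f holomorphic_on ball (of_real y) e"
      "\<forall>z\<in>ball (of_real y) e \<inter> upper_half. K_quad z = f z \<and> Re z > 0"
      "(f has_field_derivative of_real (r_outer y + 2 * ((r_outer y)\<^sup>2 - r_outer y + 1) / (r_outer y * (y\<^sup>2 - 2)))) (at (of_real y))"
      using *[of y] assms by auto
    have "\<forall>z\<in>ball (of_real y) e \<inter> upper_half. K_upper z = f z"
    proof
      fix z assume "z \<in> ball (complex_of_real y) e \<inter> upper_half"
      then have "K_quad z = f z" "Re z > 0" using ef(3) by auto
      then show "K_upper z = f z" by (simp add: K_upper_def)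
    qed
    then show ?thesis using ef(1,2,4) by blast
  next
    case False
    define y' where "y' = - y"
    have y': "y' > edge" "r_outer y' = r_outer y" "y'\<^sup>2 = y\<^sup>2" using assms False by (auto simp: y'_def r_outer_def)
    obtain e f where ef: "e > 0" "f holomorphic_on ball (of_real y') e"
      "\<forall>z\<in>ball (of_real y') e \<inter> upper_half. K_quad z = f z \<and> Re z > 0"
      "(f has_field_derivative of_real (r_outer y + 2 * ((r_outer y)\<^sup>2 - r_outer y + 1) / (r_outer y * (y\<^sup>2 - 2)))) (at (of_real y'))"
      using *[OF y'(1)] unfolding y' by blast
    define D where "D = complex_of_real (r_outer y + 2 * ((r_outer y)\<^sup>2 - r_outer y + 1) / (r_outer y * (y\<^sup>2 - 2)))"
    define g where "g = (\<lambda>z. - cnj (f (- cnj z)))"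
    have ba: "- cnj z \<in> ball (of_real y') e \<longleftrightarrow> z \<in> ball (of_real y) e" for z
    proof -
      have "of_real y' - (- cnj z) = - cnj (of_real y - z)" by (simp add: y'_def)
      then have "cmod (of_real y' - (- cnj z)) = cmod (of_real y - z)" by (simp only: norm_minus_cancel complex_mod_cnj)
      then show ?thesis by (simp only: mem_ball dist_norm)
    qed
    have gd: "(g has_field_derivative cnj d) (at z)" if "(f has_field_derivative d) (at (- cnj z))" for d z
    proof -
      have "((\<lambda>w. f (- w)) has_field_derivative d * (- 1)) (at (cnj z))"
        by (rule DERIV_chain2[where f = f and g = uminus]) (use that in \<open>auto intro!: derivative_eq_intros\<close>)
      from has_field_derivative_cnj_cnj[OF this]
      have "((\<lambda>z. cnj (f (- cnj z))) has_field_derivative cnj (d * (- 1))) (at z)" by (simp add: o_def)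
      from DERIV_minus[OF this] show ?thesis by (simp add: g_def)
    qed
    have "g holomorphic_on ball (of_real y) e"
    proof (rule holomorphic_onI)
      fix z assume "z \<in> ball (complex_of_real y) e"
      then have "- cnj z \<in> ball (of_real y') e" by (simp only: ba)
      then obtain d where "(f has_field_derivative d) (at (- cnj z))"
        using ef(2) holomorphic_on_open[OF open_ball] by blast
      from gd[OF this] show "g field_differentiable at z within ball (of_real y) e"
        by (meson field_differentiable_at_within field_differentiable_def)
    qed
    moreover have "\<forall>z\<in>ball (of_real y) e \<inter> upper_half. K_upper z = g z"
    proof
      fix z assume z: "z \<in> ball (complex_of_real y) e \<inter> upper_half"
      then have "- cnj z \<in> ball (of_real y') e \<inter> upper_half" using ba[of z] by (auto simp: upper_half_def)
      from bspec[OF ef(3) this] have "K_quad (- cnj z) = f (- cnj z)" "Re (- cnj z) > 0" by blast+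
      then show "K_upper z = g z" by (simp add: K_upper_def g_def)
    qed
    moreover have "(g has_field_derivative D) (at (of_real y))"
    proof -
      have "(g has_field_derivative cnj D) (at (of_real y))"
        by (rule gd) (use ef(4) in \<open>simp add: D_def y'_def\<close>)
      then show ?thesis by (simp add: D_def)
    qed
    ultimately show ?thesis using ef(1) unfolding D_def by blast
  qed
qed

lemma interior_upper_half: "interior upper_half = {z. 0 < Im z}"
proof -
  have "upper_half = {z. \<i> \<bullet> z \<ge> 0}" by (auto simp: upper_half_def inner_complex_def)
  then show ?thesis using interior_halfspace_ge[of \<i> 0] by (simp add: inner_complex_def)
qed

lemma convex_upper_half: "convex upper_half"
  unfolding upper_half_def by (rule convex_halfspace_Im_ge)

text \<open>Cauchy's theorem for the difference quotient of h at y over a large half-disc; the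
  quotient is continuous up to the boundary, so no principal value arises. The arc contributes
  \<open>\<i> * pi * (1 - h y)\<close> in the limit. On the line the imaginary part of the quotient
  is the integrand, as h y is real, and it vanishes outside [-B, B].\<close>

lemma half_plane_cauchy:
  fixes h :: "complex \<Rightarrow> complex" and y B C R :: real and D :: complex
  assumes cont: "continuous_on upper_half h" and hol: "h holomorphic_on {z. 0 < Im z}"
    and as: "\<And>z. z \<in> upper_half \<Longrightarrow> cmod z \<ge> R \<Longrightarrow> cmod (h z - 1) \<le> C / cmod z"
    and der: "((\<lambda>z. (h z - h (of_real y)) / (z - of_real y)) \<longlongrightarrow> D) (at (of_real y) within upper_half)"
    and hy: "Im (h (of_real y)) = 0"
    and supp: "\<And>x. \<bar>x\<bar> \<ge> B \<Longrightarrow> Im (h (of_real x)) = 0" and B: "B \<ge> 0" "\<bar>y\<bar> > B"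
  shows "((\<lambda>x. Im (h (of_real x)) / (x - y)) has_integral pi * (Re (h (of_real y)) - 1)) {- B..B}"
proof -
  define hy' where "hy' = h (of_real y)"
  define f where "f = (\<lambda>x::real. Im (h (of_real x)) / (x - y))"
  define psi where "psi = (\<lambda>z. if z = of_real y then D else (h z - hy') / (z - of_real y))"
  have yU: "of_real y \<in> upper_half" by (simp add: upper_half_def)
  have psi_cont: "continuous_on upper_half psi"
    unfolding continuous_on_def
  proof
    fix z assume z: "z \<in> upper_half"
    show "(psi \<longlongrightarrow> psi z) (at z within upper_half)"
    proof (cases "z = of_real y")
      case True
      have "eventually (\<lambda>z. (h z - hy') / (z - of_real y) = psi z) (at (of_real y) within upper_half)"
        unfolding eventually_at by (intro exI[of _ 1]) (auto simp: psi_def)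
      from Lim_transform_eventually[OF der[folded hy'_def] this] show ?thesis by (simp add: True psi_def)
    next
      case False
      have "(h \<longlongrightarrow> h z) (at z within upper_half)" using cont z by (simp add: continuous_on_def)
      then have "((\<lambda>z. (h z - hy') / (z - of_real y)) \<longlongrightarrow> (h z - hy') / (z - of_real y)) (at z within upper_half)"
        using False by (intro tendsto_intros) auto
      moreover have "eventually (\<lambda>w. (h w - hy') / (w - of_real y) = psi w) (at z within upper_half)"
        unfolding eventually_at using False
        by (intro exI[of _ "dist z (of_real y)"]) (auto simp: psi_def dist_commute)
      ultimately have "(psi \<longlongrightarrow> (h z - hy') / (z - of_real y)) (at z within upper_half)"
        by (rule Lim_transform_eventually)
      then show ?thesis using False by (simp add: psi_def)
    qed
  qed
  have psi_hol: "psi field_differentiable at z" if "z \<in> interior upper_half - {}" for z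
  proof -
    have z: "Im z > 0" using that by (simp add: interior_upper_half)
    have "(\<lambda>z. (h z - hy') / (z - of_real y)) holomorphic_on {z. 0 < Im z}"
      by (intro holomorphic_intros hol) auto
    then have "psi holomorphic_on {z. 0 < Im z}" by (rule holomorphic_transform) (auto simp: psi_def)
    then show ?thesis using z open_halfspace_Im_gt[of 0] by (auto intro: holomorphic_on_imp_differentiable_at)
  qed
  have fc: "continuous_on {- B..B} f"
    unfolding f_def using B
    by (intro continuous_intros continuous_on_compose2[OF cont]) (auto simp: upper_half_def)
  define J where "J = integral {- B..B} f"
  have fJ: "(f has_integral J) {- B..B}"
    unfolding J_def using integrable_continuous_interval[OF fc] by (rule integrable_integral)
  \<comment> \<open>Bounds the numerator \<open>(h z - 1) * z + (1 - h y) * y\<close> that remains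
    when \<open>1 - h y\<close> is subtracted from \<open>psi z * z\<close> on the arc.\<close>
  define E where "E = max C 0 + cmod (1 - hy') * \<bar>y\<bar>"
  have main: "\<bar>J - pi * (Re hy' - 1)\<bar> \<le> E * pi / (\<rho> - \<bar>y\<bar>)" if \<rho>: "\<rho> > max R \<bar>y\<bar>" for \<rho>
  proof -
    have \<rho>0: "\<rho> > 0" "\<rho> > \<bar>y\<bar>" "\<rho> \<ge> R" "\<rho> > B" using \<rho> B by auto
    define g where "g = linepath (- of_real \<rho>) (of_real \<rho>) +++ part_circlepath 0 \<rho> 0 pi"
    have ps: "pathstart (part_circlepath 0 \<rho> 0 pi) = of_real \<rho>" "pathfinish (part_circlepath 0 \<rho> 0 pi) = - of_real \<rho>"
      by simp_all
    have path1: "path_image (part_circlepath 0 \<rho> 0 pi) \<subseteq> upper_half"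
      using \<rho>0 by (auto simp: path_image_part_circlepath upper_half_def Im_exp intro!: mult_nonneg_nonneg sin_ge_zero)
    have path2: "path_image (linepath (- of_real \<rho>) (of_real \<rho>)) \<subseteq> upper_half"
      unfolding path_image_linepath by (rule closed_segment_subset[OF _ _ convex_upper_half]) (auto simp: upper_half_def)
    have "(psi has_contour_integral 0) g"
    proof (rule Cauchy_theorem_convex[OF psi_cont convex_upper_half finite.emptyI psi_hol])
      show "valid_path g" unfolding g_def by (rule valid_path_join) (auto simp: ps)
      show "path_image g \<subseteq> upper_half" unfolding g_def using path1 path2 by (subst path_image_join) (auto simp: ps)
      show "pathfinish g = pathstart g" by (simp add: g_def ps)
    qed simp
    have ci1: "psi contour_integrable_on linepath (- of_real \<rho>) (of_real \<rho>)"
      by (rule contour_integrable_continuous_linepath)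
         (rule continuous_on_subset[OF psi_cont path2[unfolded path_image_linepath]])
    have ci2: "psi contour_integrable_on part_circlepath 0 \<rho> 0 pi"
      by (rule contour_integrable_continuous_part_circlepath[OF continuous_on_subset[OF psi_cont path1]])
    obtain I1 I2 where I1: "(psi has_contour_integral I1) (linepath (- of_real \<rho>) (of_real \<rho>))"
      and I2: "(psi has_contour_integral I2) (part_circlepath 0 \<rho> 0 pi)"
      using ci1 ci2 by (auto simp: contour_integrable_on_def)
    have "(psi has_contour_integral (I1 + I2)) g"
      unfolding g_def by (rule has_contour_integral_join[OF I1 I2]) auto
    then have I12: "I1 + I2 = 0" using \<open>(psi has_contour_integral 0) g\<close> has_contour_integral_unique by blast
    have r1: "((\<lambda>x. psi (of_real x)) has_integral I1) {- \<rho>..\<rho>}"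
      using I1 \<rho>0 by (subst (asm) has_contour_integral_linepath_Reals_iff) auto
    from has_integral_linear[OF r1 bounded_linear_Im]
    have "((\<lambda>x. Im (psi (of_real x))) has_integral Im I1) {- \<rho>..\<rho>}" by (simp add: o_def)
    moreover have "Im (psi (of_real x)) = f x" if "x \<in> {- \<rho>..\<rho>} - {y}" for x
    proof -
      have "psi (of_real x) = (h (of_real x) - hy') / of_real (x - y)" using that by (simp add: psi_def)
      then show ?thesis using hy by (simp only: Im_divide_of_real) (simp add: f_def hy'_def)
    qed
    ultimately have "(f has_integral Im I1) {- \<rho>..\<rho>}"
      using has_integral_spike_finite_eq[of "{y}" "{- \<rho>..\<rho>}" f "\<lambda>x. Im (psi (of_real x))"] by auto
    moreover have "(f has_integral J) {- \<rho>..\<rho>}"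
      by (rule has_integral_on_superset[OF fJ]) (use \<rho>0 supp in \<open>auto simp: f_def\<close>)
    ultimately have J: "J = Im I1" using has_integral_unique by blast
    have r2: "((\<lambda>t. psi (0 + \<rho> * cis t) * \<rho> * \<i> * cis t) has_integral I2) {0..pi}"
      using I2 by (subst (asm) has_contour_integral_part_circlepath_iff) auto
    have c2: "((\<lambda>t::real. \<i> * (1 - hy')) has_integral (pi *\<^sub>R (\<i> * (1 - hy')))) {0..pi}"
      using has_integral_const_real[of "\<i> * (1 - hy')" 0 pi] by simp
    have "norm (I2 - pi *\<^sub>R (\<i> * (1 - hy'))) \<le> E / (\<rho> - \<bar>y\<bar>) * measure lborel {0..pi}"
    proof (rule has_integral_bound_real[OF _ _ has_integral_diff[OF r2 c2]])
      show "0 \<le> E / (\<rho> - \<bar>y\<bar>)" using \<rho>0 by (simp add: E_def)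
      show "norm (psi (0 + \<rho> * cis t) * \<rho> * \<i> * cis t - \<i> * (1 - hy')) \<le> E / (\<rho> - \<bar>y\<bar>)"
        if t: "t \<in> {0..pi} - {}" for t
      proof -
        define z where "z = of_real \<rho> * cis t"
        have z: "cmod z = \<rho>" "z \<in> upper_half" using \<rho>0 t by (auto simp: z_def norm_mult upper_half_def intro!: mult_nonneg_nonneg sin_ge_zero)
        have zy: "cmod (z - of_real y) \<ge> \<rho> - \<bar>y\<bar>" using norm_triangle_ineq2[of z "of_real y"] z by simp
        then have zy0: "z - of_real y \<noteq> 0" using \<rho>0 by auto
        have "psi (0 + \<rho> * cis t) * \<rho> * \<i> * cis t - \<i> * (1 - hy') = \<i> * (psi z * z - (1 - hy'))"
          by (simp add: z_def algebra_simps)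
        also have "psi z * z - (1 - hy') = ((h z - 1) * z + (1 - hy') * of_real y) / (z - of_real y)"
          using zy0 by (simp add: psi_def field_simps)
        also have "norm (\<i> * (((h z - 1) * z + (1 - hy') * of_real y) / (z - of_real y))) =
          cmod ((h z - 1) * z + (1 - hy') * of_real y) / cmod (z - of_real y)"
          by (simp add: norm_mult norm_divide)
        also have "\<dots> \<le> E / (\<rho> - \<bar>y\<bar>)"
        proof (rule frac_le)
          have "cmod ((h z - 1) * z) \<le> C / \<rho> * \<rho>"
            unfolding norm_mult z(1) using as[OF z(2)] z(1) \<rho>0 by (intro mult_right_mono) auto
          also have "\<dots> \<le> max C 0" using \<rho>0 by simp
          finally show "cmod ((h z - 1) * z + (1 - hy') * of_real y) \<le> E"
            unfolding E_def using norm_triangle_ineq[of "(h z - 1) * z" "(1 - hy') * of_real y"] by (simp add: norm_mult)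
          show "0 \<le> E" by (simp add: E_def)
        qed (use zy \<rho>0 in auto)
        finally show ?thesis .
      qed
    qed simp
    then have b: "cmod (I2 - pi *\<^sub>R (\<i> * (1 - hy'))) \<le> E * pi / (\<rho> - \<bar>y\<bar>)" by simp
    have "J - pi * (Re hy' - 1) = - Im (I2 - pi *\<^sub>R (\<i> * (1 - hy')))"
    proof -
      have "I1 = - I2" using I12 by (simp add: eq_neg_iff_add_eq_0)
      then show ?thesis unfolding J by (simp add: algebra_simps)
    qed
    then have "\<bar>J - pi * (Re hy' - 1)\<bar> \<le> cmod (I2 - pi *\<^sub>R (\<i> * (1 - hy')))"
      using abs_Im_le_cmod[of "I2 - pi *\<^sub>R (\<i> * (1 - hy'))"] by simp
    with b show ?thesis by linarith
  qed
  have "\<bar>J - pi * (Re hy' - 1)\<bar> \<le> 0"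
  proof (rule tendsto_lowerbound)
    show "((\<lambda>\<rho>. E * pi / (\<rho> - \<bar>y\<bar>)) \<longlongrightarrow> 0) at_top" by real_asymp
    show "eventually (\<lambda>\<rho>. \<bar>J - pi * (Re hy' - 1)\<bar> \<le> E * pi / (\<rho> - \<bar>y\<bar>)) at_top"
      using eventually_gt_at_top[of "max R \<bar>y\<bar>"] by eventually_elim (rule main)
  qed simp
  then have "J = pi * (Re hy' - 1)" by simp
  then show ?thesis using fJ by (simp add: f_def hy'_def)
qed

section \<open>Stieltjes representation\<close>

lemma r_outer_strict_mono:
  assumes "edge \<le> x" "x < y" shows "r_outer x < r_outer y"
proof (rule ccontr)
  assume "\<not> r_outer x < r_outer y"
  then have le: "r_outer y \<le> r_outer x" by simp
  have xs: "x > sqrt 2" "y > sqrt 2" using assms edge_gt by linarith+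
  define wx wy where "wx = ln (x\<^sup>2 / (x\<^sup>2 - 2)) / 2" and "wy = ln (y\<^sup>2 / (y\<^sup>2 - 2)) / 2"
  have w: "wx \<le> sqrt 3 * pi / 9" "wy \<le> sqrt 3 * pi / 9"
    using outer_iff(3)[OF xs(1)] outer_iff(3)[OF xs(2)] assms by (auto simp: wx_def wy_def edge_def)
  have T: "T0 (r_outer x) = wx" "T0 (r_outer y) = wy" "r_outer y \<ge> 0"
    using T0_T0_inv[OF w(1)] T0_T0_inv[OF w(2)] by (simp_all add: r_outer_def wx_def wy_def)
  have "wx \<le> wy"
    using T T0_strict_antimono[of "r_outer y" "r_outer x"] le by (cases "r_outer y = r_outer x") auto
  then have "ln (x\<^sup>2 / (x\<^sup>2 - 2)) \<le> ln (y\<^sup>2 / (y\<^sup>2 - 2))" by (simp add: wx_def wy_def)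
  then have le: "x\<^sup>2 / (x\<^sup>2 - 2) \<le> y\<^sup>2 / (y\<^sup>2 - 2)"
    using outer_iff(2)[OF xs(1)] outer_iff(2)[OF xs(2)] by (subst (asm) ln_le_cancel_iff) auto
  have "x\<^sup>2 < y\<^sup>2" using assms edge_gt(2) by (intro power_strict_mono) auto
  moreover have "x\<^sup>2 > 2" "y\<^sup>2 > 2" using outer_iff(1) xs by auto
  ultimately show False using le by (simp add: field_simps)
qed

text \<open>\<open>x * r_outer x\<close> increases strictly from 0 beyond the edge and is odd in x,
  so the value -\<lambda> is taken once, on the negative side; inside the edge K is not real. The
  mirrored solution s comes from the intermediate value theorem, with the upper end X justified by
  K(X) \<ge> X - C.\<close>

lemma K_upper_neg_real_unique:
  assumes "lam > 0"
  shows "\<exists>a. a < - edge \<and> (\<forall>x. K_upper (of_real x) = - of_real lam \<longleftrightarrow> x = a)"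
proof -
  obtain C R where CR: "C \<ge> 0" "R \<ge> 1" "\<And>z. z \<in> upper_half \<Longrightarrow> cmod z \<ge> R \<Longrightarrow> cmod (K_upper z - z) \<le> C / cmod z"
    using K_upper_asymp by blast
  define X where "X = max (max R edge) (lam + C)"
  have X: "X \<ge> R" "X \<ge> edge" "X \<ge> lam + C" "X \<ge> 1" using CR by (auto simp: X_def)
  have "continuous_on {edge..X} (\<lambda>x. Re (K_upper (of_real x)))"
    by (intro continuous_intros continuous_on_compose2[OF K_upper_continuous]) (auto simp: upper_half_def)
  moreover have "Re (K_upper (of_real edge)) \<le> lam" using K_upper_real(5)[of edge] edge_gt assms by simp
  moreover have "lam \<le> Re (K_upper (of_real X))"
  proof -
    have "cmod (K_upper (of_real X) - of_real X) \<le> C / cmod (of_real X)" using CR(3)[of "of_real X"] X by (auto simp: upper_half_def)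
    also have "\<dots> \<le> C" using X CR by (simp add: divide_le_eq mult_le_cancel_left1)
    finally have "\<bar>Re (K_upper (of_real X)) - X\<bar> \<le> C"
      using abs_Re_le_cmod[of "K_upper (of_real X) - of_real X"] by simp
    then show ?thesis using X by linarith
  qed
  ultimately obtain s where s: "edge \<le> s" "Re (K_upper (of_real s)) = lam"
    using IVT'[of "\<lambda>x. Re (K_upper (of_real x))" edge lam X] X by auto
  have sr: "s * r_outer s = lam" using K_upper_real(2)[of s] s edge_gt by simp
  have "s \<noteq> edge" using K_upper_real(5)[of edge] edge_gt s assms by auto
  then have s1: "s > edge" using s by simp
  have "K_upper (of_real x) = - of_real lam \<longleftrightarrow> x = - s" for x
  proof
    assume "x = - s"
    then have "K_upper (of_real x) = of_real ((- s) * r_outer (- s))" using K_upper_real(2)[of "- s"] s edge_gt by simp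
    also have "r_outer (- s) = r_outer s" by (simp add: r_outer_def)
    also have "of_real (- s * r_outer s) = - of_real (s * r_outer s)" by simp
    finally show "K_upper (of_real x) = - of_real lam" unfolding sr .
  next
    assume x: "K_upper (of_real x) = - of_real lam"
    then have "Im (K_upper (of_real x)) = 0" by simp
    then have xe: "\<bar>x\<bar> \<ge> edge" using K_upper_real(1)[of x] by fastforce
    then have "complex_of_real (x * r_outer x) = of_real (- lam)" using x K_upper_real(2)[of x] by simp
    then have xr: "x * r_outer x = - lam" by (simp only: of_real_eq_iff)
    have "x < 0"
    proof (rule ccontr)
      assume "\<not> x < 0"
      then have "x * r_outer x \<ge> 0" using K_upper_real(3)[OF xe] by simp
      then show False using xr assms by simp
    qed
    then have x': "edge \<le> - x" "(- x) * r_outer (- x) = lam" using xe xr by (auto simp: r_outer_def)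
    have mono: "p * r_outer p < q * r_outer q" if "edge \<le> p" "p < q" for p q
    proof -
      have "p * r_outer p \<le> p * r_outer q" using r_outer_strict_mono[OF that] that edge_gt by (intro mult_left_mono) auto
      also have "\<dots> < q * r_outer q" using r_outer_strict_mono[OF that] K_upper_real(3)[of p] that edge_gt
        by (intro mult_strict_right_mono) auto
      finally show ?thesis .
    qed
    have "- x = s" using mono[of "- x" s] mono[of s "- x"] x' s(1) sr by (metis less_irrefl linorder_cases)
    then show "x = - s" by simp
  qed
  then show ?thesis using s1 by (intro exI[of _ "- s"]) auto
qed

lemma a_lam_props:
  assumes "lam > 0"
  shows "a_lam lam < - edge" "K_upper (of_real x) = - of_real lam \<longleftrightarrow> x = a_lam lam"
proof -
  obtain a where a: "a < - edge" "\<And>x. K_upper (of_real x) = - of_real lam \<longleftrightarrow> x = a"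
    using K_upper_neg_real_unique[OF assms] by blast
  have G: "Gfun (of_real x) = 1 / K_upper (of_real x)" for x by (rule Gfun_eq) (simp add: upper_half_def)
  have eq: "1 + of_real lam * Gfun (of_real x) = 0 \<longleftrightarrow> x = a" for x
  proof -
    have "1 + of_real lam * Gfun (of_real x) = 0 \<longleftrightarrow> K_upper (of_real x) = - of_real lam"
      unfolding G using assms by (cases "K_upper (of_real x) = 0") (auto simp: field_simps eq_neg_iff_add_eq_0)
    then show ?thesis using a(2) by simp
  qed
  have "a_lam lam = a" unfolding a_lam_def
  proof (rule the_equality)
    show "a \<notin> {- sqrt (2 + gamma0), sqrt (2 + gamma0)} \<and> 1 + of_real lam * Gfun (of_real a) = 0"
      using eq[of a] a(1) edge_gt by (auto simp: edge_def)
  qed (use eq in auto)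
  then show "a_lam lam < - edge" "K_upper (of_real x) = - of_real lam \<longleftrightarrow> x = a_lam lam" using a by auto
qed

section \<open>Removing the pole at a\<close>

locale pole =
  fixes lam a :: real
  assumes lam: "lam > 0" and a: "a < - edge" and Ka: "\<And>x. K_upper (of_real x) = - of_real lam \<longleftrightarrow> x = a"
begin

text \<open>The residue of \<open>1 / (K + \<lambda>)\<close> at a, that is, the reciprocal of the
  derivative of K, written in terms of a and \<lambda> through K(a) = -\<lambda>. As the value at a
  it makes \<open>pole_ratio\<close> continuous.\<close>

definition atom_mass :: real where "atom_mass = lam * (2 - a\<^sup>2) / (lam\<^sup>2 * a + 2 * lam + 2 * a)"

definition pole_ratio :: "complex \<Rightarrow> complex" where
  "pole_ratio z = (if z = of_real a then of_real atom_mass else (z - of_real a) / (K_upper z + of_real lam))"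

text \<open>The density in the variable before the shift by \<lambda>. At a the convention 1/0 = 0
  gives the value 0, consistent with the vanishing of the density outside the edges.\<close>

definition ac_density :: "real \<Rightarrow> real" where "ac_density x = - Im (1 / (K_upper (of_real x) + of_real lam)) / pi"

text \<open>In the open half-plane \<open>Im K \<ge> Im z > 0\<close> excludes zeros of K +
  \<lambda>; on the line a is the only one.\<close>

lemma nonzero: "z \<in> upper_half \<Longrightarrow> z \<noteq> of_real a \<Longrightarrow> K_upper z + of_real lam \<noteq> 0"
proof
  assume z: "z \<in> upper_half" "z \<noteq> of_real a" "K_upper z + of_real lam = 0"
  show False
  proof (cases "Im z > 0")
    case True
    then have "Im (K_upper z + of_real lam) > 0" using Im_K_upper_ge[OF True] by simp
    then show False using z(3) by simp
  next
    case False
    then have "z = of_real (Re z)" using z(1) by (simp add: upper_half_def complex_eq_iff)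
    moreover have "K_upper z = - of_real lam" using z(3) by (simp add: eq_neg_iff_add_eq_0)
    ultimately have "Re z = a" using Ka by metis
    then show False using z(2) \<open>z = of_real (Re z)\<close> by simp
  qed
qed

lemma atom_mass_facts: "lam\<^sup>2 * a + 2 * lam + 2 * a < 0" "2 - a\<^sup>2 < 0" "atom_mass > 0"
  "of_real (r_outer a + 2 * ((r_outer a)\<^sup>2 - r_outer a + 1) / (r_outer a * (a\<^sup>2 - 2))) = (of_real (1 / atom_mass) :: complex)"
proof -
  have as: "a < - sqrt 2" "a < 0" using a edge_gt by linarith+
  have "sqrt 2 * sqrt 2 < (- a) * (- a)" using as by (intro mult_strict_mono) auto
  then show a2: "2 - a\<^sup>2 < 0" by (simp add: power2_eq_square)
  \<comment> \<open>As a \<le> -1, the denominator of the mass is at most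
    \<open>- (\<lambda>\<^sup>2 + 2 - 2 * \<lambda>)\<close>, and this bracket is
    \<open>(\<lambda> - 1)\<^sup>2 + 1\<close>.\<close>
  have "(lam\<^sup>2 + 2) * a \<le> (lam\<^sup>2 + 2) * (- 1)"
  proof (rule mult_left_mono)
    have "sqrt 2 \<ge> 1" by simp
    then show "a \<le> - 1" using as by linarith
  qed simp
  moreover have "lam\<^sup>2 + 2 - 2 * lam > 0"
  proof -
    have "lam\<^sup>2 + 2 - 2 * lam = (lam - 1)\<^sup>2 + 1" by (simp add: power2_eq_square algebra_simps)
    also have "\<dots> > 0" by (rule add_nonneg_pos) auto
    finally show ?thesis .
  qed
  ultimately show den: "lam\<^sup>2 * a + 2 * lam + 2 * a < 0" by (simp add: algebra_simps)
  show "atom_mass > 0" unfolding atom_mass_def using den a2 lam by (intro divide_neg_neg mult_pos_neg) auto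
  have "complex_of_real (a * r_outer a) = of_real (- lam)" using K_upper_real(2)[of a] Ka[of a] a edge_gt by simp
  then have ra: "a * r_outer a = - lam" by (simp only: of_real_eq_iff)
  define r where "r = r_outer a"
  have r: "lam = - a * r" using ra by (simp add: r_def)
  have r0: "r \<noteq> 0" using r lam by auto
  have aa: "a\<^sup>2 - 2 \<noteq> 0" "a \<noteq> 0" using a2 as by auto
  have m: "1 / atom_mass = (lam\<^sup>2 * a + 2 * lam + 2 * a) / (lam * (2 - a\<^sup>2))" by (simp add: atom_mass_def)
  \<comment> \<open>Substituting \<lambda> = - a r shows that numerator and denominator of
    \<open>1 / atom_mass\<close> share the factor a; what is left is the derivative of K found in
    \<open>K_upper_local\<close>.\<close>
  have num: "lam\<^sup>2 * a + 2 * lam + 2 * a = a * (r * r * (a\<^sup>2 - 2) + 2 * (r\<^sup>2 - r + 1))"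
    unfolding r by (simp add: power2_eq_square algebra_simps)
  have dn: "lam * (2 - a\<^sup>2) = a * (r * (a\<^sup>2 - 2))" unfolding r by (simp add: algebra_simps)
  have "r_outer a + 2 * ((r_outer a)\<^sup>2 - r_outer a + 1) / (r_outer a * (a\<^sup>2 - 2)) = 1 / atom_mass"
  proof -
    define k where "k = a\<^sup>2 - 2"
    define q where "q = r\<^sup>2 - r + 1"
    have "r + 2 * q / (r * k) = (r * r * k + 2 * q) / (r * k)" using r0 aa(1) by (simp add: k_def field_simps)
    also have "\<dots> = (a * (r * r * k + 2 * q)) / (a * (r * k))" using aa(2) by simp
    finally show ?thesis unfolding m num dn r_def[symmetric] k_def q_def .
  qed
  then show "of_real (r_outer a + 2 * ((r_outer a)\<^sup>2 - r_outer a + 1) / (r_outer a * (a\<^sup>2 - 2))) = (of_real (1 / atom_mass) :: complex)"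
    by simp
qed

text \<open>At a the ratio is the reciprocal of a difference quotient of K, whose limit is
  \<open>1 / atom_mass\<close> because K continues holomorphically around a. Elsewhere the
  denominator does not vanish.\<close>

lemma pole_ratio_continuous: "continuous_on upper_half pole_ratio"
  unfolding continuous_on_def
proof
  fix z assume z: "z \<in> upper_half"
  show "(pole_ratio \<longlongrightarrow> pole_ratio z) (at z within upper_half)"
  proof (cases "z = of_real a")
    case True
    have "\<bar>a\<bar> > edge" using a edge_gt by linarith
    from K_upper_local[OF this] obtain e f where ef: "e > 0" "\<forall>z\<in>ball (of_real a) e \<inter> upper_half. K_upper z = f z"
      "(f has_field_derivative of_real (1 / atom_mass)) (at (of_real a))"
      unfolding atom_mass_facts(4) by blast
    have aU: "of_real a \<in> upper_half" by (simp add: upper_half_def)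
    have fa: "f (of_real a) = - of_real lam"
      using bspec[OF ef(2), of "of_real a"] ef(1) aU Ka[of a] by simp
    have "((\<lambda>z. (f z - f (of_real a)) / (z - of_real a)) \<longlongrightarrow> of_real (1 / atom_mass)) (at (of_real a) within upper_half)"
      using DERIV_subset[OF ef(3), of upper_half] by (simp add: has_field_derivative_iff)
    then have "((\<lambda>z. 1 / ((f z - f (of_real a)) / (z - of_real a))) \<longlongrightarrow> 1 / of_real (1 / atom_mass)) (at (of_real a) within upper_half)"
      using atom_mass_facts(3) by (intro tendsto_divide tendsto_const) auto
    moreover have "eventually (\<lambda>z. 1 / ((f z - f (of_real a)) / (z - of_real a)) = pole_ratio z) (at (of_real a) within upper_half)"
      unfolding eventually_at
    proof (intro exI[of _ e] conjI ballI impI)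
      fix z assume "z \<in> upper_half" "z \<noteq> of_real a \<and> dist z (of_real a) < e"
      then have "K_upper z = f z" "z \<noteq> of_real a" using ef(2) by (auto simp: dist_commute)
      then show "1 / ((f z - f (of_real a)) / (z - of_real a)) = pole_ratio z" by (simp add: pole_ratio_def fa)
    qed (rule ef(1))
    ultimately have "(pole_ratio \<longlongrightarrow> 1 / of_real (1 / atom_mass)) (at (of_real a) within upper_half)"
      by (rule Lim_transform_eventually)
    then show ?thesis by (simp add: True pole_ratio_def)
  next
    case False
    have "(K_upper \<longlongrightarrow> K_upper z) (at z within upper_half)" using K_upper_continuous z by (simp add: continuous_on_def)
    then have "((\<lambda>z. (z - of_real a) / (K_upper z + of_real lam)) \<longlongrightarrow> (z - of_real a) / (K_upper z + of_real lam)) (at z within upper_half)"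
      using nonzero[OF z False] by (intro tendsto_intros) auto
    moreover have "eventually (\<lambda>w. (w - of_real a) / (K_upper w + of_real lam) = pole_ratio w) (at z within upper_half)"
      unfolding eventually_at using False
      by (intro exI[of _ "dist z (of_real a)"]) (auto simp: pole_ratio_def dist_commute)
    ultimately have "(pole_ratio \<longlongrightarrow> (z - of_real a) / (K_upper z + of_real lam)) (at z within upper_half)"
      by (rule Lim_transform_eventually)
    then show ?thesis using False by (simp add: pole_ratio_def)
  qed
qed

lemma pole_ratio_holomorphic: "pole_ratio holomorphic_on {z. 0 < Im z}"
proof (rule holomorphic_transform)
  have nonzero': "K_upper z + of_real lam \<noteq> 0" if "0 < Im z" for z
  proof (rule nonzero)
    show "z \<noteq> of_real a" using that by auto
  qed (use that in \<open>simp add: upper_half_def\<close>)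
  show "(\<lambda>z. (z - of_real a) / (K_upper z + of_real lam)) holomorphic_on {z. 0 < Im z}"
    using nonzero' by (intro holomorphic_intros K_upper_holomorphic) auto
qed (auto simp: pole_ratio_def)

lemma pole_ratio_asymp: "\<exists>C R. \<forall>z\<in>upper_half. cmod z \<ge> R \<longrightarrow> cmod (pole_ratio z - 1) \<le> C / cmod z"
proof -
  obtain C R where CR: "C \<ge> 0" "R \<ge> 1" "\<And>z. z \<in> upper_half \<Longrightarrow> cmod z \<ge> R \<Longrightarrow> cmod (K_upper z - z) \<le> C / cmod z"
    using K_upper_asymp by blast
  define R' where "R' = max R (max (2 * (C + lam)) (\<bar>a\<bar> + 1))"
  have "cmod (pole_ratio z - 1) \<le> 2 * (C + lam + \<bar>a\<bar>) / cmod z" if z: "z \<in> upper_half" "cmod z \<ge> R'" for z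
  proof -
    have zz: "cmod z \<ge> R" "cmod z \<ge> 2 * (C + lam)" "cmod z > \<bar>a\<bar>" "cmod z \<ge> 1" using z CR(2) by (auto simp: R'_def)
    have "cmod (K_upper z - z) \<le> C / cmod z" by (rule CR(3)[OF z(1) zz(1)])
    also have "\<dots> \<le> C / 1" using zz CR by (intro divide_left_mono) auto
    finally have K: "cmod (K_upper z - z) \<le> C" by simp
    have za: "z \<noteq> of_real a" using zz(3) by auto
    have "cmod z = cmod ((K_upper z + of_real lam) - (K_upper z - z) - of_real lam)" by simp
    also have "\<dots> \<le> cmod (K_upper z + of_real lam) + cmod (K_upper z - z) + cmod (of_real lam)"
      by (meson add_right_mono norm_triangle_ineq4 order_trans)
    finally have "cmod z \<le> cmod (K_upper z + of_real lam) + C + lam" using K lam by simp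
    then have den: "cmod (K_upper z + of_real lam) \<ge> cmod z / 2" using zz(2) by simp
    have "pole_ratio z - 1 = - ((K_upper z - z) + of_real (lam + a)) / (K_upper z + of_real lam)"
      using nonzero[OF z(1) za] za by (simp add: pole_ratio_def field_simps)
    then have "cmod (pole_ratio z - 1) = cmod ((K_upper z - z) + of_real (lam + a)) / cmod (K_upper z + of_real lam)"
      by (simp only: norm_divide norm_minus_cancel)
    also have "\<dots> \<le> (C + lam + \<bar>a\<bar>) / (cmod z / 2)"
    proof (rule frac_le)
      have "cmod ((K_upper z - z) + of_real (lam + a)) \<le> cmod (K_upper z - z) + cmod (of_real (lam + a))"
        by (rule norm_triangle_ineq)
      also have "cmod (complex_of_real (lam + a)) = \<bar>lam + a\<bar>" by (rule norm_of_real)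
      finally show "cmod ((K_upper z - z) + of_real (lam + a)) \<le> C + lam + \<bar>a\<bar>" using K lam by linarith
    qed (use den zz CR lam in auto)
    finally show ?thesis by (simp add: mult.commute)
  qed
  then show ?thesis by blast
qed

lemma pole_ratio_real:
  assumes "\<bar>x\<bar> \<ge> edge" shows "Im (pole_ratio (of_real x)) = 0" "ac_density x = 0"
proof -
  have K: "K_upper (of_real x) = of_real (x * r_outer x)" using K_upper_real(2)[OF assms] .
  have "1 / (K_upper (of_real x) + of_real lam) = of_real (1 / (x * r_outer x + lam))" unfolding K by simp
  then show "ac_density x = 0" by (simp only: ac_density_def Im_complex_of_real)
  show "Im (pole_ratio (of_real x)) = 0"
  proof (cases "x = a")
    case False
    have "pole_ratio (of_real x) = of_real ((x - a) / (x * r_outer x + lam))" unfolding pole_ratio_def K using False by simp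
    then show ?thesis by (simp only: Im_complex_of_real)
  qed (simp add: pole_ratio_def)
qed

lemma Im_pole_ratio: "Im (pole_ratio (of_real x)) = - pi * ((x - a) * ac_density x)"
proof (cases "x = a")
  case False
  have "pole_ratio (of_real x) = of_real (x - a) * (1 / (K_upper (of_real x) + of_real lam))" using False by (simp add: pole_ratio_def)
  then have "Im (pole_ratio (of_real x)) = (x - a) * Im (1 / (K_upper (of_real x) + of_real lam))"
    by (simp only: times_complex.sel Re_complex_of_real Im_complex_of_real)
  then show ?thesis by (simp add: ac_density_def)
qed (simp add: pole_ratio_def)

lemma ac_density_nonneg: "ac_density x \<ge> 0"
proof -
  have "Im (1 / w) \<le> 0" if "Im w \<ge> 0" for w :: complex
    using that by (simp add: Im_divide divide_nonpos_nonneg)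
  then have "Im (1 / (K_upper (of_real x) + of_real lam)) \<le> 0" using Im_K_upper_real_nonneg[of x] by simp
  then show ?thesis by (simp add: ac_density_def divide_nonpos_pos)
qed

lemma ac_density_continuous: "continuous_on {- edge..edge} ac_density"
  unfolding ac_density_def
proof (intro continuous_intros continuous_on_compose2[OF K_upper_continuous])
  show "\<forall>x\<in>{- edge..edge}. K_upper (of_real x) + of_real lam \<noteq> 0"
    using a by (auto simp: eq_neg_iff_add_eq_0[symmetric] Ka)
qed (auto simp: upper_half_def)

text \<open>Cauchy's theorem yields gauge integrals over the interval between the edges, the measure
  needs Lebesgue integrals over the whole line. They agree since the density is continuous on the
  interval and vanishes at and beyond its ends.\<close>

lemma ac_density_integral:
  assumes g: "continuous_on {- edge..edge} g"
  shows "integrable lborel (\<lambda>x. ac_density x * g x)" "(\<integral>x. ac_density x * g x \<partial>lborel) = integral {- edge..edge} (\<lambda>x. ac_density x * g x)"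
    "(\<lambda>x. ac_density x * g x) integrable_on {- edge..edge}"
proof -
  have c: "continuous_on {- edge..edge} (\<lambda>x. ac_density x * g x)" by (intro continuous_intros ac_density_continuous g)
  have e: "(\<lambda>x. indicator {- edge..edge} x *\<^sub>R (ac_density x * g x)) = (\<lambda>x. ac_density x * g x)"
  proof
    fix x
    show "indicator {- edge..edge} x *\<^sub>R (ac_density x * g x) = ac_density x * g x"
      using pole_ratio_real(2)[of x] by (cases "edge \<le> \<bar>x\<bar>") (auto simp: indicator_def)
  qed
  have "integrable lborel (\<lambda>x. indicator {- edge..edge} x *\<^sub>R (ac_density x * g x))"
    by (rule borel_integrable_compact[OF compact_Icc c])
  then have s: "set_integrable lborel {- edge..edge} (\<lambda>x. ac_density x * g x)" by (simp add: set_integrable_def)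
  then show "integrable lborel (\<lambda>x. ac_density x * g x)" unfolding set_integrable_def e .
  show "(\<lambda>x. ac_density x * g x) integrable_on {- edge..edge}" by (rule set_borel_integral_eq_integral(1)[OF s])
  show "(\<integral>x. ac_density x * g x \<partial>lborel) = integral {- edge..edge} (\<lambda>x. ac_density x * g x)"
    using set_borel_integral_eq_integral(2)[OF s] unfolding set_lebesgue_integral_def e .
qed

text \<open>\<open>half_plane_cauchy\<close> with h = \<open>pole_ratio\<close>, whose imaginary
  part on the line is \<open>- pi * (x - a)\<close> times the density. The identity
  \<open>(x - a) / (y - x) = (y - a) / (y - x) - 1\<close> splits the integral into the Stieltjes
  transform and the total mass of the density.\<close>

lemma pole_ratio_formula:
  assumes y: "\<bar>y\<bar> > edge" "y \<noteq> a"
  shows "Re (pole_ratio (of_real y)) = 1 - (\<integral>x. ac_density x \<partial>lborel) + (y - a) * (\<integral>x. ac_density x * (1 / (y - x)) \<partial>lborel)"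
    "pole_ratio (of_real y) = of_real (Re (pole_ratio (of_real y)))"
proof -
  show hy: "pole_ratio (of_real y) = of_real (Re (pole_ratio (of_real y)))"
    using pole_ratio_real(1)[of y] y by (simp add: complex_eq_iff)
  obtain e f where ef: "e > 0" "f holomorphic_on ball (of_real y) e" "\<forall>z\<in>ball (of_real y) e \<inter> upper_half. K_upper z = f z"
    using K_upper_local[OF y(1)] by blast
  have yU: "complex_of_real y \<in> upper_half" by (simp add: upper_half_def)
  have fy: "f (of_real y) = K_upper (of_real y)" using bspec[OF ef(3), of "of_real y"] ef(1) yU by simp
  obtain f' where f': "(f has_field_derivative f') (at (of_real y))"
    using ef(1,2) holomorphic_on_open[OF open_ball] by (metis centre_in_ball)
  have ne: "f (of_real y) + of_real lam \<noteq> 0" unfolding fy using nonzero[OF yU] y by simp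
  have "\<exists>D. ((\<lambda>z. (z - of_real a) / (f z + of_real lam)) has_field_derivative D) (at (of_real y))"
    using ne f' by (auto intro!: derivative_eq_intros exI)
  then obtain D where "((\<lambda>z. (z - of_real a) / (f z + of_real lam)) has_field_derivative D) (at (of_real y))" by blast
  from DERIV_subset[OF this, of upper_half]
  have "((\<lambda>z. ((z - of_real a) / (f z + of_real lam) - (of_real y - of_real a) / (f (of_real y) + of_real lam)) / (z - of_real y)) \<longlongrightarrow> D) (at (of_real y) within upper_half)"
    by (simp add: has_field_derivative_iff)
  moreover have "eventually (\<lambda>z. ((z - of_real a) / (f z + of_real lam) - (of_real y - of_real a) / (f (of_real y) + of_real lam)) / (z - of_real y)
     = (pole_ratio z - pole_ratio (of_real y)) / (z - of_real y)) (at (of_real y) within upper_half)"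
    unfolding eventually_at
  proof (intro exI[of _ "min e (dist (complex_of_real y) (of_real a))"] conjI ballI impI)
    show "0 < min e (dist (complex_of_real y) (of_real a))" using ef(1) y by simp
    fix z assume z: "z \<in> upper_half" "z \<noteq> of_real y \<and> dist z (of_real y) < min e (dist (complex_of_real y) (of_real a))"
    then have "K_upper z = f z" "z \<noteq> of_real a" using ef(3) by (auto simp: dist_commute)
    then show "((z - of_real a) / (f z + of_real lam) - (of_real y - of_real a) / (f (of_real y) + of_real lam)) / (z - of_real y)
     = (pole_ratio z - pole_ratio (of_real y)) / (z - of_real y)"
      using y by (simp add: pole_ratio_def fy)
  qed
  ultimately have der: "((\<lambda>z. (pole_ratio z - pole_ratio (of_real y)) / (z - of_real y)) \<longlongrightarrow> D) (at (of_real y) within upper_half)"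
    by (rule Lim_transform_eventually)
  obtain C R where CR: "\<forall>z\<in>upper_half. cmod z \<ge> R \<longrightarrow> cmod (pole_ratio z - 1) \<le> C / cmod z" using pole_ratio_asymp by blast
  have "((\<lambda>x. Im (pole_ratio (of_real x)) / (x - y)) has_integral pi * (Re (pole_ratio (of_real y)) - 1)) {- edge..edge}"
  proof (rule half_plane_cauchy[OF pole_ratio_continuous pole_ratio_holomorphic _ der])
    show "cmod (pole_ratio z - 1) \<le> C / cmod z" if "z \<in> upper_half" "R \<le> cmod z" for z using CR that by blast
    show "Im (pole_ratio (of_real y)) = 0" using pole_ratio_real(1)[of y] y by simp
    show "Im (pole_ratio (of_real x)) = 0" if "edge \<le> \<bar>x\<bar>" for x by (rule pole_ratio_real(1)[OF that])
  qed (use edge_gt y in auto)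
  then have I: "integral {- edge..edge} (\<lambda>x. Im (pole_ratio (of_real x)) / (x - y)) = pi * (Re (pole_ratio (of_real y)) - 1)"
    by (rule integral_unique)
  have c1: "continuous_on {- edge..edge} (\<lambda>x. 1 / (y - x))" using y by (intro continuous_intros) auto
  have c0: "continuous_on {- edge..edge} (\<lambda>x::real. 1::real)" by (intro continuous_intros)
  have integrand: "Im (pole_ratio (of_real x)) / (x - y) = pi * ((y - a) * (ac_density x * (1 / (y - x))) - ac_density x * 1)" if "x \<in> {- edge..edge}" for x
  proof -
    have "x - y \<noteq> 0" using that y by auto
    then have q: "(x - a) / (y - x) = (y - a) * (1 / (y - x)) - 1" by (simp add: field_simps)
    have "Im (pole_ratio (of_real x)) / (x - y) = pi * (ac_density x * ((x - a) / (y - x)))"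
      unfolding Im_pole_ratio using \<open>x - y \<noteq> 0\<close> by (simp add: divide_simps) (simp add: algebra_simps)
    then show ?thesis unfolding q by (simp add: algebra_simps)
  qed
  note i1 = integrable_on_mult_right[OF ac_density_integral(3)[OF c1], of "y - a"]
  from integrand have "integral {- edge..edge} (\<lambda>x. Im (pole_ratio (of_real x)) / (x - y)) =
      integral {- edge..edge} (\<lambda>x. pi * ((y - a) * (ac_density x * (1 / (y - x))) - ac_density x * 1))"
    by (rule integral_cong)
  also have "\<dots> = pi * ((y - a) * integral {- edge..edge} (\<lambda>x. ac_density x * (1 / (y - x))) - integral {- edge..edge} (\<lambda>x. ac_density x * 1))"
    by (simp only: integral_mult_right integral_diff[OF i1 ac_density_integral(3)[OF c0]])
  finally have "pi * (Re (pole_ratio (of_real y)) - 1) = pi * ((y - a) * (\<integral>x. ac_density x * (1 / (y - x)) \<partial>lborel) - (\<integral>x. ac_density x * 1 \<partial>lborel))"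
    unfolding I ac_density_integral(2)[OF c1] ac_density_integral(2)[OF c0] .
  then show "Re (pole_ratio (of_real y)) = 1 - (\<integral>x. ac_density x \<partial>lborel) + (y - a) * (\<integral>x. ac_density x * (1 / (y - x)) \<partial>lborel)"
    by simp
qed

lemma ac_density_integrable: "integrable lborel ac_density"
  using ac_density_integral(1)[of "\<lambda>_. 1"] by simp

text \<open>Let y tend to a from the left in \<open>pole_ratio_formula\<close>. The left side tends
  to \<open>pole_ratio\<close> at a by continuity. On the right the Stieltjes integral stays
  bounded, since y keeps the distance - edge - a from the support, and the factor y - a kills it.
  Hence atom and density have total mass 1.\<close>

lemma atom_mass_eq: "atom_mass = 1 - (\<integral>x. ac_density x \<partial>lborel)"
proof -
  define P where "P = (\<integral>x. ac_density x \<partial>lborel)"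
  define d where "d = - edge - a"
  have d: "d > 0" using a by (simp add: d_def)
  define y where "y = (\<lambda>n. a - inverse (real (Suc n)))"
  have yb: "y n < a" for n by (simp add: y_def)
  have ye: "\<bar>y n\<bar> > edge" for n using yb[of n] a edge_gt by linarith
  have y0: "(\<lambda>n. y n) \<longlonglongrightarrow> a - 0" unfolding y_def by (intro tendsto_diff tendsto_const LIMSEQ_inverse_real_of_nat)
  define J where "J = (\<lambda>n. \<integral>x. ac_density x * (1 / (y n - x)) \<partial>lborel)"
  have Jb: "\<bar>J n\<bar> \<le> P / d" for n
  proof -
    have c1: "continuous_on {- edge..edge} (\<lambda>x. 1 / (y n - x))" using ye[of n] by (intro continuous_intros) auto
    have "\<bar>J n\<bar> \<le> (\<integral>x. \<bar>ac_density x * (1 / (y n - x))\<bar> \<partial>lborel)" unfolding J_def by (rule integral_abs_bound)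
    also have "\<dots> \<le> (\<integral>x. ac_density x * (1 / d) \<partial>lborel)"
    proof (rule integral_mono)
      show "integrable lborel (\<lambda>x. \<bar>ac_density x * (1 / (y n - x))\<bar>)" using ac_density_integral(1)[OF c1] by (rule integrable_abs)
      show "integrable lborel (\<lambda>x. ac_density x * (1 / d))" by (rule ac_density_integral(1)) (intro continuous_intros)
      fix x
      show "\<bar>ac_density x * (1 / (y n - x))\<bar> \<le> ac_density x * (1 / d)"
      proof (cases "\<bar>x\<bar> \<ge> edge")
        case False
        then have "\<bar>y n - x\<bar> \<ge> d" using yb[of n] by (simp add: d_def)
        then have "1 / \<bar>y n - x\<bar> \<le> 1 / d" using d by (intro divide_left_mono mult_pos_pos) auto
        then show ?thesis using ac_density_nonneg[of x] by (simp add: abs_mult mult_left_mono divide_inverse)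
      qed (simp add: pole_ratio_real)
    qed
    also have "\<dots> = P / d" by (simp add: P_def)
    finally show ?thesis .
  qed
  have "(\<lambda>n. (y n - a) * J n) \<longlonglongrightarrow> 0"
  proof (rule Lim_null_comparison)
    show "(\<lambda>n. inverse (real (Suc n)) * (P / d)) \<longlonglongrightarrow> 0"
      using tendsto_mult[OF LIMSEQ_inverse_real_of_nat tendsto_const[of "P / d"]] by simp
    show "eventually (\<lambda>n. norm ((y n - a) * J n) \<le> inverse (real (Suc n)) * (P / d)) sequentially"
    proof (intro always_eventually allI)
      fix n
      have "norm ((y n - a) * J n) = inverse (real (Suc n)) * \<bar>J n\<bar>" by (simp add: y_def abs_mult del: of_nat_Suc)
      also have "\<dots> \<le> inverse (real (Suc n)) * (P / d)" by (rule mult_left_mono[OF Jb]) simp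
      finally show "norm ((y n - a) * J n) \<le> inverse (real (Suc n)) * (P / d)" .
    qed
  qed
  then have "(\<lambda>n. 1 - P + (y n - a) * J n) \<longlonglongrightarrow> 1 - P + 0" by (intro tendsto_intros)
  moreover have "1 - P + (y n - a) * J n = Re (pole_ratio (of_real (y n)))" for n
    using pole_ratio_formula(1)[OF ye[of n]] yb[of n] by (simp add: P_def J_def)
  ultimately have 1: "(\<lambda>n. Re (pole_ratio (of_real (y n)))) \<longlonglongrightarrow> 1 - P" by simp
  have "(\<lambda>n. pole_ratio (of_real (y n))) \<longlonglongrightarrow> pole_ratio (of_real a)"
  proof (rule continuous_on_tendsto_compose[OF pole_ratio_continuous])
    show "(\<lambda>n. complex_of_real (y n)) \<longlonglongrightarrow> of_real a" using y0 by (intro tendsto_of_real) simp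
  qed (auto simp: upper_half_def)
  then have "(\<lambda>n. Re (pole_ratio (of_real (y n)))) \<longlonglongrightarrow> atom_mass" using tendsto_Re by (fastforce simp: pole_ratio_def)
  then show ?thesis using LIMSEQ_unique[OF 1] by (simp add: P_def)
qed

lemma stieltjes_formula:
  assumes y: "y > edge"
  shows "1 / (lam + y * r_outer y) = atom_mass / (y - a) + (\<integral>x. ac_density x * (1 / (y - x)) \<partial>lborel)"
proof -
  have ya: "y - a > 0" using y a edge_gt by linarith
  have K: "K_upper (of_real y) = of_real (y * r_outer y)" using K_upper_real(2)[of y] y edge_gt by simp
  have "pole_ratio (of_real y) = of_real ((y - a) / (y * r_outer y + lam))" unfolding pole_ratio_def K using ya by simp
  then have "(y - a) / (y * r_outer y + lam) = atom_mass + (y - a) * (\<integral>x. ac_density x * (1 / (y - x)) \<partial>lborel)"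
    using pole_ratio_formula(1)[of y] y edge_gt ya atom_mass_eq by simp
  then have "(y - a) / (y * r_outer y + lam) / (y - a) = (atom_mass + (y - a) * (\<integral>x. ac_density x * (1 / (y - x)) \<partial>lborel)) / (y - a)"
    by simp
  then show ?thesis using ya by (simp add: add_divide_distrib add.commute)
qed

end

section \<open>The limit measure\<close>

definition sum_measure :: "'a measure \<Rightarrow> 'a measure \<Rightarrow> 'a measure" where
  "sum_measure M N = measure_of (space M) (sets M) (\<lambda>A. emeasure M A + emeasure N A)"

lemma sets_sum_measure [simp]: "sets (sum_measure M N) = sets M"
  and space_sum_measure [simp]: "space (sum_measure M N) = space M"
  by (simp_all add: sum_measure_def)

lemma emeasure_sum_measure:
  assumes "sets N = sets M" "A \<in> sets M"
  shows "emeasure (sum_measure M N) A = emeasure M A + emeasure N A"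
proof (rule emeasure_measure_of[OF sum_measure_def])
  show "sets M \<subseteq> Pow (space M)" by (rule sets.space_closed)
  show "positive (sets (sum_measure M N)) (\<lambda>A. emeasure M A + emeasure N A)"
    by (simp add: positive_def)
  show "countably_additive (sets (sum_measure M N)) (\<lambda>A. emeasure M A + emeasure N A)"
    unfolding countably_additive_def
  proof (intro allI impI)
    fix A :: "nat \<Rightarrow> 'a set"
    assume "range A \<subseteq> sets (sum_measure M N)" "disjoint_family A"
    then show "(\<Sum>i. emeasure M (A i) + emeasure N (A i)) = emeasure M (\<Union>(range A)) + emeasure N (\<Union>(range A))"
      using assms(1) by (subst suminf_add[symmetric]) (auto simp: suminf_emeasure)
  qed
qed (use assms in simp)

lemma nn_integral_sum_measure:
  assumes "sets N = sets M" "f \<in> borel_measurable M"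
  shows "(\<integral>\<^sup>+x. f x \<partial>sum_measure M N) = (\<integral>\<^sup>+x. f x \<partial>M) + (\<integral>\<^sup>+x. f x \<partial>N)"
proof -
  have sp: "space N = space M" using sets_eq_imp_space_eq[OF assms(1)] .
  have mN: "borel_measurable N = borel_measurable M" and mS: "borel_measurable (sum_measure M N) = borel_measurable M"
    by (auto intro!: measurable_cong_sets simp: assms(1))
  show ?thesis using assms(2)
  proof (induction rule: borel_measurable_induct)
    case (cong f g)
    then show ?case
      using nn_integral_cong[of M f g] nn_integral_cong[of N f g] nn_integral_cong[of "sum_measure M N" f g] sp
      by simp
  next
    case (set A)
    then show ?case using assms(1) by (simp add: emeasure_sum_measure)
  next
    case (mult u c)
    then show ?case by (simp add: nn_integral_cmult mN mS distrib_left)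
  next
    case (add u v)
    then show ?case by (simp add: nn_integral_add mN mS add_ac)
  next
    case (seq U)
    have "(\<integral>\<^sup>+x. (SUP i. U i x) \<partial>sum_measure M N) = (SUP i. \<integral>\<^sup>+x. U i x \<partial>sum_measure M N)"
      using seq by (intro nn_integral_monotone_convergence_SUP) (auto simp: mS)
    also have "\<dots> = (SUP i. (\<integral>\<^sup>+x. U i x \<partial>M) + (\<integral>\<^sup>+x. U i x \<partial>N))" using seq by simp
    also have "\<dots> = (SUP i. \<integral>\<^sup>+x. U i x \<partial>M) + (SUP i. \<integral>\<^sup>+x. U i x \<partial>N)"
      using seq by (intro ennreal_SUP_add incseq_nn_integral) auto
    also have "(SUP i. \<integral>\<^sup>+x. U i x \<partial>M) = (\<integral>\<^sup>+x. (SUP i. U i x) \<partial>M)"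
      using seq by (intro nn_integral_monotone_convergence_SUP[symmetric]) auto
    also have "(SUP i. \<integral>\<^sup>+x. U i x \<partial>N) = (\<integral>\<^sup>+x. (SUP i. U i x) \<partial>N)"
      using seq by (intro nn_integral_monotone_convergence_SUP[symmetric]) (auto simp: mN)
    finally show ?case by (simp add: image_comp SUP_apply)
  qed
qed

lemma integral_sum_measure:
  fixes f :: "'a \<Rightarrow> real"
  assumes "sets N = sets M" "integrable M f" "integrable N f"
  shows "integrable (sum_measure M N) f"
    "integral\<^sup>L (sum_measure M N) f = integral\<^sup>L M f + integral\<^sup>L N f"
proof -
  have mS: "borel_measurable (sum_measure M N) = borel_measurable M"
    by (auto intro!: measurable_cong_sets)
  have fm: "f \<in> borel_measurable M" using assms by auto
  have nn: "(\<integral>\<^sup>+x. ennreal (g x) \<partial>sum_measure M N) = (\<integral>\<^sup>+x. ennreal (g x) \<partial>M) + (\<integral>\<^sup>+x. ennreal (g x) \<partial>N)"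
    if "g \<in> borel_measurable M" for g
    using that by (intro nn_integral_sum_measure assms) auto
  show i: "integrable (sum_measure M N) f"
    unfolding integrable_iff_bounded using nn[of "\<lambda>x. norm (f x)"] fm assms(2,3)
    by (auto simp: mS integrable_iff_bounded)
  have fin: "(\<integral>\<^sup>+x. ennreal (f x) \<partial>K) < \<infinity>" "(\<integral>\<^sup>+x. ennreal (- f x) \<partial>K) < \<infinity>" if "integrable K f" for K
    using that by (auto simp: real_integrable_def less_top)
  show "integral\<^sup>L (sum_measure M N) f = integral\<^sup>L M f + integral\<^sup>L N f"
    unfolding real_lebesgue_integral_def[OF i] real_lebesgue_integral_def[OF assms(2)]
      real_lebesgue_integral_def[OF assms(3)] nn[OF fm] nn[OF borel_measurable_uminus[OF fm]]
    using fin[OF assms(2)] fin[OF assms(3)] by (simp add: enn2real_plus)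
qed

text \<open>The geometric series of \<open>1 / (z - x)\<close> under the integral: its remainder
  \<open>(x / z) ^ n / (z - x)\<close> is uniformly small for |x| \<le> r < z.\<close>

lemma moments_sums_stieltjes:
  fixes M :: "real measure"
  assumes M: "prob_space M" "sets M = sets borel" "AE x in M. \<bar>x\<bar> \<le> r" and r: "0 < r" "r < z"
  shows "(\<lambda>n. (\<integral>x. x ^ n \<partial>M) / z ^ Suc n) sums (\<integral>x. 1 / (z - x) \<partial>M)"
proof -
  interpret prob_space M by (rule M)
  have fm: "finite_measure M" by unfold_locales
  have int: "integrable M (\<lambda>x. x ^ k)" for k by (rule bounded_powers_integrable[OF fm M(2,3)])
  have bm: "f \<in> borel_measurable M" if "f \<in> borel_measurable borel" for f :: "real \<Rightarrow> real"
    by (subst measurable_cong_sets[OF M(2) refl]) (rule that)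
  have intS: "integrable M (\<lambda>x. 1 / (z - x))"
  proof (rule integrable_const_bound[of _ "1 / (z - r)"])
    show "AE x in M. norm (1 / (z - x)) \<le> 1 / (z - r)"
      using M(3)
    proof eventually_elim
      case (elim x)
      then have "z - x \<ge> z - r" "z - x > 0" using r by auto
      then show ?case using r by (auto intro!: divide_left_mono)
    qed
  qed (intro bm, measurable)
  have part: "(\<Sum>k<n. x ^ k / z ^ Suc k) = (1 - (x / z) ^ n) / (z - x)" if "x \<noteq> z" for x n
  proof (induction n)
    case (Suc n)
    have "(\<Sum>k<Suc n. x ^ k / z ^ Suc k) = (1 - (x / z) ^ n) / (z - x) + (x / z) ^ n / z"
      using Suc by (simp add: power_divide)
    also have "\<dots> = (1 - (x / z) ^ Suc n) / (z - x)" using that r by (simp add: field_simps)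
    finally show ?case .
  qed simp
  have "(\<lambda>n. (\<integral>x. 1 / (z - x) \<partial>M) - (\<Sum>k<n. (\<integral>x. x ^ k \<partial>M) / z ^ Suc k)) \<longlonglongrightarrow> 0"
  proof (rule Lim_null_comparison)
    have "(\<lambda>n. (r / z) ^ n) \<longlonglongrightarrow> 0" using r by (intro LIMSEQ_realpow_zero) auto
    then show "(\<lambda>n. (r / z) ^ n * (1 / (z - r))) \<longlonglongrightarrow> 0" by (rule tendsto_mult_left_zero)
    show "eventually (\<lambda>n. norm ((\<integral>x. 1 / (z - x) \<partial>M) - (\<Sum>k<n. (\<integral>x. x ^ k \<partial>M) / z ^ Suc k)) \<le> (r / z) ^ n * (1 / (z - r))) sequentially"
    proof (intro always_eventually allI)
      fix n
      have ips: "integrable M (\<lambda>x. \<Sum>k<n. x ^ k / z ^ Suc k)" using int by (intro Bochner_Integration.integrable_sum) auto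
      have "(\<Sum>k<n. (\<integral>x. x ^ k \<partial>M) / z ^ Suc k) = (\<integral>x. (\<Sum>k<n. x ^ k / z ^ Suc k) \<partial>M)"
        using int by (subst Bochner_Integration.integral_sum) auto
      then have "(\<integral>x. 1 / (z - x) \<partial>M) - (\<Sum>k<n. (\<integral>x. x ^ k \<partial>M) / z ^ Suc k) =
         (\<integral>x. 1 / (z - x) - (\<Sum>k<n. x ^ k / z ^ Suc k) \<partial>M)"
        using intS ips by (subst Bochner_Integration.integral_diff) auto
      also have "norm \<dots> \<le> (\<integral>x. norm (1 / (z - x) - (\<Sum>k<n. x ^ k / z ^ Suc k)) \<partial>M)" by (rule integral_norm_bound)
      also have "\<dots> \<le> (\<integral>x. (r / z) ^ n * (1 / (z - r)) \<partial>M)"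
      proof (rule integral_mono_AE)
        show "integrable M (\<lambda>x. norm (1 / (z - x) - (\<Sum>k<n. x ^ k / z ^ Suc k)))"
          using intS ips by (intro integrable_norm Bochner_Integration.integrable_diff)
        show "AE x in M. norm (1 / (z - x) - (\<Sum>k<n. x ^ k / z ^ Suc k)) \<le> (r / z) ^ n * (1 / (z - r))"
          using M(3)
        proof eventually_elim
          case (elim x)
          then have x: "z - x \<ge> z - r" "z - x > 0" "x \<noteq> z" using r by auto
          have "1 / (z - x) - (\<Sum>k<n. x ^ k / z ^ Suc k) = (x / z) ^ n * (1 / (z - x))"
            unfolding part[OF x(3)] by (simp add: diff_divide_distrib)
          also have "norm \<dots> = (\<bar>x\<bar> / z) ^ n * (1 / (z - x))" using x r by (simp add: abs_mult power_abs)
          also have "\<dots> \<le> (r / z) ^ n * (1 / (z - r))"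
            using x r elim by (intro mult_mono power_mono divide_right_mono divide_left_mono) auto
          finally show ?case .
        qed
      qed auto
      also have "\<dots> = (r / z) ^ n * (1 / (z - r))" using prob_space by simp
      finally show "norm ((\<integral>x. 1 / (z - x) \<partial>M) - (\<Sum>k<n. (\<integral>x. x ^ k \<partial>M) / z ^ Suc k)) \<le> (r / z) ^ n * (1 / (z - r))" .
    qed
  qed
  from tendsto_diff[OF tendsto_const[of "\<integral>x. 1 / (z - x) \<partial>M"] this] show ?thesis unfolding sums_def by simp
qed

context pole
begin

text \<open>K is evaluated at x - \<lambda>, hence density and atom are both translated by
  \<lambda>.\<close>

definition lim_meas :: "real measure" where
  "lim_meas = sum_measure (density lborel (\<lambda>x. ennreal (ac_density (x - lam)))) (density (return borel (a + lam)) (\<lambda>_. ennreal atom_mass))"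

lemma sets_lim_meas: "sets lim_meas = sets borel"
  by (simp add: lim_meas_def)

lemma ac_density_measurable [measurable]: "ac_density \<in> borel_measurable borel"
  using borel_measurable_integrable[OF ac_density_integrable] by simp

lemma emeasure_lim_meas:
  assumes "B \<in> sets borel"
  shows "emeasure lim_meas B = emeasure (density lborel (\<lambda>x. ennreal (ac_density (x - lam)))) B + ennreal atom_mass * indicator B (a + lam)"
proof -
  have "emeasure (density (return borel (a + lam)) (\<lambda>_. ennreal atom_mass)) B = ennreal atom_mass * indicator B (a + lam)"
    using assms by (simp add: emeasure_density_const)
  then show ?thesis unfolding lim_meas_def using assms by (subst emeasure_sum_measure) auto
qed

lemma emeasure_density_zero:
  assumes "B \<in> sets borel" "\<And>x. x \<in> B \<Longrightarrow> \<bar>x - lam\<bar> \<ge> edge"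
  shows "emeasure (density lborel (\<lambda>x. ennreal (ac_density (x - lam)))) B = 0"
proof -
  have "emeasure (density lborel (\<lambda>x. ennreal (ac_density (x - lam)))) B = (\<integral>\<^sup>+x. ennreal (ac_density (x - lam)) * indicator B x \<partial>lborel)"
    using assms by (intro emeasure_density) auto
  also have "\<dots> = (\<integral>\<^sup>+x. 0 \<partial>(lborel :: real measure))"
  proof (rule nn_integral_cong)
    fix x
    show "ennreal (ac_density (x - lam)) * indicator B x = 0"
      using assms(2)[of x] pole_ratio_real(2)[of "x - lam"] by (cases "x \<in> B") auto
  qed
  finally show ?thesis by simp
qed

lemma lim_meas_integral:
  assumes g: "g \<in> borel_measurable borel" and i: "integrable lborel (\<lambda>x. ac_density x * g (x + lam))"
  shows "integral\<^sup>L lim_meas g = (\<integral>x. ac_density x * g (x + lam) \<partial>lborel) + atom_mass * g (a + lam)"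
proof -
  have e: "(\<lambda>x. ac_density (lam + 1 * x - lam) * g (lam + 1 * x)) = (\<lambda>x. ac_density x * g (x + lam))"
    by (simp add: add.commute)
  have i': "integrable lborel (\<lambda>x. ac_density (x - lam) * g x)"
    using lborel_integrable_real_affine_iff[of 1 "\<lambda>x. ac_density (x - lam) * g x" lam] i unfolding e by simp
  have eq: "(\<integral>x. ac_density (x - lam) * g x \<partial>lborel) = (\<integral>x. ac_density x * g (x + lam) \<partial>lborel)"
    using lborel_integral_real_affine[of 1 "\<lambda>x. ac_density (x - lam) * g x" lam] unfolding e by simp
  have 1: "integrable (density lborel (\<lambda>x. ennreal (ac_density (x - lam)))) g"
    using i' g ac_density_nonneg by (subst integrable_density) auto
  have 2: "integrable (density (return borel (a + lam)) (\<lambda>_. ennreal atom_mass)) g"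
    using g atom_mass_facts(3) by (subst integrable_density) (auto simp: integrable_iff_bounded nn_integral_return)
  have "integral\<^sup>L lim_meas g = integral\<^sup>L (density lborel (\<lambda>x. ennreal (ac_density (x - lam)))) g
      + integral\<^sup>L (density (return borel (a + lam)) (\<lambda>_. ennreal atom_mass)) g"
    unfolding lim_meas_def by (rule integral_sum_measure(2)[OF _ 1 2]) simp
  also have "integral\<^sup>L (density lborel (\<lambda>x. ennreal (ac_density (x - lam)))) g = (\<integral>x. ac_density (x - lam) * g x \<partial>lborel)"
    using g ac_density_nonneg by (subst integral_density) auto
  also have "integral\<^sup>L (density (return borel (a + lam)) (\<lambda>_. ennreal atom_mass)) g = atom_mass * g (a + lam)"
    using g atom_mass_facts(3) by (subst integral_density) (auto simp: integral_return)
  finally show ?thesis unfolding eq .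
qed

lemma prob_space_lim_meas: "prob_space lim_meas"
proof
  have "emeasure (density lborel (\<lambda>x. ennreal (ac_density (x - lam)))) UNIV = (\<integral>\<^sup>+x. ennreal (ac_density (x - lam)) \<partial>lborel)"
    by (subst emeasure_density) auto
  also have "\<dots> = (\<integral>\<^sup>+x. ennreal (ac_density x) \<partial>lborel)"
    using nn_integral_real_affine[of "\<lambda>x. ennreal (ac_density (x - lam))" 1 lam] by (simp add: add.commute)
  also have "\<dots> = ennreal (\<integral>x. ac_density x \<partial>lborel)"
    using ac_density_integrable ac_density_nonneg by (intro nn_integral_eq_integral) auto
  finally have "emeasure lim_meas UNIV = ennreal (\<integral>x. ac_density x \<partial>lborel) + ennreal atom_mass"
    by (simp add: emeasure_lim_meas)
  also have "\<dots> = ennreal ((\<integral>x. ac_density x \<partial>lborel) + atom_mass)"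
    using ac_density_nonneg atom_mass_facts(3) by (intro ennreal_plus[symmetric]) (auto intro: integral_nonneg_AE)
  also have "(\<integral>x. ac_density x \<partial>lborel) + atom_mass = 1" using atom_mass_eq by simp
  finally show "emeasure lim_meas (space lim_meas) = 1"
    by (simp add: lim_meas_def)
qed

text \<open>As a < - edge < 0 < \<lambda>, the radius \<open>\<lambda> - a\<close> bounds the atom a
  + \<lambda> as well as all points within \<open>edge\<close> of \<lambda>.\<close>

lemma AE_lim_meas: "AE x in lim_meas. \<bar>x\<bar> \<le> lam - a"
proof (rule AE_I)
  show "{x \<in> space lim_meas. \<not> \<bar>x\<bar> \<le> lam - a} \<subseteq> {x. \<bar>x\<bar> > lam - a}" by auto
  have B: "{x::real. \<bar>x\<bar> > lam - a} \<in> sets borel" by measurable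
  then show "{x. \<bar>x\<bar> > lam - a} \<in> sets lim_meas" by (simp add: sets_lim_meas)
  have "emeasure (density lborel (\<lambda>x. ennreal (ac_density (x - lam)))) {x. \<bar>x\<bar> > lam - a} = 0"
    by (rule emeasure_density_zero[OF B]) (use a lam edge_gt in auto)
  moreover have "\<bar>a + lam\<bar> \<le> lam - a" using a lam edge_gt by linarith
  ultimately show "emeasure lim_meas {x. \<bar>x\<bar> > lam - a} = 0"
    unfolding emeasure_lim_meas[OF B] by (simp add: indicator_def)
qed

lemma lim_meas_stieltjes:
  assumes "y > edge"
  shows "(\<integral>x. 1 / (y + lam - x) \<partial>lim_meas) = 1 / (lam + y * r_outer y)"
proof -
  have c: "continuous_on {- edge..edge} (\<lambda>x. 1 / (y - x))" using assms by (intro continuous_intros) auto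
  have "(\<integral>x. 1 / (y + lam - x) \<partial>lim_meas) = (\<integral>x. ac_density x * (1 / (y + lam - (x + lam))) \<partial>lborel) + atom_mass * (1 / (y + lam - (a + lam)))"
    by (rule lim_meas_integral) (use ac_density_integral(1)[OF c] in simp_all)
  then show ?thesis using stieltjes_formula[OF assms] by simp
qed

text \<open>The moment series at z = y + \<lambda> sums to
  \<open>1 / (\<lambda> + w_euler y N N)\<close> for finite N and to
  \<open>1 / (\<lambda> + y * r_outer y)\<close> for the candidate measure. The first tends to the
  second by \<open>w_euler_limit\<close>, and with x = 1/z
  \<open>power_series_coeff_tendsto_0\<close> carries this over to each moment.\<close>

lemma is_limit_distribution_lim_meas: "is_limit_distribution lam lim_meas"
  unfolding is_limit_distribution_def
proof (intro conjI allI)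
  show "prob_space lim_meas" by (rule prob_space_lim_meas)
  show "sets lim_meas = sets borel" by (rule sets_lim_meas)
  show "\<exists>R. AE x in lim_meas. \<bar>x\<bar> \<le> R" using AE_lim_meas by blast
  fix n
  define r where "r = lam - a"
  have r: "r > 0" using a lam edge_gt by (simp add: r_def)
  define Mo where "Mo = (\<lambda>j. \<integral>x. x ^ j \<partial>lim_meas)"
  interpret prob_space lim_meas by (rule prob_space_lim_meas)
  have fm: "finite_measure lim_meas" by unfold_locales
  have Mo_bound: "\<bar>Mo j\<bar> \<le> r ^ j" for j
  proof -
    have int: "integrable lim_meas (\<lambda>x. x ^ j)" by (rule bounded_powers_integrable[OF fm sets_lim_meas AE_lim_meas])
    have "\<bar>Mo j\<bar> \<le> (\<integral>x. \<bar>x ^ j\<bar> \<partial>lim_meas)" unfolding Mo_def by (rule integral_abs_bound)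
    also have "\<dots> \<le> (\<integral>x. r ^ j \<partial>lim_meas)"
    proof (rule integral_mono_AE)
      show "integrable lim_meas (\<lambda>x. \<bar>x ^ j\<bar>)" using int by (rule integrable_abs)
      show "AE x in lim_meas. \<bar>x ^ j\<bar> \<le> r ^ j" using AE_lim_meas
        by eventually_elim (auto simp: power_abs r_def intro!: power_mono)
    qed simp
    also have "\<dots> = r ^ j" using prob_space by simp
    finally show ?thesis .
  qed
  define C where "C = max r (2 + lam)"
  define d where "d = (\<lambda>N j. vacuum_state (S_op lam N ^^ j) - of_real (Mo j))"
  \<comment> \<open>For z > Z the point y = z - \<lambda> is at least 4, as the Euler estimates
    require, and beyond the edge, as the Stieltjes formula requires; the summand r makes the moment
    series of the candidate converge.\<close>
  define Z where "Z = max (4 + lam) (edge + lam) + r"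
  have Zp: "Z > 0" using lam r by (simp add: Z_def max_def)
  have "(\<lambda>N. d N n) \<longlonglongrightarrow> 0"
  proof (rule power_series_coeff_tendsto_0[of C "1 / Z" d 2])
    show "C > 0" using lam by (simp add: C_def max_def)
    show "1 / Z > 0" using Zp by simp
    show "cmod (d N j) \<le> 2 * C ^ j" if "N \<ge> 1" for N j
    proof -
      have "cmod (d N j) \<le> cmod (vacuum_state (S_op lam N ^^ j)) + \<bar>Mo j\<bar>"
        unfolding d_def using norm_triangle_ineq4[of "vacuum_state (S_op lam N ^^ j)" "of_real (Mo j)"] by simp
      also have "\<dots> \<le> (2 + lam) ^ j + r ^ j" using moment_bound[OF that, of lam j] lam Mo_bound[of j] by simp
      also have "\<dots> \<le> C ^ j + C ^ j" using lam r by (intro add_mono power_mono) (auto simp: C_def)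
      finally show ?thesis by simp
    qed
  next
    fix x :: real assume x: "0 < x" "x < 1 / Z"
    define z where "z = 1 / x"
    have z: "z > Z" "z > 0" using x Zp by (auto simp: z_def field_simps)
    define y where "y = z - lam"
    have y: "y \<ge> 4" "y > edge" "z = y + lam" "z > r" using z r lam by (auto simp: y_def Z_def)
    have Wp: "lam + y * r_outer y > 0"
      using K_upper_real(4)[of y] y lam edge_gt by (intro add_pos_pos mult_pos_pos) auto
    have S1: "(\<lambda>j. Mo j / z ^ Suc j) sums (1 / (lam + y * r_outer y))"
      using moments_sums_stieltjes[OF prob_space_lim_meas sets_lim_meas AE_lim_meas[folded r_def] r y(4)]
      unfolding Mo_def y(3) lim_meas_stieltjes[OF y(2)] .
    have sums: "(\<Sum>j. d N j * of_real x ^ j) = of_real (z * (1 / (lam + w_euler y N N) - 1 / (lam + y * r_outer y)))"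
      if N: "N \<ge> 1" for N
    proof -
      have "(\<lambda>j. of_real z * (vacuum_state (S_op lam N ^^ j) / of_real (y + lam) ^ Suc j - of_real (Mo j / z ^ Suc j)))
        sums (of_real z * (of_real (1 / (lam + w_euler y N N)) - of_real (1 / (lam + y * r_outer y))))"
        by (intro sums_mult sums_diff vacuum_moments_sums N y(1) sums_of_real S1) (use lam in simp)
      moreover have "of_real z * (vacuum_state (S_op lam N ^^ j) / of_real (y + lam) ^ Suc j - of_real (Mo j / z ^ Suc j)) =
          d N j * of_real x ^ j" for j
      proof -
        have "complex_of_real z * of_real x = 1" using x by (simp add: z_def)
        then have zx: "of_real x ^ j * (of_real z ^ j) = (1::complex)"
          by (simp add: power_mult_distrib[symmetric] mult.commute)
        have z0: "complex_of_real z \<noteq> 0" using z by simp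
        have "of_real z * (vacuum_state (S_op lam N ^^ j) / of_real (y + lam) ^ Suc j - of_real (Mo j / z ^ Suc j)) = d N j / of_real z ^ j"
        proof -
          have zy: "complex_of_real (y + lam) = of_real z" by (simp only: y(3))
          have "w * (v / w ^ Suc j - m / w ^ Suc j) = (v - m) / w ^ j" if "w \<noteq> 0" for v m w :: complex
            using that by (simp add: field_simps)
          from this[OF z0] show ?thesis unfolding zy d_def of_real_divide of_real_power .
        qed
        also have "\<dots> = d N j * of_real x ^ j" using zx z0 by (simp add: field_simps)
        finally show ?thesis .
      qed
      ultimately show ?thesis using sums_unique by fastforce
    qed
    have "(\<lambda>N. w_euler y N N) \<longlonglongrightarrow> y * r_outer y" unfolding r_outer_def by (rule w_euler_limit[OF y(1)])
    then have "(\<lambda>N. z * (1 / (lam + w_euler y N N) - 1 / (lam + y * r_outer y))) \<longlonglongrightarrow> z * (1 / (lam + y * r_outer y) - 1 / (lam + y * r_outer y))"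
      using Wp by (intro tendsto_intros) auto
    then have "(\<lambda>N. z * (1 / (lam + w_euler y N N) - 1 / (lam + y * r_outer y))) \<longlonglongrightarrow> 0" by simp
    then have "(\<lambda>N. complex_of_real (z * (1 / (lam + w_euler y N N) - 1 / (lam + y * r_outer y)))) \<longlonglongrightarrow> of_real 0"
      by (rule tendsto_of_real)
    moreover have "eventually (\<lambda>N. of_real (z * (1 / (lam + w_euler y N N) - 1 / (lam + y * r_outer y))) = (\<Sum>j. d N j * of_real x ^ j)) sequentially"
      using eventually_ge_at_top[of 1] by eventually_elim (simp only: sums)
    ultimately show "(\<lambda>N. \<Sum>j. d N j * of_real x ^ j) \<longlonglongrightarrow> 0"
      using Lim_transform_eventually by fastforce
  qed
  from tendsto_add[OF this tendsto_const[of "of_real (Mo n)"]]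
  show "(\<lambda>N. vacuum_state (S_op lam N ^^ n)) \<longlonglongrightarrow> of_real (\<integral>x. x ^ n \<partial>lim_meas)"
    by (simp add: d_def Mo_def)
qed

lemma mu_eq: "mu lam = lim_meas"
  by (rule mu_eqI[OF is_limit_distribution_lim_meas])

text \<open>With G = 1/K the quotient is \<open>1 / (K + \<lambda>)\<close> wherever K is nonzero.
  At the two edges K = 0 and the separately prescribed value 1/\<lambda> is the same expression; at
  the pole both sides are 0 by the convention for division by zero.\<close>

lemma Im_G_lam: "Im (G_lam lam (of_real x)) = - pi * ac_density (x - lam)"
proof -
  define u where "u = x - lam"
  have G: "Gfun (of_real u) = 1 / K_upper (of_real u)" by (rule Gfun_eq) (simp add: upper_half_def)
  have "G_lam lam (of_real x) = 1 / (K_upper (of_real u) + of_real lam)"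
  proof (cases "\<bar>u\<bar> = edge")
    case True
    then have "complex_of_real x = of_real (lam - sqrt (2 + gamma0)) \<or> complex_of_real x = of_real (lam + sqrt (2 + gamma0))"
      unfolding of_real_eq_iff by (auto simp: u_def edge_def)
    then show ?thesis using K_upper_real(5)[OF True] unfolding G_lam_def by (simp only: if_True) simp
  next
    case False
    then have "\<not> (complex_of_real x = of_real (lam - sqrt (2 + gamma0)) \<or> complex_of_real x = of_real (lam + sqrt (2 + gamma0)))"
      unfolding of_real_eq_iff using edge_gt by (auto simp: u_def edge_def)
    then have e: "G_lam lam (of_real x) = (1 / K_upper (of_real u)) / (1 + of_real lam * (1 / K_upper (of_real u)))"
      unfolding G_lam_def G[symmetric] by (simp only: if_False u_def of_real_diff)
    have "K_upper (of_real u) \<noteq> 0"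
    proof (cases "\<bar>u\<bar> < edge")
      case True
      then show ?thesis using K_upper_real(1)[OF True] by auto
    next
      case f: False
      then have "\<bar>u\<bar> > edge" "u \<noteq> 0" using False edge_gt by auto
      then show ?thesis using K_upper_real(2,4)[of u] by (simp add: less_imp_neq[symmetric])
    qed
    then have "(1 / K_upper (of_real u)) / (1 + of_real lam * (1 / K_upper (of_real u))) = 1 / (K_upper (of_real u) + of_real lam)"
      by (cases "K_upper (of_real u) + of_real lam = 0") (auto simp: field_simps eq_neg_iff_add_eq_0)
    then show ?thesis unfolding e .
  qed
  then show ?thesis unfolding u_def[symmetric] by (simp add: ac_density_def)
qed

lemma shifted_ac_density_integrable: "integrable lborel (\<lambda>x. ac_density (x - lam))"
  using lborel_integrable_real_affine_iff[of 1 "\<lambda>x. ac_density (x - lam)" lam] ac_density_integrable by simp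

lemma measure_mu:
  assumes "B \<in> sets borel"
  shows "measure (mu lam) B = atom_mass * measure (return borel (a + lam)) B + (LINT x:B|lborel. ac_density (x - lam))"
proof -
  interpret prob_space lim_meas by (rule prob_space_lim_meas)
  have B': "B \<in> sets lim_meas" using assms by (simp add: sets_lim_meas)
  have "integrable lborel (\<lambda>x. indicator B x *\<^sub>R ac_density (x - lam))"
    by (rule integrable_mult_indicator[OF _ shifted_ac_density_integrable]) (use assms in simp)
  then have i: "integrable lborel (\<lambda>x. indicator B (x + lam) *\<^sub>R ac_density x)"
    using lborel_integrable_real_affine_iff[of 1 "\<lambda>x. indicator B x *\<^sub>R ac_density (x - lam)" lam] by (simp add: add.commute)
  have e: "(\<integral>x. indicator B x *\<^sub>R ac_density (x - lam) \<partial>lborel) = (\<integral>x. indicator B (x + lam) *\<^sub>R ac_density x \<partial>lborel)"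
    using lborel_integral_real_affine[of 1 "\<lambda>x. indicator B x *\<^sub>R ac_density (x - lam)" lam] by (simp add: add.commute)
  have "measure lim_meas B = (\<integral>x. indicator B x \<partial>lim_meas)" using B' by simp
  also have "\<dots> = (\<integral>x. ac_density x * indicator B (x + lam) \<partial>lborel) + atom_mass * indicator B (a + lam)"
    by (rule lim_meas_integral) (use assms i in \<open>simp_all add: mult.commute\<close>)
  finally show ?thesis
    unfolding mu_eq set_lebesgue_integral_def e using assms by (simp add: measure_return mult.commute)
qed

text \<open>The null set carrying the singular part is the single point a + \<lambda>. It lies
  outside the interval around \<lambda> on which the density lives, because a is beyond the edge, so
  intersecting with it isolates exactly the atom.\<close>

lemma ac_part_mu: "ac_part (mu lam) = density lborel (\<lambda>x. ennreal (ac_density (x - lam)))"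
proof (rule ac_part_eqI)
  let ?D = "density lborel (\<lambda>x. ennreal (ac_density (x - lam)))"
  have p: "{a + lam} \<in> null_sets lborel" by (rule finite_imp_null_set_lborel) simp
  have "emeasure lim_meas B = emeasure ?D B + emeasure lim_meas (B \<inter> {a + lam})" if B: "B \<in> sets borel" for B
  proof -
    have "emeasure ?D (B \<inter> {a + lam}) = 0"
      by (rule emeasure_density_zero) (use B a edge_gt in auto)
    moreover have "B \<inter> {a + lam} \<in> sets borel" using B by auto
    ultimately show ?thesis using emeasure_lim_meas[OF B] emeasure_lim_meas[of "B \<inter> {a + lam}"]
      by (simp add: indicator_def)
  qed
  moreover have "absolutely_continuous lborel ?D" by (rule absolutely_continuousI_density) measurable
  moreover have "sets ?D = sets borel" by simp
  ultimately show "is_ac_part (mu lam) ?D"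
    unfolding is_ac_part_def mu_eq using p by blast
qed

lemma AE_ac_part: "AE x in ac_part (mu lam). x \<in> {lam - edge..lam + edge}"
proof -
  have m: "(\<lambda>x. ennreal (ac_density (x - lam))) \<in> borel_measurable lborel" by measurable
  have "x \<in> {lam - edge..lam + edge}" if "0 < ennreal (ac_density (x - lam))" for x
  proof (rule ccontr)
    assume "x \<notin> {lam - edge..lam + edge}"
    then have "edge \<le> \<bar>x - lam\<bar>" by auto
    from pole_ratio_real(2)[OF this] show False using that by simp
  qed
  then show ?thesis unfolding ac_part_mu AE_density[OF m] by (intro AE_I2 impI)
qed

end

theorem theorem6p10:
  fixes lam a :: real
  assumes "lam > 0" and "a = a_lam lam"
  shows "integrable lborel (\<lambda>x. Im (G_lam lam (complex_of_real x)))
    \<and> (\<forall>B\<in>sets borel. measure (mu lam) B =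
          lam * (2 - a\<^sup>2) / (lam\<^sup>2 * a + 2 * lam + 2 * a) * measure (return borel (a + lam)) B
          + (LINT x:B|lborel. - Im (G_lam lam (complex_of_real x)) / pi))
    \<and> (AE x in ac_part (mu lam). x \<in> {lam - sqrt (2 + gamma0)..lam + sqrt (2 + gamma0)})"
proof -
  interpret pole lam a
    using a_lam_props[OF assms(1)] assms by unfold_locales auto
  have "integrable lborel (\<lambda>x. Im (G_lam lam (complex_of_real x)))"
    unfolding Im_G_lam using shifted_ac_density_integrable by simp
  moreover have "- Im (G_lam lam (complex_of_real x)) / pi = ac_density (x - lam)" for x
    unfolding Im_G_lam by simp
  ultimately show ?thesis
    using measure_mu AE_ac_part unfolding atom_mass_def edge_def by simp
qed

end
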